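(* Let $\mathcal{O},\mathcal{P}$ be smooth orbifolds (without boundary) with $\dim\mathcal{O}\ge\dim\mathcal{P}$. Let $(f,\{\tilde f_x\},\{\Theta_{f,x}\}):\mathcal{O}\to\mathcal{P}$ be a smooth complete orbifold map and let $p\in\mathcal{P}$ be a regular value of $f$. Then $\mathcal{S}=f^{-1}(p)$ has the structure of a full smooth suborbifold of $\mathcal{O}$ of dimension $\dim\mathcal{S}=\dim\mathcal{O}-\dim\mathcal{P}$. Moreover, for each $x\in\mathcal{S}$ the local isotropy group of $\mathcal{S}$ at $x$ is $\Gamma_{x,\mathcal{S}}=\Gamma_{x,\mathcal{O}}/G_{x,\mathcal{O}}$, where $$G_{x,\mathcal{O}}=\{\gamma\in\Gamma_{x,\mathcal{O}}\mid d\gamma|_{\ker(d\tilde f_x(\tilde x))}=\mathrm{Id}\}$$ and $d\gamma$ denotes the differential at $\tilde x$ of the action of $\gamma$ on $\tilde U_x$.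
   Context: Smooth means $C^\infty$. Orbifold. An $n$-dimensional smooth orbifold $\mathcal{O}$ consists of a paracompact Hausdorff space $X_{\mathcal{O}}$ (the underlying space) with the following local structure. For each $x\in X_{\mathcal{O}}$ and neighborhood $U$ of $x$ there are a neighborhood $U_x\subset U$ of $x$, an open set $\tilde U_x$ diffeomorphic to $\mathbb{R}^n$, a finite group $\Gamma_x$ acting smoothly and effectively on $\tilde U_x$ and fixing $0\in\tilde U_x$, and a homeomorphism $\phi_x:\tilde U_x/\Gamma_x\to U_x$ with $\phi_x(0)=x$. These satisfy: if $U_z\subset U_x$ is another such neighborhood with data $\tilde U_z,\Gamma_z,\phi_z$, there are a smooth embedding $\tilde\psi_{zx}:\tilde U_z\to\tilde U_x$ and an injective homomorphism $\theta_{zx}:\Gamma_z\to\Gamma_x$ such that $\tilde\psi_{zx}$ is $\theta_{zx}$-equivariant and covers the inclusion $U_z\subset U_x$. The tuple $(\tilde U_x,\Gamma_x,\rho_x,\phi_x)$, with $\rho_x:\Gamma_x\to\mathrm{Diff}^\infty(\tilde U_x)$ the action, is called an orbifold chart at $x$, and $\Gamma_x=\Gamma_{x,\mathcal{O}}$ the isotropy group of $x$ (well defined up to isomorphism). Write $\tilde x$ for the point $0\in\tilde U_x$ lying over $x$. Suborbifold. A suborbifold $\mathcal{S}$ of $\mathcal{O}$ is a subspace $X_{\mathcal{S}}\subset X_{\mathcal{O}}$ with the subspace topology such that for each $x\in X_{\mathcal{S}}$ and neighborhood $W$ of $x$ in $X_{\mathcal{O}}$ there are an orbifold chart $(\tilde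 U_x,\Gamma_x,\rho_x,\phi_x)$ of $\mathcal{O}$ at $x$ with $U_x\subset W$, a subgroup $\Lambda_x\subset\Gamma_x$, and a $\rho_x(\Lambda_x)$-invariant linear submanifold $\tilde V_x\subset\tilde U_x\cong\mathbb{R}^n$ such that, with $\Omega_x=\{\gamma\in\Lambda_x\mid\rho_x(\gamma)|_{\tilde V_x}=\mathrm{Id}\}$, $(\tilde V_x,\Lambda_x/\Omega_x,\rho_x|_{\Lambda_x},\psi_x)$ is an orbifold chart for $\mathcal{S}$ at $x$ with $V_x=\psi_x(\tilde V_x/\rho_x(\Lambda_x))=U_x\cap X_{\mathcal{S}}$. The (intrinsic) isotropy group of $\mathcal{S}$ at $x$ is $\Gamma_{x,\mathcal{S}}=\Lambda_x/\Omega_x$. The suborbifold is full if $\Lambda_x=\Gamma_x$ for all $x\in\mathcal{S}$. Complete orbifold map. A smooth complete orbifold map $(f,\{\tilde f_x\},\{\Theta_{f,x}\}):\mathcal{O}\to\mathcal{P}$ consists of a continuous map $f:X_{\mathcal{O}}\to X_{\mathcal{P}}$ and, for each $x\in\mathcal{O}$, a group homomorphism $\Theta_{f,x}:\Gamma_x\to\Gamma_{f(x)}$ and a smooth $\Theta_{f,x}$-equivariant map $\tilde f_x:\tilde U_x\to\tilde V_{f(x)}$ covering $f|_{U_x}$, where $(\tilde U_x,\Gamma_x)$ and $(\tilde V_{f(x)},\Gamma_{f(x)})$ are orbifold charts at $x$ and $f(x)$. Two such maps are identified if for each $x$ the lifts agree as germs at $\tilde x$ and the homomorphisms agree. Regular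 value. A point $p\in\mathcal{P}$ is a regular value of $f$ if the differential $d\tilde f_x(\tilde x):T_{\tilde x}\tilde U_x\to T_{\tilde p}\tilde V_p$ is surjective for all $x\in f^{-1}(p)$. In particular, points $p\notin f(\mathcal{O})$ are regular values. *)

theory Defs
  imports "HOL-Analysis.Analysis" "HOL-Algebra.Coset" "HOL-Algebra.Group_Action"
begin

section \<open>Smooth maps\<close>

text \<open>Being of class $C^k$ on an open set: differentiable there, with all directional
  derivatives of class $C^{k-1}$.\<close>

primrec Ck_on :: "nat \<Rightarrow> 'a::euclidean_space set \<Rightarrow> ('a \<Rightarrow> 'b::euclidean_space) \<Rightarrow> bool" where
  "Ck_on 0 W f \<longleftrightarrow> continuous_on W f"
| "Ck_on (Suc k) W f \<longleftrightarrow>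
     (\<forall>x\<in>W. f differentiable (at x)) \<and> (\<forall>v. Ck_on k W (\<lambda>x. frechet_derivative f (at x) v))"

text \<open>On a set that need not be open, a map is smooth if it extends locally to a smooth map on an
  open set. This is applied to relatively open subsets of linear subspaces.\<close>

definition smooth_on :: "'a::euclidean_space set \<Rightarrow> ('a \<Rightarrow> 'b::euclidean_space) \<Rightarrow> bool" where
  "smooth_on A f \<longleftrightarrow>
     (\<forall>x\<in>A. \<exists>W g. open W \<and> x \<in> W \<and> (\<forall>k. Ck_on k W g) \<and> (\<forall>y\<in>A \<inter> W. f y = g y))"

definition diffeomorphism ::
    "'a::euclidean_space set \<Rightarrow> 'b::euclidean_space set \<Rightarrow> ('a \<Rightarrow> 'b) \<Rightarrow> bool" where
  "diffeomorphism A B f \<longleftrightarrow> bij_betw f A B \<and> smooth_on A f \<and> smooth_on B (inv_into A f)"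

definition diffeomorphic :: "'a::euclidean_space set \<Rightarrow> 'b::euclidean_space set \<Rightarrow> bool" where
  "diffeomorphic A B \<longleftrightarrow> (\<exists>f. diffeomorphism A B f)"

definition smooth_embedding ::
    "'a::euclidean_space set \<Rightarrow> 'b::euclidean_space set \<Rightarrow> ('a \<Rightarrow> 'b) \<Rightarrow> bool" where
  "smooth_embedding A B f \<longleftrightarrow> f ` A \<subseteq> B \<and> diffeomorphism A (f ` A) f"

definition paracompact_space :: "'x topology \<Rightarrow> bool" where
  "paracompact_space X \<longleftrightarrow>
     (\<forall>\<U>. (\<forall>U\<in>\<U>. openin X U) \<and> \<Union>\<U> = topspace X \<longrightarrow>
       (\<exists>\<V>. (\<forall>V\<in>\<V>. openin X V \<and> (\<exists>U\<in>\<U>. V \<subseteq> U)) \<and> \<Union>\<V> = topspace X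
          \<and> locally_finite_in X \<V>))"

section \<open>Orbifold charts\<close>

text \<open>The copy of $R^n$ in which the chart domain lies is an $n$-dimensional linear subspace
  \<open>cmodel\<close> of an ambient Euclidean space \<open>'a\<close>, which may vary with the chart. Thus $n$ is a natural
  number, $n = 0$ is allowed, and the charts of a suborbifold, whose domains lie in smaller
  subspaces, have the same type. The tangent space of the domain at any point is \<open>cmodel\<close>.

  The homeomorphism from the orbit space to the open set \<open>csupp\<close> is given by its composition
  \<open>cproj\<close> with the projection to the orbit space: a quotient map onto \<open>csupp\<close> whose fibres are the
  orbits.\<close>

record ('x, 'a, 'g) orbichart =
  cmodel :: "'a set"
  cdom :: "'a set"
  cgroup :: "'g monoid"
  cact :: "'g \<Rightarrow> 'a \<Rightarrow> 'a"
  cproj :: "'a \<Rightarrow> 'x"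

definition csupp :: "('x, 'a, 'g) orbichart \<Rightarrow> 'x set" where
  "csupp c = cproj c ` cdom c"

definition ccentre :: "('x, 'a::euclidean_space, 'g) orbichart \<Rightarrow> 'x" where
  "ccentre c = cproj c 0"

definition orbifold_chart ::
    "nat \<Rightarrow> 'x topology \<Rightarrow> ('x, 'a::euclidean_space, 'g) orbichart \<Rightarrow> bool" where
  "orbifold_chart n X c \<longleftrightarrow>
     subspace (cmodel c) \<and> dim (cmodel c) = n \<and>
     openin (top_of_set (cmodel c)) (cdom c) \<and> 0 \<in> cdom c \<and> diffeomorphic (cdom c) (cmodel c) \<and>
     finite (carrier (cgroup c)) \<and> faithful_action (cgroup c) (cdom c) (cact c) \<and>
     (\<forall>g\<in>carrier (cgroup c). smooth_on (cdom c) (cact c g) \<and> cact c g 0 = 0) \<and>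
     openin X (csupp c) \<and>
     quotient_map (top_of_set (cdom c)) (subtopology X (csupp c)) (cproj c) \<and>
     (\<forall>y\<in>cdom c. \<forall>z\<in>cdom c. cproj c y = cproj c z \<longleftrightarrow> z \<in> orbit (cgroup c) (cact c) y)"

definition chart_embedding ::
    "('x, 'a::euclidean_space, 'g) orbichart \<Rightarrow> ('x, 'a, 'g) orbichart
      \<Rightarrow> ('a \<Rightarrow> 'a) \<Rightarrow> ('g \<Rightarrow> 'g) \<Rightarrow> bool" where
  "chart_embedding c d \<psi> \<theta> \<longleftrightarrow>
     smooth_embedding (cdom c) (cdom d) \<psi> \<and>
     \<theta> \<in> hom (cgroup c) (cgroup d) \<and> inj_on \<theta> (carrier (cgroup c)) \<and>
     (\<forall>g\<in>carrier (cgroup c). \<forall>y\<in>cdom c. \<psi> (cact c g y) = cact d (\<theta> g) (\<psi> y)) \<and>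
     (\<forall>y\<in>cdom c. cproj d (\<psi> y) = cproj c y)"

section \<open>Orbifolds\<close>

record ('x, 'a, 'g) orbifold =
  ospace :: "'x topology"
  odim :: nat
  oatlas :: "('x, 'a, 'g) orbichart set"

definition smooth_orbifold :: "('x, 'a::euclidean_space, 'g) orbifold \<Rightarrow> bool" where
  "smooth_orbifold Q \<longleftrightarrow>
     Hausdorff_space (ospace Q) \<and> paracompact_space (ospace Q) \<and>
     (\<forall>c\<in>oatlas Q. orbifold_chart (odim Q) (ospace Q) c) \<and>
     (\<forall>x U. openin (ospace Q) U \<and> x \<in> U \<longrightarrow>
        (\<exists>c\<in>oatlas Q. ccentre c = x \<and> csupp c \<subseteq> U)) \<and>
     (\<forall>c\<in>oatlas Q. \<forall>d\<in>oatlas Q. csupp c \<subseteq> csupp d \<longrightarrow> (\<exists>\<psi> \<theta>. chart_embedding c d \<psi> \<theta>))"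

text \<open>The atlas is not assumed to be maximal. The orbifold charts of \<open>Q\<close> are therefore all charts
  compatible with the atlas, in the sense that at each point of their support some atlas chart
  embeds into them.\<close>

definition chart_of ::
    "('x, 'a::euclidean_space, 'g) orbifold \<Rightarrow> ('x, 'a, 'g) orbichart \<Rightarrow> bool" where
  "chart_of Q c \<longleftrightarrow>
     orbifold_chart (odim Q) (ospace Q) c \<and>
     (\<forall>y\<in>csupp c. \<exists>w\<in>oatlas Q. ccentre w = y \<and> csupp w \<subseteq> csupp c \<and>
        (\<exists>\<psi> \<theta>. chart_embedding w c \<psi> \<theta>))"

lemma chart_of_atlas:
  assumes "smooth_orbifold Q" "c \<in> oatlas Q"
  shows "chart_of Q c"
proof -
  have "openin (ospace Q) (csupp c)"
    using assms by (auto simp: smooth_orbifold_def orbifold_chart_def)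
  then show ?thesis
    using assms unfolding smooth_orbifold_def chart_of_def by meson
qed

section \<open>Suborbifolds\<close>

definition pointwise_stabilizer ::
    "('x, 'a, 'g) orbichart \<Rightarrow> 'g set \<Rightarrow> 'a set \<Rightarrow> 'g set" where
  "pointwise_stabilizer c \<Lambda> V = {g\<in>\<Lambda>. \<forall>y\<in>V. cact c g y = y}"

text \<open>The chart induced by a subgroup \<open>\<Lambda>\<close> on the linear submanifold \<open>cdom c \<inter> L\<close>. A coset in
  $\Lambda/\Omega$ acts through any of its representatives.\<close>

definition induced_chart ::
    "('x, 'a, 'g) orbichart \<Rightarrow> 'g set \<Rightarrow> 'a set \<Rightarrow> ('x, 'a, 'g set) orbichart" where
  "induced_chart c \<Lambda> L =
     \<lparr>cmodel = L,
      cdom = cdom c \<inter> L,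
      cgroup = (cgroup c)\<lparr>carrier := \<Lambda>\<rparr> Mod pointwise_stabilizer c \<Lambda> (cdom c \<inter> L),
      cact = (\<lambda>C. restrict (cact c (SOME g. g \<in> C)) (cdom c \<inter> L)),
      cproj = cproj c\<rparr>"

definition suborbifold_chart ::
    "('x, 'a::euclidean_space, 'g) orbifold \<Rightarrow> ('x, 'a, 'g set) orbifold
      \<Rightarrow> ('x, 'a, 'g) orbichart \<Rightarrow> 'g set \<Rightarrow> 'a set \<Rightarrow> bool" where
  "suborbifold_chart Q S c \<Lambda> L \<longleftrightarrow>
     chart_of Q c \<and> subgroup \<Lambda> (cgroup c) \<and> subspace L \<and> L \<subseteq> cmodel c \<and>
     (\<forall>g\<in>\<Lambda>. cact c g ` (cdom c \<inter> L) = cdom c \<inter> L) \<and>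
     chart_of S (induced_chart c \<Lambda> L) \<and>
     csupp (induced_chart c \<Lambda> L) = csupp c \<inter> topspace (ospace S)"

definition suborbifold ::
    "('x, 'a::euclidean_space, 'g) orbifold \<Rightarrow> ('x, 'a, 'g set) orbifold \<Rightarrow> bool" where
  "suborbifold Q S \<longleftrightarrow>
     smooth_orbifold S \<and>
     topspace (ospace S) \<subseteq> topspace (ospace Q) \<and>
     ospace S = subtopology (ospace Q) (topspace (ospace S)) \<and>
     (\<forall>x\<in>topspace (ospace S). \<forall>W. openin (ospace Q) W \<and> x \<in> W \<longrightarrow>
        (\<exists>c \<Lambda> L. ccentre c = x \<and> csupp c \<subseteq> W \<and> suborbifold_chart Q S c \<Lambda> L))"

text \<open>The same \<open>cdom c \<inter> L\<close> can arise from several \<open>\<Lambda>\<close>; full means that the full isotropy groups are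
  one admissible choice of the $\Lambda_x$.\<close>

definition full_suborbifold ::
    "('x, 'a::euclidean_space, 'g) orbifold \<Rightarrow> ('x, 'a, 'g set) orbifold \<Rightarrow> bool" where
  "full_suborbifold Q S \<longleftrightarrow>
     suborbifold Q S \<and>
     (\<forall>x\<in>topspace (ospace S). \<forall>W. openin (ospace Q) W \<and> x \<in> W \<longrightarrow>
        (\<exists>c L. ccentre c = x \<and> csupp c \<subseteq> W \<and>
           suborbifold_chart Q S c (carrier (cgroup c)) L))"

section \<open>Complete orbifold maps\<close>

text \<open>A representative of a complete orbifold map: besides the map it records, for each \<open>x\<close>, the
  charts at \<open>x\<close> and at its image between which the lift is defined.\<close>

record ('x, 'a, 'g, 'y, 'b, 'h) orbimap =
  mfun :: "'x \<Rightarrow> 'y"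
  msrc :: "'x \<Rightarrow> ('x, 'a, 'g) orbichart"
  mtgt :: "'x \<Rightarrow> ('y, 'b, 'h) orbichart"
  mlift :: "'x \<Rightarrow> 'a \<Rightarrow> 'b"
  mhom :: "'x \<Rightarrow> 'g \<Rightarrow> 'h"

definition complete_orbifold_map ::
    "('x, 'a::euclidean_space, 'g) orbifold \<Rightarrow> ('y, 'b::euclidean_space, 'h) orbifold
      \<Rightarrow> ('x, 'a, 'g, 'y, 'b, 'h) orbimap \<Rightarrow> bool" where
  "complete_orbifold_map Q P F \<longleftrightarrow>
     continuous_map (ospace Q) (ospace P) (mfun F) \<and>
     (\<forall>x\<in>topspace (ospace Q).
        chart_of Q (msrc F x) \<and> ccentre (msrc F x) = x \<and>
        chart_of P (mtgt F x) \<and> ccentre (mtgt F x) = mfun F x \<and>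
        mhom F x \<in> hom (cgroup (msrc F x)) (cgroup (mtgt F x)) \<and>
        smooth_on (cdom (msrc F x)) (mlift F x) \<and>
        mlift F x ` cdom (msrc F x) \<subseteq> cdom (mtgt F x) \<and>
        (\<forall>g\<in>carrier (cgroup (msrc F x)). \<forall>y\<in>cdom (msrc F x).
           mlift F x (cact (msrc F x) g y) = cact (mtgt F x) (mhom F x g) (mlift F x y)) \<and>
        (\<forall>y\<in>cdom (msrc F x).
           cproj (mtgt F x) (mlift F x y) = mfun F (cproj (msrc F x) y)))"

text \<open>The differential, at the point over the centre, of a map defined on the domain of a chart. It
  is to be evaluated on \<open>cmodel c\<close> only, where the derivative is unique.\<close>

definition differential ::
    "('x, 'a::euclidean_space, 'g) orbichart \<Rightarrow> ('a \<Rightarrow> 'b::euclidean_space) \<Rightarrow> 'a \<Rightarrow> 'b" where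
  "differential c f = frechet_derivative f (at 0 within cdom c)"

lemma differential_unique:
  assumes c: "orbifold_chart n X c"
    and D: "(f has_derivative D) (at 0 within cdom c)" and v: "v \<in> cmodel c"
  shows "differential c f v = D v"
proof -
  have E: "subspace (cmodel c)" "openin (top_of_set (cmodel c)) (cdom c)" "0 \<in> cdom c"
    using c by (auto simp: orbifold_chart_def)
  obtain W where W: "open W" "cdom c = cmodel c \<inter> W"
    using E(2) by (auto simp: openin_open)
  define T where "T = (\<lambda>t::real. t *\<^sub>R v) -` W"
  have T: "open T" "0 \<in> T"
    using W E(3) unfolding T_def by (auto intro!: continuous_open_vimage continuous_intros)
  have sub: "(\<lambda>t. t *\<^sub>R v) ` T \<subseteq> cdom c"
    using v E(1) W(2) by (auto simp: T_def subspace_scale)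
  have line: "((\<lambda>t. f (t *\<^sub>R v)) has_derivative (\<lambda>t. D' (t *\<^sub>R v))) (at 0)"
    if D': "(f has_derivative D') (at 0 within cdom c)" for D'
  proof -
    have "((\<lambda>t. t *\<^sub>R v) has_derivative (\<lambda>t. t *\<^sub>R v)) (at (0::real) within T)"
      by (auto intro!: derivative_eq_intros)
    moreover have "(f has_derivative D') (at (0 *\<^sub>R v) within (\<lambda>t. t *\<^sub>R v) ` T)"
      using has_derivative_subset[OF D' sub] by simp
    ultimately have "(f \<circ> (\<lambda>t. t *\<^sub>R v) has_derivative D' \<circ> (\<lambda>t. t *\<^sub>R v)) (at (0::real) within T)"
      by (rule diff_chain_within)
    then show ?thesis
      using T by (simp add: o_def at_within_open[of 0 T])
  qed
  have "(f has_derivative differential c f) (at 0 within cdom c)"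
    using D unfolding differential_def by (metis differentiableI frechet_derivative_works)
  from has_derivative_unique[OF line[OF this] line[OF D]] show ?thesis
    by (metis scaleR_one)
qed

definition regular_value ::
    "('x, 'a::euclidean_space, 'g) orbifold \<Rightarrow> ('y, 'b::euclidean_space, 'h) orbifold
      \<Rightarrow> ('x, 'a, 'g, 'y, 'b, 'h) orbimap \<Rightarrow> 'y \<Rightarrow> bool" where
  "regular_value Q P F p \<longleftrightarrow>
     p \<in> topspace (ospace P) \<and>
     (\<forall>x\<in>topspace (ospace Q). mfun F x = p \<longrightarrow>
        differential (msrc F x) (mlift F x) ` cmodel (msrc F x) = cmodel (mtgt F x))"

definition lift_kernel ::
    "('x, 'a::euclidean_space, 'g, 'y, 'b::euclidean_space, 'h) orbimap \<Rightarrow> 'x \<Rightarrow> 'a set" where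
  "lift_kernel F x = {v \<in> cmodel (msrc F x). differential (msrc F x) (mlift F x) v = 0}"

definition kernel_fixer ::
    "('x, 'a::euclidean_space, 'g, 'y, 'b::euclidean_space, 'h) orbimap \<Rightarrow> 'x \<Rightarrow> 'g set" where
  "kernel_fixer F x =
     {g \<in> carrier (cgroup (msrc F x)).
        \<forall>v\<in>lift_kernel F x. differential (msrc F x) (cact (msrc F x) g) v = v}"

end

theory Submission
  imports Defs "HOL-Algebra.Multiplicative_Group"
begin

text \<open>At a point \<open>x\<close> of the preimage, averaging over the isotropy group turns \<open>y - s (T y) + s (f y)\<close>
  into a local diffeomorphism that linearizes the action; here \<open>f\<close> is the lift, \<open>T\<close> its differential
  at the centre and \<open>s\<close> a linear right inverse of \<open>T\<close>. Its composition with \<open>T\<close> factors as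
  \<open>\<eta> \<circ> f\<close> with \<open>\<eta>\<close> locally injective, so the preimage becomes the kernel of \<open>T\<close>, on which the group
  acts linearly. Balls of an invariant quadratic form then give slice charts at \<open>x\<close>.

  An element of a chart group that is the identity on a nonempty open set is trivial. Hence translates
  of the image of a chart under an embedding are equal or disjoint, and two charts that embed in a
  common one embed in each other as soon as their supports are nested. Since the atlas need not be
  maximal, the slice charts of the preimage are taken so small, relative to a point-finite cover by base
  charts, that any two with nested supports embed in a common base chart.\<close>

section \<open>Differentiability of class $C^k$\<close>

text \<open>A suborbifold chart must be cut out by a linear subspace, whereas the zero set of the
  lift is only a submanifold, on which the chart group acts nonlinearly; one equivariant change of
  coordinates has to straighten both. Without averaging, the coordinate map has \<open>f\<close>
  itself as its image under \<open>T\<close>, but it need not be equivariant. Averaging restores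
  equivariance and spoils this identity, because the target group acts nonlinearly too; the map
  \<open>\<eta>\<close> measures the defect. Fullness costs nothing: the slice is everything in the
  chart that lies over the preimage, hence a union of orbits of the whole chart group. Linearity of
  the action is used once more for the quotient groups. An embedding of charts sees only an open
  piece of the larger slice, and elements that agree on that piece must agree on the entire slice
  before a homomorphism between the quotients exists. For the same reason the pointwise stabilizer
  of a small slice is the group fixing the whole kernel.\<close>

lemma Ck_on_subset: "Ck_on k W f \<Longrightarrow> V \<subseteq> W \<Longrightarrow> Ck_on k V f"
  by (induction k arbitrary: f) (auto intro: continuous_on_subset)

text \<open>\<open>frechet_derivative\<close> is a choice among derivatives; both functions have
  exactly the same derivatives at \<open>x\<close>, so the choices coincide, even where there is
  none.\<close>

lemma frechet_derivative_cong_open: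
  assumes "open W" "\<And>x. x \<in> W \<Longrightarrow> f x = g x" "x \<in> W"
  shows "frechet_derivative f (at x) = frechet_derivative g (at x)"
proof -
  have "(f has_derivative D) (at x) \<longleftrightarrow> (g has_derivative D) (at x)" for D
    using assms by (metis has_derivative_transform_within_open)
  then show ?thesis
    unfolding frechet_derivative_def by simp
qed

lemma Ck_on_cong:
  assumes "open W" "\<And>x. x \<in> W \<Longrightarrow> f x = g x" "Ck_on k W f"
  shows "Ck_on k W g"
  using assms(2,3)
proof (induction k arbitrary: f g)
  case 0
  then show ?case by (simp cong: continuous_on_cong)
next
  case (Suc k)
  have "g differentiable (at x)" if "x \<in> W" for x
    using Suc.prems that \<open>open W\<close> unfolding differentiable_def
    by (metis Ck_on.simps(2) differentiable_def has_derivative_transform_within_open)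
  moreover have "Ck_on k W (\<lambda>x. frechet_derivative g (at x) v)" for v
    using Suc.IH[of "\<lambda>x. frechet_derivative f (at x) v" "\<lambda>x. frechet_derivative g (at x) v"]
      frechet_derivative_cong_open[OF \<open>open W\<close> Suc.prems(1)] Suc.prems(2) by simp
  ultimately show ?case by simp
qed

lemma Ck_on_local:
  assumes "\<And>x. x \<in> W \<Longrightarrow> \<exists>V. open V \<and> x \<in> V \<and> Ck_on k V f"
  shows "Ck_on k W f"
  using assms
proof (induction k arbitrary: f)
  case 0
  then show ?case
    by (metis Ck_on.simps(1) continuous_at_imp_continuous_on continuous_on_eq_continuous_at)
next
  case (Suc k)
  have "f differentiable (at x)" if "x \<in> W" for x
    using Suc.prems[OF that] by auto
  moreover have "Ck_on k W (\<lambda>x. frechet_derivative f (at x) v)" for v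
  proof (rule Suc.IH)
    fix x assume "x \<in> W"
    from Suc.prems[OF this] show "\<exists>V. open V \<and> x \<in> V \<and> Ck_on k V (\<lambda>x. frechet_derivative f (at x) v)"
      by auto
  qed
  ultimately show ?case by simp
qed

lemma Ck_on_Suc_imp: "Ck_on (Suc k) W f \<Longrightarrow> Ck_on k W f"
proof (induction k arbitrary: f)
  case 0
  then show ?case
    by (auto intro: continuous_at_imp_continuous_on differentiable_imp_continuous_within)
qed simp

lemma Ck_on_has_derivative:
  "Ck_on (Suc k) W f \<Longrightarrow> x \<in> W \<Longrightarrow> (f has_derivative frechet_derivative f (at x)) (at x)"
  by (simp add: frechet_derivative_works)

text \<open>The derivative may be supplied in whatever form a calculus rule yields it, instead of
  through the choice operator.\<close>

lemma Ck_on_SucI: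
  assumes "open W" "\<And>x. x \<in> W \<Longrightarrow> (f has_derivative D x) (at x)"
    and "\<And>v. Ck_on k W (\<lambda>x. D x v)"
  shows "Ck_on (Suc k) W f"
proof -
  have "Ck_on k W (\<lambda>x. frechet_derivative f (at x) v)" for v
    by (rule Ck_on_cong[OF assms(1) _ assms(3)]) (simp add: frechet_derivative_at[OF assms(2)])
  with assms(2) show ?thesis by (auto simp: differentiable_def)
qed

lemma Ck_on_const: "open W \<Longrightarrow> Ck_on k W (\<lambda>x. c)"
  by (induction k arbitrary: c) (auto simp: frechet_derivative_const)

lemma Ck_on_linear: "open W \<Longrightarrow> linear f \<Longrightarrow> Ck_on k W f"
proof (cases k)
  case (Suc m)
  assume "open W" "linear f"
  then show ?thesis
    unfolding Suc
    by (intro Ck_on_SucI[where D="\<lambda>_. f"] Ck_on_const)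
      (auto simp: linear_imp_has_derivative)
qed (auto simp: linear_continuous_on linear_linear)

lemma Ck_on_add:
  "open W \<Longrightarrow> Ck_on k W f \<Longrightarrow> Ck_on k W g \<Longrightarrow> Ck_on k W (\<lambda>x. f x + g x)"
proof (induction k arbitrary: f g)
  case (Suc k)
  show ?case
    by (rule Ck_on_SucI[OF \<open>open W\<close> has_derivative_add[OF Ck_on_has_derivative[OF Suc.prems(2)]
            Ck_on_has_derivative[OF Suc.prems(3)]]])
      (use Suc in auto)
qed (auto intro: continuous_on_add)

lemma Ck_on_sum:
  "open W \<Longrightarrow> (\<And>i. i \<in> I \<Longrightarrow> Ck_on k W (f i)) \<Longrightarrow> Ck_on k W (\<lambda>x. \<Sum>i\<in>I. f i x)"
  by (induction I rule: infinite_finite_induct) (auto intro: Ck_on_add Ck_on_const)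

lemma Ck_on_scaleR:
  "open W \<Longrightarrow> Ck_on k W f \<Longrightarrow> Ck_on k W g \<Longrightarrow> Ck_on k W (\<lambda>x. f x *\<^sub>R g x)"
proof (induction k arbitrary: f g)
  case (Suc k)
  show ?case
    by (rule Ck_on_SucI[OF \<open>open W\<close> has_derivative_scaleR[OF Ck_on_has_derivative[OF Suc.prems(2)]
            Ck_on_has_derivative[OF Suc.prems(3)]]])
      (use Suc Ck_on_Suc_imp[OF Suc.prems(2)] Ck_on_Suc_imp[OF Suc.prems(3)]
        in \<open>auto intro!: Ck_on_add\<close>)
qed (auto intro: continuous_on_scaleR)

text \<open>Turns a linear map at a varying argument into a finite sum of scalar multiples of its
  values at fixed vectors; \<open>Ck_on\<close> controls derivatives only in a fixed
  direction.\<close>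

lemma linear_sum_Basis:
  fixes f :: "'a::euclidean_space \<Rightarrow> 'b::real_vector"
  shows "linear f \<Longrightarrow> f v = (\<Sum>b\<in>Basis. (v \<bullet> b) *\<^sub>R f b)"
  by (metis (no_types, lifting) euclidean_representation linear_scale linear_sum sum.cong)

lemma linear_frechet_derivative_at: "Ck_on (Suc k) W f \<Longrightarrow> x \<in> W \<Longrightarrow> linear (frechet_derivative f (at x))"
  by (simp add: linear_frechet_derivative)

lemma Ck_on_compose_linear:
  assumes "open W" "linear l" "Ck_on k W f"
  shows "Ck_on k W (\<lambda>x. l (f x))"
  using assms(3)
proof (induction k arbitrary: f)
  case 0
  then show ?case
    using assms(2) by (simp add: continuous_on_compose2[of UNIV l] linear_continuous_on linear_linear)
next
  case (Suc k)
  show ?case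
    by (rule Ck_on_SucI[OF \<open>open W\<close>
          has_derivative_compose[OF Ck_on_has_derivative[OF Suc.prems] linear_imp_has_derivative[OF assms(2)]]])
      (use Suc in auto)
qed

lemma Ck_on_compose:
  assumes "open W" "open V" "Ck_on k W f" "Ck_on k V g" "f ` W \<subseteq> V"
  shows "Ck_on k W (\<lambda>x. g (f x))"
  using assms(3,4)
proof (induction k arbitrary: g)
  case 0
  then show ?case using assms by (auto intro: continuous_on_compose2)
next
  case (Suc k)
  let ?f' = "\<lambda>x. frechet_derivative f (at x)" and ?g' = "\<lambda>y. frechet_derivative g (at y)"
  show ?case
  proof (rule Ck_on_SucI[OF \<open>open W\<close>, where D="\<lambda>x v. \<Sum>b\<in>Basis. (?f' x v \<bullet> b) *\<^sub>R ?g' (f x) b"])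
    fix x assume x: "x \<in> W"
    then have fx: "f x \<in> V" using assms(5) by auto
    have "((\<lambda>x. g (f x)) has_derivative (\<lambda>v. ?g' (f x) (?f' x v))) (at x)"
      using has_derivative_compose[OF Ck_on_has_derivative[OF Suc.prems(1) x]
          Ck_on_has_derivative[OF Suc.prems(2) fx]] .
    moreover have "?g' (f x) (?f' x v) = (\<Sum>b\<in>Basis. (?f' x v \<bullet> b) *\<^sub>R ?g' (f x) b)" for v
      by (rule linear_sum_Basis[OF linear_frechet_derivative_at[OF Suc.prems(2) fx]])
    ultimately show "((\<lambda>x. g (f x)) has_derivative (\<lambda>v. \<Sum>b\<in>Basis. (?f' x v \<bullet> b) *\<^sub>R ?g' (f x) b)) (at x)"
      by simp
  next
    fix v
    have "Ck_on k W (\<lambda>x. ?f' x v \<bullet> b)" for b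
      using Suc.prems(1)
      by (intro Ck_on_compose_linear[OF \<open>open W\<close>, of "\<lambda>u. u \<bullet> b"])
        (simp_all add: bounded_linear.linear bounded_linear_inner_left)
    then show "Ck_on k W (\<lambda>x. \<Sum>b\<in>Basis. (?f' x v \<bullet> b) *\<^sub>R ?g' (f x) b)"
      using Suc.IH[OF Ck_on_Suc_imp[OF Suc.prems(1)], of "\<lambda>y. ?g' y b" for b] Suc.prems
      by (intro Ck_on_sum Ck_on_scaleR \<open>open W\<close>) auto
  qed
qed

text \<open>The difference of the inverses is rewritten as \<open>H y (G z (H z v) - G y (H z v))\<close>, so that
  boundedness of the inverses near a point gives first continuity and then differentiability.\<close>

lemma linear_inverse_locally_bounded:
  fixes G H :: "'a::euclidean_space \<Rightarrow> 'b::euclidean_space \<Rightarrow> 'b"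
  assumes "open W" "z \<in> W"
    and lin: "\<And>y. y \<in> W \<Longrightarrow> linear (G y)" "\<And>y. y \<in> W \<Longrightarrow> linear (H y)"
    and inv: "\<And>y v. y \<in> W \<Longrightarrow> H y (G y v) = v" "\<And>y v. y \<in> W \<Longrightarrow> G y (H y v) = v"
    and cont: "\<And>v. continuous_on W (\<lambda>y. G y v)"
  shows "\<exists>C. \<forall>\<^sub>F y in at z. \<forall>u. norm (H y u) \<le> C * norm u"
proof -
  obtain B where B: "B > 0" "\<And>u. norm (H z u) \<le> B * norm u"
    using linear_bounded_pos[OF lin(2)[OF \<open>z \<in> W\<close>]] by blast
  \<comment> \<open>A bound for the operator norm of \<open>G z - G y\<close> in terms of finitely
    many values, each continuous in \<open>y\<close>.\<close>
  define N where "N y = (\<Sum>b\<in>Basis. norm (G z b - G y b))" for y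
  have "isCont (\<lambda>y. G y b) z" for b
    using cont \<open>open W\<close> \<open>z \<in> W\<close> by (simp add: continuous_on_eq_continuous_at)
  then have "(N \<longlongrightarrow> (\<Sum>b\<in>Basis. norm (G z b - G z b))) (at z)"
    unfolding N_def isCont_def by (intro tendsto_intros)
  then have "(N \<longlongrightarrow> 0) (at z)" by simp
  \<comment> \<open>With this threshold the error term becomes half of \<open>norm (H y u)\<close>
    and can be absorbed on the left.\<close>
  then have "\<forall>\<^sub>F y in at z. N y < 1 / (2 * B)"
    using B(1) by (intro order_tendstoD(2)) auto
  moreover have "\<forall>\<^sub>F y in at z. y \<in> W"
    using \<open>open W\<close> \<open>z \<in> W\<close> by (simp add: eventually_at_in_open')
  ultimately have "\<forall>\<^sub>F y in at z. \<forall>u. norm (H y u) \<le> 2 * B * norm u"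
  proof eventually_elim
    case (elim y)
    show ?case
    proof
      fix u
      let ?w = "H y u"
      have "norm (G z ?w - G y ?w) = norm (\<Sum>b\<in>Basis. (?w \<bullet> b) *\<^sub>R (G z b - G y b))"
        by (simp only: scaleR_diff_right sum_subtractf flip: linear_sum_Basis[OF lin(1)[OF elim(2)]]
            linear_sum_Basis[OF lin(1)[OF \<open>z \<in> W\<close>]])
      also have "\<dots> \<le> (\<Sum>b\<in>Basis. norm ?w * norm (G z b - G y b))"
        by (intro sum_norm_le) (simp add: Basis_le_norm mult_right_mono)
      also have "\<dots> = norm ?w * N y"
        by (simp add: N_def sum_distrib_left)
      also have "\<dots> \<le> norm ?w * (1 / (2 * B))"
        using elim(1) by (intro mult_left_mono) auto
      finally have "norm (G z ?w) \<le> norm u + norm ?w / (2 * B)"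
        using norm_triangle_ineq[of "G y ?w" "G z ?w - G y ?w"] inv(2)[OF elim(2)] by simp
      moreover have "norm ?w \<le> B * norm (G z ?w)"
        using B(2)[of "G z ?w"] inv(1)[OF \<open>z \<in> W\<close>] by simp
      ultimately have "norm ?w \<le> B * (norm u + norm ?w / (2 * B))"
        using B(1) by (meson mult_left_mono order_trans less_imp_le)
      then show "norm ?w \<le> 2 * B * norm u"
        using B(1) by (simp add: field_simps)
    qed
  qed
  then show ?thesis by blast
qed

lemma continuous_linear_inverse:
  fixes G H :: "'a::euclidean_space \<Rightarrow> 'b::euclidean_space \<Rightarrow> 'b"
  assumes "open W"
    and lin: "\<And>y. y \<in> W \<Longrightarrow> linear (G y)" "\<And>y. y \<in> W \<Longrightarrow> linear (H y)"
    and inv: "\<And>y v. y \<in> W \<Longrightarrow> H y (G y v) = v" "\<And>y v. y \<in> W \<Longrightarrow> G y (H y v) = v"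
    and cont: "\<And>v. continuous_on W (\<lambda>y. G y v)"
  shows "continuous_on W (\<lambda>y. H y v)"
proof -
  have "((\<lambda>y. H y v) \<longlongrightarrow> H z v) (at z)" if z: "z \<in> W" for z
  proof -
    obtain C where C: "\<forall>\<^sub>F y in at z. \<forall>u. norm (H y u) \<le> C * norm u"
      using linear_inverse_locally_bounded[OF assms(1) z lin inv cont] by blast
    let ?u = "H z v"
    have "isCont (\<lambda>y. G y ?u) z"
      using cont \<open>open W\<close> z by (simp add: continuous_on_eq_continuous_at)
    then have "((\<lambda>y. C * norm (v - G y ?u)) \<longlongrightarrow> C * norm (v - G z ?u)) (at z)"
      unfolding isCont_def by (intro tendsto_intros)
    then have lim: "((\<lambda>y. C * norm (v - G y ?u)) \<longlongrightarrow> 0) (at z)"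
      using inv(2)[OF z] by simp
    have "\<forall>\<^sub>F y in at z. y \<in> W"
      using \<open>open W\<close> z by (simp add: eventually_at_in_open')
    with C have bound: "\<forall>\<^sub>F y in at z. norm (H y v - H z v) \<le> C * norm (v - G y ?u)"
    proof eventually_elim
      case (elim y)
      have "H y v - H z v = H y (v - G y ?u)"
        using lin(2)[OF elim(2)] inv(1)[OF elim(2)] by (simp add: linear_diff)
      then show ?case using elim(1) by metis
    qed
    show ?thesis
      by (rule LIM_zero_cancel, rule Lim_null_comparison[OF bound lim])
  qed
  then show ?thesis
    by (simp add: \<open>open W\<close> continuous_on_eq_continuous_at isCont_def)
qed

text \<open>Differentiating the identity \<open>G y (H y v) = v\<close> forces the formula.\<close>

lemma has_derivative_linear_inverse:
  fixes G H :: "'a::euclidean_space \<Rightarrow> 'b::euclidean_space \<Rightarrow> 'b"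
  assumes "open W"
    and lin: "\<And>y. y \<in> W \<Longrightarrow> linear (G y)" "\<And>y. y \<in> W \<Longrightarrow> linear (H y)"
    and inv: "\<And>y v. y \<in> W \<Longrightarrow> H y (G y v) = v" "\<And>y v. y \<in> W \<Longrightarrow> G y (H y v) = v"
    and diff: "\<And>y v. y \<in> W \<Longrightarrow> ((\<lambda>y. G y v) has_derivative D y v) (at y)" and z: "z \<in> W"
  shows "((\<lambda>y. H y v) has_derivative (\<lambda>t. - H z (D z (H z v) t))) (at z)"
proof -
  have "isCont (\<lambda>y. G y v) y" if "y \<in> W" for y v
    using diff[OF that] by (rule has_derivative_continuous)
  then have cont: "continuous_on W (\<lambda>y. G y v)" for v
    by (simp add: continuous_at_imp_continuous_on)
  let ?u = "H z v"
  define q where "q y = G y ?u" for y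
  have qz: "q z = v" using inv(2)[OF z] by (simp add: q_def)
  have isH: "isCont (\<lambda>y. H y b) z" for b
    using continuous_linear_inverse[OF assms(1) lin inv cont] z \<open>open W\<close>
    by (simp add: continuous_on_eq_continuous_at)
  let ?D = "D z ?u"
  have Dq: "(q has_derivative ?D) (at z)"
    using diff[OF z] by (simp add: q_def[abs_def])
  have split: "H y v - H z v = - H y (q y - q z)" if "y \<in> W" for y
    using lin(2)[OF that] inv(1)[OF that] qz by (simp add: q_def linear_diff)
  obtain C where C: "\<forall>\<^sub>F y in at z. \<forall>u. norm (H y u) \<le> C * norm u"
    using linear_inverse_locally_bounded[OF assms(1) z lin inv cont] by blast
  obtain K where K: "K > 0" "\<And>t. norm (?D t) \<le> K * norm t"
    using has_derivative_bounded_linear[OF Dq] bounded_linear.pos_bounded by (metis mult.commute)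
  define R where "R y = norm (q y - q z - ?D (y - z)) / norm (y - z)" for y
  define M where "M y = (\<Sum>b\<in>Basis. norm (H z b - H y b))" for y
  have R: "(R \<longlongrightarrow> 0) (at z)"
  proof -
    have "((\<lambda>y. (1 / norm (y - z)) *\<^sub>R (q y - (q z + ?D (y - z)))) \<longlongrightarrow> 0) (at z)"
      using Dq unfolding has_derivative_at2 by blast
    from tendsto_norm_zero[OF this] show ?thesis
      by (simp add: R_def[abs_def] diff_diff_eq)
  qed
  have "(M \<longlongrightarrow> (\<Sum>b\<in>Basis. norm (H z b - H z b))) (at z)"
    using isH unfolding M_def isCont_def by (intro tendsto_intros)
  then have M: "(M \<longlongrightarrow> 0) (at z)" by simp
  have "((\<lambda>y. C * R y + M y * K) \<longlongrightarrow> C * 0 + 0 * K) (at z)"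
    by (intro tendsto_intros R M)
  then have lim: "((\<lambda>y. C * R y + M y * K) \<longlongrightarrow> 0) (at z)" by simp
  have "\<forall>\<^sub>F y in at z. y \<in> W"
    using \<open>open W\<close> z by (simp add: eventually_at_in_open')
  moreover have "\<forall>\<^sub>F y in at z. y \<noteq> z"
    by (simp add: eventually_at_filter)
  ultimately have "\<forall>\<^sub>F y in at z.
      norm ((1 / norm (y - z)) *\<^sub>R (H y v - (H z v + - H z (?D (y - z))))) \<le> C * R y + M y * K"
    using C
  proof eventually_elim
    case (elim y)
    let ?w = "?D (y - z)"
    have "norm (H z ?w - H y ?w) = norm (\<Sum>b\<in>Basis. (?w \<bullet> b) *\<^sub>R (H z b - H y b))"
      by (simp only: scaleR_diff_right sum_subtractf flip: linear_sum_Basis[OF lin(2)[OF elim(1)]]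
          linear_sum_Basis[OF lin(2)[OF z]])
    also have "\<dots> \<le> (\<Sum>b\<in>Basis. norm ?w * norm (H z b - H y b))"
      by (intro sum_norm_le) (simp add: Basis_le_norm mult_right_mono)
    also have "\<dots> = norm ?w * M y"
      by (simp add: M_def sum_distrib_left)
    also have "\<dots> \<le> K * norm (y - z) * M y"
      using K(2) by (intro mult_right_mono) (auto simp: M_def sum_nonneg)
    finally have 1: "norm (H z ?w - H y ?w) \<le> K * norm (y - z) * M y" .
    have 2: "norm (H y (q y - q z - ?w)) \<le> C * norm (q y - q z - ?w)"
      using elim(3) by blast
    \<comment> \<open>The first part tests the continuity of \<open>H\<close> on the linear term and
      is controlled by \<open>M\<close>; the second applies the bounded \<open>H y\<close> to the
      remainder of \<open>q\<close> and is controlled by \<open>R\<close>.\<close>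
    have eq: "H y v - (H z v + - H z ?w) = (H z ?w - H y ?w) - H y (q y - q z - ?w)"
      using split[OF elim(1)] lin(2)[OF elim(1)] by (simp add: linear_diff linear_add algebra_simps)
    have "norm (H y v - (H z v + - H z ?w)) \<le> K * norm (y - z) * M y + C * norm (q y - q z - ?w)"
      unfolding eq using 1 2 norm_triangle_ineq4[of "H z ?w - H y ?w" "H y (q y - q z - ?w)"] by linarith
    also have "\<dots> = (C * R y + M y * K) * norm (y - z)"
      using elim(2) by (simp add: R_def field_simps)
    finally have le: "norm (H y v - (H z v + - H z ?w)) \<le> (C * R y + M y * K) * norm (y - z)" .
    have "norm (y - z) > 0" using elim(2) by simp
    with le show ?case
      by (simp only: norm_scaleR abs_divide abs_norm_cancel abs_one times_divide_eq_left mult_1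
          pos_divide_le_eq)
  qed
  then have "((\<lambda>y. (1 / norm (y - z)) *\<^sub>R (H y v - (H z v + - H z (?D (y - z))))) \<longlongrightarrow> 0) (at z)"
    by (rule Lim_null_comparison[OF _ lim])
  moreover have "bounded_linear (\<lambda>t. - H z (?D t))"
    unfolding linear_conv_bounded_linear[symmetric]
    using linear_compose_neg[OF linear_compose[OF has_derivative_linear[OF Dq] lin(2)[OF z]]]
    by (simp add: o_def)
  ultimately show ?thesis
    unfolding has_derivative_at2 by blast
qed

text \<open>The derivative of \<open>H\<close> is an expression in \<open>H\<close> and the
  derivative of \<open>G\<close>, so class C^k of \<open>H\<close> improves to class
  C^(k+1).\<close>

lemma Ck_on_linear_inverse:
  fixes G H :: "'a::euclidean_space \<Rightarrow> 'b::euclidean_space \<Rightarrow> 'b"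
  assumes "open W"
    and lin: "\<And>y. y \<in> W \<Longrightarrow> linear (G y)" "\<And>y. y \<in> W \<Longrightarrow> linear (H y)"
    and inv: "\<And>y v. y \<in> W \<Longrightarrow> H y (G y v) = v" "\<And>y v. y \<in> W \<Longrightarrow> G y (H y v) = v"
  shows "(\<And>v. Ck_on k W (\<lambda>y. G y v)) \<Longrightarrow> Ck_on k W (\<lambda>y. H y v)"
proof (induction k arbitrary: v)
  case 0
  then show ?case
    using continuous_linear_inverse[OF assms] by simp
next
  case (Suc k)
  define D where "D y u = frechet_derivative (\<lambda>y. G y u) (at y)" for y u
  have der: "((\<lambda>y. G y u) has_derivative D y u) (at y)" if "y \<in> W" for y u
    unfolding D_def by (rule Ck_on_has_derivative[OF Suc.prems that])
  have H: "Ck_on k W (\<lambda>y. H y u)" for u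
    using Suc.IH Suc.prems Ck_on_Suc_imp by blast
  have linH: "H y u = (\<Sum>b\<in>Basis. (u \<bullet> b) *\<^sub>R H y b)" if "y \<in> W" for y u
    by (rule linear_sum_Basis[OF lin(2)[OF that]])
  \<comment> \<open>\<open>D\<close> is defined separately for each \<open>u\<close>; its linearity
    in \<open>u\<close> comes from differentiating the expansion of \<open>G y u\<close> in the
    basis and from uniqueness of derivatives.\<close>
  have linD: "D y u t = (\<Sum>b\<in>Basis. (u \<bullet> b) *\<^sub>R D y b t)" if "y \<in> W" for y u t
  proof -
    have "((\<lambda>y. \<Sum>b\<in>Basis. (u \<bullet> b) *\<^sub>R G y b) has_derivative (\<lambda>t. \<Sum>b\<in>Basis. (u \<bullet> b) *\<^sub>R D y b t)) (at y)"
      using der[OF that] by (intro has_derivative_sum has_derivative_scaleR_right)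
    then have "((\<lambda>y. G y u) has_derivative (\<lambda>t. \<Sum>b\<in>Basis. (u \<bullet> b) *\<^sub>R D y b t)) (at y)"
      by (rule has_derivative_transform_within_open[OF _ \<open>open W\<close> that])
        (metis linear_sum_Basis lin(1))
    then show ?thesis
      using fun_cong[OF has_derivative_unique[OF der[OF that]]] by blast
  qed
  show ?case
  proof (rule Ck_on_SucI[OF \<open>open W\<close> has_derivative_linear_inverse[OF assms der]])
    fix t
    have Dk: "Ck_on k W (\<lambda>y. D y b t)" for b
      using Suc.prems[of b] by (simp add: D_def)
    have inner: "Ck_on k W (\<lambda>y. f y \<bullet> b)" if "Ck_on k W f" for f :: "'a \<Rightarrow> 'b" and b
      using that by (intro Ck_on_compose_linear[OF \<open>open W\<close>, of "\<lambda>u. u \<bullet> b"])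
        (simp_all add: bounded_linear.linear bounded_linear_inner_left)
    let ?w = "\<lambda>y. \<Sum>b\<in>Basis. (H y v \<bullet> b) *\<^sub>R D y b t"
    have w: "Ck_on k W ?w"
      by (intro Ck_on_sum Ck_on_scaleR inner H Dk \<open>open W\<close>)
    have "Ck_on k W (\<lambda>y. (-1) *\<^sub>R (\<Sum>b\<in>Basis. (?w y \<bullet> b) *\<^sub>R H y b))"
      by (intro Ck_on_scaleR Ck_on_const Ck_on_sum inner w H \<open>open W\<close>)
    then show "Ck_on k W (\<lambda>y. - H y (D y (H y v) t))"
      by (rule Ck_on_cong[OF \<open>open W\<close>, rotated]) (simp add: linD linH flip: linH)
  qed auto
qed

section \<open>Smooth maps on open sets and their local inverses\<close>

definition Cinf_on :: "'a::euclidean_space set \<Rightarrow> ('a \<Rightarrow> 'b::euclidean_space) \<Rightarrow> bool" where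
  "Cinf_on W f \<longleftrightarrow> (\<forall>k. Ck_on k W f)"

lemma Cinf_on_continuous: "Cinf_on W f \<Longrightarrow> continuous_on W f"
  using Ck_on.simps(1) unfolding Cinf_on_def by blast

lemma Cinf_on_has_derivative:
  "Cinf_on W f \<Longrightarrow> x \<in> W \<Longrightarrow> (f has_derivative frechet_derivative f (at x)) (at x)"
  using Ck_on_has_derivative unfolding Cinf_on_def by blast

lemma Cinf_on_frechet_derivative:
  "Cinf_on W f \<Longrightarrow> Cinf_on W (\<lambda>x. frechet_derivative f (at x) v)"
  unfolding Cinf_on_def by (metis Ck_on.simps(2))

text \<open>The inverse function theorem gives a differentiable \<open>g\<close> whose derivative at
  \<open>y\<close> inverts the derivative of \<open>f\<close> at \<open>g y\<close>. If
  \<open>g\<close> is of class C^k, so is the derivative of \<open>f\<close> along \<open>g\<close>,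
  hence also its inverse, and \<open>g\<close> is of class C^(k+1).\<close>

lemma smooth_local_inverse:
  fixes f :: "'a::euclidean_space \<Rightarrow> 'a"
  assumes "open W" "q \<in> W" and smooth: "Cinf_on W f"
    and deriv: "(f has_derivative D) (at q)" and "inj D"
  obtains U V g where "open U" "q \<in> U" "U \<subseteq> W" "open V" "homeomorphism U V f g" "Cinf_on V g"
proof -
  \<comment> \<open>Bundled as a bounded linear map because the inverse function theorem asks for
    continuity in operator norm.\<close>
  define f' where "f' x = Blinfun (frechet_derivative f (at x))" for x
  have der: "(f has_derivative frechet_derivative f (at x)) (at x)" if "x \<in> W" for x
    using Cinf_on_has_derivative[OF smooth that] .
  have app: "blinfun_apply (f' x) = frechet_derivative f (at x)" if "x \<in> W" for x
    unfolding f'_def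
    by (rule bounded_linear_Blinfun_apply[OF has_derivative_bounded_linear[OF der[OF that]]])
  have cont: "continuous_on W f'"
  proof (rule continuous_on_blinfun_componentwise)
    fix b :: 'a
    have "continuous_on W (\<lambda>x. frechet_derivative f (at x) b)"
      using Cinf_on_continuous[OF Cinf_on_frechet_derivative[OF smooth]] .
    then show "continuous_on W (\<lambda>x. blinfun_apply (f' x) b)"
      using app by (simp cong: continuous_on_cong)
  qed
  have D: "blinfun_apply (f' q) = D"
    using app[OF \<open>q \<in> W\<close>] frechet_derivative_at[OF deriv] by simp
  obtain E where E: "linear E" "E \<circ> D = id"
    using linear_injective_left_inverse[OF has_derivative_linear[OF deriv] \<open>inj D\<close>] by blast
  have der': "(f has_derivative blinfun_apply (f' x)) (at x)" if "x \<in> W" for x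
    unfolding app[OF that] by (rule der[OF that])
  have invf: "Blinfun E o\<^sub>L f' q = id_blinfun"
    using E D by (intro blinfun_eqI) (simp add: bounded_linear_Blinfun_apply linear_linear o_def fun_eq_iff)
  show thesis
  proof (rule inverse_function_theorem[OF \<open>open W\<close> der' cont \<open>q \<in> W\<close> invf])
    fix U V :: "'a set" and g g'
    assume U: "open U" "U \<subseteq> W" "q \<in> U" "open V" "homeomorphism U V f g"
      and g': "\<And>y. y \<in> V \<Longrightarrow> (g has_derivative (g' y)) (at y)"
        "\<And>y. y \<in> V \<Longrightarrow> g' y = inv_into UNIV (blinfun_apply (f' (g y)))"
        "\<And>y. y \<in> V \<Longrightarrow> bij (blinfun_apply (f' (g y)))"
    have gW: "g y \<in> W" if "y \<in> V" for y
      using U(2,5) that by (auto simp: homeomorphism_def)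
    let ?G = "\<lambda>y. frechet_derivative f (at (g y))"
    have "Ck_on k V g" for k
    proof (induction k)
      case 0
      then show ?case using U(5) by (simp add: homeomorphism_def)
    next
      case (Suc k)
      have G: "Ck_on k V (\<lambda>y. ?G y v)" for v
        by (rule Ck_on_compose[OF \<open>open V\<close> \<open>open W\<close> Suc])
          (use gW Cinf_on_frechet_derivative[OF smooth] in \<open>auto simp: Cinf_on_def\<close>)
      have "Ck_on k V (\<lambda>y. g' y v)" for v
      proof (rule Ck_on_linear_inverse[OF \<open>open V\<close> _ _ _ _ G])
        fix y assume y: "y \<in> V"
        show "linear (?G y)" using has_derivative_linear[OF der[OF gW[OF y]]] .
        show "linear (g' y)" using has_derivative_linear[OF g'(1)[OF y]] .
        fix v
        show "g' y (?G y v) = v" "?G y (g' y v) = v"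
          using g'(2,3)[OF y] app[OF gW[OF y]] by (auto simp: bij_is_inj bij_is_surj surj_f_inv_f)
      qed
      then show ?case
        using Ck_on_SucI[OF \<open>open V\<close> g'(1)] by blast
    qed
    then have "Cinf_on V g" by (simp add: Cinf_on_def)
    with U that show thesis by blast
  qed
qed

text \<open>Chart domains are open only relative to a linear subspace. Composing with a projection
  onto it thickens them to open sets of the ambient space, where full derivatives make
  sense.\<close>

lemma subspace_projection:
  fixes E :: "'a::euclidean_space set"
  assumes "subspace E"
  obtains P :: "'a \<Rightarrow> 'a" where "linear P" "\<And>x. P x \<in> E" "\<And>x. x \<in> E \<Longrightarrow> P x = x"
proof -
  have "\<exists>g. g ` UNIV \<subseteq> E \<and> linear g \<and> (\<forall>v\<in>E. g (id v) = v)"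
    by (rule linear_exists_left_inverse_on[OF linear_id assms]) auto
  then show thesis using that by (auto simp: image_subset_iff)
qed

lemma open_vimage_projection:
  fixes P :: "'a::euclidean_space \<Rightarrow> 'a"
  assumes "openin (top_of_set E) A" "linear P" "\<And>x. P x \<in> E"
  shows "open (P -` A)"
proof -
  obtain W where W: "open W" "A = E \<inter> W"
    using assms(1) by (auto simp: openin_open)
  have "P -` A = P -` W"
    using W(2) assms(3) by auto
  then show ?thesis
    using W(1) assms(2) linear_continuous_at linear_conv_bounded_linear
      continuous_open_vimage[of W P] by metis
qed

lemma Cinf_on_subset: "Cinf_on W f \<Longrightarrow> V \<subseteq> W \<Longrightarrow> Cinf_on V f"
  unfolding Cinf_on_def using Ck_on_subset by blast

lemma Cinf_on_compose:
  "open W \<Longrightarrow> open V \<Longrightarrow> Cinf_on W f \<Longrightarrow> Cinf_on V g \<Longrightarrow> f ` W \<subseteq> V \<Longrightarrow> Cinf_on W (\<lambda>x. g (f x))"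
  unfolding Cinf_on_def using Ck_on_compose by blast

lemma Cinf_on_linear: "open W \<Longrightarrow> linear f \<Longrightarrow> Cinf_on W f"
  unfolding Cinf_on_def using Ck_on_linear by blast

lemma Cinf_on_compose_linear:
  "open W \<Longrightarrow> linear l \<Longrightarrow> Cinf_on W f \<Longrightarrow> Cinf_on W (\<lambda>x. l (f x))"
  unfolding Cinf_on_def using Ck_on_compose_linear by blast

lemma Cinf_on_const: "open W \<Longrightarrow> Cinf_on W (\<lambda>x. c)"
  unfolding Cinf_on_def using Ck_on_const by blast

lemma Cinf_on_add:
  "open W \<Longrightarrow> Cinf_on W f \<Longrightarrow> Cinf_on W g \<Longrightarrow> Cinf_on W (\<lambda>x. f x + g x)"
  unfolding Cinf_on_def using Ck_on_add by blast

lemma Cinf_on_sum: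
  "open W \<Longrightarrow> (\<And>i. i \<in> I \<Longrightarrow> Cinf_on W (f i)) \<Longrightarrow> Cinf_on W (\<lambda>x. \<Sum>i\<in>I. f i x)"
  by (simp add: Cinf_on_def Ck_on_sum)

lemma Cinf_on_scaleR:
  "open W \<Longrightarrow> Cinf_on W f \<Longrightarrow> Cinf_on W g \<Longrightarrow> Cinf_on W (\<lambda>x. f x *\<^sub>R g x)"
  unfolding Cinf_on_def using Ck_on_scaleR by blast

lemma Cinf_on_uminus: "open W \<Longrightarrow> Cinf_on W f \<Longrightarrow> Cinf_on W (\<lambda>x. - f x)"
  using Cinf_on_scaleR[OF _ Cinf_on_const[of W "-1::real"], of f] by simp

lemma Cinf_on_diff:
  "open W \<Longrightarrow> Cinf_on W f \<Longrightarrow> Cinf_on W g \<Longrightarrow> Cinf_on W (\<lambda>x. f x - g x)"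
  using Cinf_on_add[of W f "\<lambda>x. - g x"] Cinf_on_uminus[of W g] by simp

lemma Cinf_on_inner:
  assumes "open W" "Cinf_on W f" "Cinf_on W g"
  shows "Cinf_on W (\<lambda>x. f x \<bullet> g x)"
proof -
  have "Cinf_on W (\<lambda>x. h x \<bullet> b)" if "Cinf_on W h" for h :: "'a \<Rightarrow> 'b" and b
    using that by (intro Cinf_on_compose_linear[OF assms(1), of "\<lambda>u. u \<bullet> b"])
      (simp_all add: bounded_linear.linear bounded_linear_inner_left)
  then have "Cinf_on W (\<lambda>x. \<Sum>b\<in>Basis. (f x \<bullet> b) *\<^sub>R (g x \<bullet> b))"
    using assms by (intro Cinf_on_sum Cinf_on_scaleR) auto
  then show ?thesis
    by (simp add: euclidean_inner[of "f _" "g _"])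
qed

text \<open>The derivative of a power is a multiple of another power, so the induction runs over all
  exponents at once.\<close>

lemma Cinf_on_powr: "Cinf_on {0<..} (\<lambda>t::real. t powr a)"
proof -
  have "Ck_on k {0<..} (\<lambda>t::real. t powr a)" for k
  proof (induction k arbitrary: a)
    case 0
    then show ?case by (auto intro!: continuous_intros)
  next
    case (Suc k)
    show ?case
    proof (rule Ck_on_SucI[where D="\<lambda>t v. v *\<^sub>R (a *\<^sub>R t powr (a - 1))"])
      show "((\<lambda>t. t powr a) has_derivative (\<lambda>v. v *\<^sub>R (a *\<^sub>R t powr (a - 1)))) (at t)"
        if "t \<in> {0<..}" for t :: real
      proof -
        have "(*) (a * t powr (a - 1)) = (\<lambda>v. v *\<^sub>R (a *\<^sub>R t powr (a - 1)))"
          by (simp add: fun_eq_iff)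
        then show ?thesis
          using has_real_derivative_powr[of t a] that by (simp add: has_field_derivative_def)
      qed
      show "Ck_on k {0<..} (\<lambda>t. v *\<^sub>R (a *\<^sub>R t powr (a - 1)))" for v :: real
        by (intro Ck_on_scaleR Ck_on_const Suc) auto
    qed auto
  qed
  then show ?thesis by (simp add: Cinf_on_def)
qed

section \<open>Smooth maps on sets that need not be open\<close>

lemma smooth_on_alt:
  "smooth_on A f \<longleftrightarrow> (\<forall>x\<in>A. \<exists>W g. open W \<and> x \<in> W \<and> Cinf_on W g \<and> (\<forall>y\<in>A \<inter> W. f y = g y))"
  unfolding smooth_on_def Cinf_on_def ..

lemma smooth_on_subset: "smooth_on A f \<Longrightarrow> B \<subseteq> A \<Longrightarrow> smooth_on B f"
  unfolding smooth_on_alt by (intro ballI) (drule bspec, blast, blast)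

lemma smooth_on_cong: "smooth_on A f \<Longrightarrow> (\<And>x. x \<in> A \<Longrightarrow> f x = g x) \<Longrightarrow> smooth_on A g"
  unfolding smooth_on_alt by (metis Int_iff)

lemma Cinf_on_imp_smooth_on: "open W \<Longrightarrow> Cinf_on W f \<Longrightarrow> A \<subseteq> W \<Longrightarrow> smooth_on A f"
  unfolding smooth_on_alt by blast

lemma smooth_on_linear: "linear f \<Longrightarrow> smooth_on A f"
  using Cinf_on_imp_smooth_on[OF open_UNIV Cinf_on_linear[OF open_UNIV]] by blast

lemma smooth_on_imp_continuous_on: "smooth_on A f \<Longrightarrow> continuous_on A f"
proof -
  assume f: "smooth_on A f"
  have "continuous (at x within A) f" if x: "x \<in> A" for x
  proof -
    obtain W g where W: "open W" "x \<in> W" "Cinf_on W g" "\<forall>y\<in>A \<inter> W. f y = g y"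
      using f x unfolding smooth_on_alt by blast
    have "continuous (at x within A) g"
      using Cinf_on_continuous[OF W(3)] W(1,2) continuous_on_eq_continuous_at continuous_at_imp_continuous_within
      by blast
    moreover have "\<forall>\<^sub>F y in at x within A. g y = f y"
      unfolding eventually_at_topological using W by auto
    ultimately show ?thesis
      using W(2,4) x unfolding continuous_within by (simp add: tendsto_cong)
  qed
  then show ?thesis by (simp add: continuous_on_eq_continuous_within)
qed

lemma smooth_on_compose:
  assumes f: "smooth_on A f" and g: "smooth_on B g" and "f ` A \<subseteq> B"
  shows "smooth_on A (\<lambda>x. g (f x))"
  unfolding smooth_on_alt
proof
  fix x assume x: "x \<in> A"
  obtain W f' where W: "open W" "x \<in> W" "Cinf_on W f'" "\<forall>y\<in>A \<inter> W. f y = f' y"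
    using f x unfolding smooth_on_alt by blast
  obtain V g' where V: "open V" "f x \<in> V" "Cinf_on V g'" "\<forall>y\<in>B \<inter> V. g y = g' y"
    using g x \<open>f ` A \<subseteq> B\<close> unfolding smooth_on_alt by blast
  define U where "U = W \<inter> f' -` V"
  have "open U"
    unfolding U_def using Cinf_on_continuous[OF W(3)] W(1) V(1) by (metis continuous_on_open_vimage Int_commute)
  moreover have "x \<in> U"
    using W(2,4) V(2) x by (auto simp: U_def)
  moreover have "Cinf_on U (\<lambda>x. g' (f' x))"
    by (rule Cinf_on_compose[OF \<open>open U\<close> V(1) Cinf_on_subset[OF W(3)] V(3)]) (auto simp: U_def)
  moreover have "\<forall>y\<in>A \<inter> U. g (f y) = g' (f' y)"
    using W(4) V(4) \<open>f ` A \<subseteq> B\<close> unfolding U_def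
    by (metis (no_types, lifting) IntD1 IntD2 IntI image_subset_iff vimageE)
  ultimately show "\<exists>W h. open W \<and> x \<in> W \<and> Cinf_on W h \<and> (\<forall>y\<in>A \<inter> W. g (f y) = h y)"
    by blast
qed

text \<open>The extensions provided by \<open>smooth_on\<close> are local and unrelated;
  \<open>f (P x)\<close> is a single one, since near each point it agrees with a local extension
  composed with \<open>P\<close>.\<close>

lemma smooth_on_projection:
  fixes P :: "'a::euclidean_space \<Rightarrow> 'a"
  assumes A: "openin (top_of_set E) A" and P: "linear P" "\<And>x. P x \<in> E" "\<And>x. x \<in> E \<Longrightarrow> P x = x"
    and f: "smooth_on A f"
  shows "Cinf_on (P -` A) (\<lambda>x. f (P x))"
proof -
  have "Ck_on k (P -` A) (\<lambda>x. f (P x))" for k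
  proof (rule Ck_on_local)
    fix x assume "x \<in> P -` A"
    then obtain W g where W: "open W" "P x \<in> W" "Cinf_on W g" "\<forall>y\<in>A \<inter> W. f y = g y"
      using f unfolding smooth_on_alt by blast
    let ?V = "P -` A \<inter> P -` W"
    have "open (P -` W)"
      using W(1) P(1) linear_continuous_at linear_conv_bounded_linear
        continuous_open_vimage[of W P] by metis
    then have V: "open ?V"
      using open_vimage_projection[OF A P(1,2)] by blast
    have "Cinf_on ?V (\<lambda>x. g (P x))"
      by (rule Cinf_on_compose[OF V W(1) Cinf_on_linear[OF V P(1)] W(3)]) auto
    then have "Ck_on k ?V (\<lambda>x. g (P x))"
      by (simp add: Cinf_on_def)
    then have "Ck_on k ?V (\<lambda>x. f (P x))"
      by (rule Ck_on_cong[OF V, rotated]) (use W(4) in auto)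
    then show "\<exists>V. open V \<and> x \<in> V \<and> Ck_on k V (\<lambda>x. f (P x))"
      using V W(2) \<open>x \<in> P -` A\<close> by blast
  qed
  then show ?thesis by (simp add: Cinf_on_def)
qed

lemma diffeomorphism_imp_homeomorphic:
  assumes "diffeomorphism A B f"
  shows "A homeomorphic B"
proof -
  have f: "bij_betw f A B" "continuous_on A f" "continuous_on B (inv_into A f)"
    using assms smooth_on_imp_continuous_on unfolding diffeomorphism_def by blast+
  then have "homeomorphism A B f (inv_into A f)"
    using bij_betw_inv_into[OF f(1)] bij_betw_inv_into_left[OF f(1)] bij_betw_inv_into_right[OF f(1)]
    by (simp add: homeomorphism_def bij_betw_imp_surj_on)
  then show ?thesis by (auto simp: homeomorphic_def)
qed

lemma diffeomorphismI:
  assumes "f ` A = B" "\<And>x. x \<in> A \<Longrightarrow> g (f x) = x" "smooth_on A f" "smooth_on B g"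
  shows "diffeomorphism A B f"
proof -
  have inj: "inj_on f A" using assms(2) by (metis inj_onI)
  then have "inv_into A f y = g y" if "y \<in> B" for y
    using assms(1,2) that by auto
  then show ?thesis
    using assms inj smooth_on_cong[OF assms(4), of "inv_into A f"]
    by (auto simp: diffeomorphism_def bij_betw_def)
qed

lemma Cinf_on_powr_compose:
  assumes "open W" "Cinf_on W f" "\<And>x. x \<in> W \<Longrightarrow> 0 < f x"
  shows "Cinf_on W (\<lambda>x. f x powr (a::real))"
  using Cinf_on_compose[OF assms(1) _ assms(2) Cinf_on_powr[of a]] assms(3) by auto

text \<open>Radial rescaling by \<open>1 / sqrt (r^2 - q v)\<close>, with inverse rescaling by
  \<open>r / sqrt (1 + q w)\<close>. Homogeneity of degree two gives
  \<open>1 + q (f v) = r^2 / (r^2 - q v)\<close>, so the factors cancel. The subspace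
  \<open>L\<close> is arbitrary because a slice chart needs this both for its model and for its
  slice.\<close>

lemma diffeomorphic_quadratic_ball:
  fixes L :: "'a::euclidean_space set"
  assumes "subspace L" and q: "Cinf_on UNIV q" "\<And>t v. q (t *\<^sub>R v) = t\<^sup>2 * q v" "\<And>v. 0 \<le> q v"
    and "0 < (r::real)"
  shows "diffeomorphic {v\<in>L. q v < r\<^sup>2} L"
proof -
  define f where "f v = ((r\<^sup>2 - q v) powr (- (1/2))) *\<^sub>R v" for v
  define g where "g w = (r * (1 + q w) powr (- (1/2))) *\<^sub>R w" for w
  let ?W = "{v. q v < r\<^sup>2}"
  have W: "open ?W"
    using Cinf_on_continuous[OF q(1)] by (intro open_Collect_less continuous_intros) auto
  have powr_sq: "(s powr (- (1/2)))\<^sup>2 = 1 / s" if "s > 0" for s :: real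
    using that by (simp add: power2_eq_square powr_minus_divide flip: powr_add)
  have powr_inv: "(1 / s) powr (- (1/2)) = 1 / s powr (- (1/2))" if "s > 0" for s :: real
    using that by (simp add: powr_divide)
  have r_powr: "(r\<^sup>2) powr (- (1/2)) = 1 / r"
    using \<open>0 < r\<close> by (simp add: powr_minus_divide powr_half_sqrt)
  have qf: "1 + q (f v) = r\<^sup>2 / (r\<^sup>2 - q v)" if "q v < r\<^sup>2" for v
    using that by (simp add: f_def q(2) powr_sq field_simps)
  have qg: "r\<^sup>2 - q (g w) = r\<^sup>2 / (1 + q w)" for w
    using q(3)[of w] by (simp add: g_def q(2) power_mult_distrib powr_sq field_simps add_pos_nonneg)
  have gf: "g (f v) = v" if "q v < r\<^sup>2" for v
    using that \<open>0 < r\<close> unfolding g_def qf[OF that]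
    by (simp add: f_def powr_divide r_powr)
  have fg: "f (g w) = w" for w
    using q(3)[of w] \<open>0 < r\<close> unfolding f_def qg
    by (simp add: g_def powr_divide r_powr)
  have gq: "q (g w) < r\<^sup>2" for w
  proof -
    have "r\<^sup>2 / (1 + q w) > 0" using q(3)[of w] \<open>0 < r\<close> by simp
    then show ?thesis using qg[of w] by linarith
  qed
  have "diffeomorphism {v\<in>L. q v < r\<^sup>2} L f"
  proof (rule diffeomorphismI[where g=g])
    show "f ` {v \<in> L. q v < r\<^sup>2} = L"
    proof
      show "f ` {v \<in> L. q v < r\<^sup>2} \<subseteq> L"
        using \<open>subspace L\<close> by (auto simp: f_def subspace_scale)
      show "L \<subseteq> f ` {v \<in> L. q v < r\<^sup>2}"
      proof
        fix w assume "w \<in> L"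
        then have "g w \<in> {v \<in> L. q v < r\<^sup>2}"
          using \<open>subspace L\<close> gq by (auto simp: g_def subspace_scale)
        then show "w \<in> f ` {v \<in> L. q v < r\<^sup>2}"
          by (rule rev_image_eqI) (simp add: fg)
      qed
    qed
    have "Cinf_on ?W f"
      unfolding f_def
      by (intro Cinf_on_scaleR Cinf_on_powr_compose Cinf_on_diff Cinf_on_const W
          Cinf_on_subset[OF q(1)] Cinf_on_linear linear_ident) auto
    then show "smooth_on {v \<in> L. q v < r\<^sup>2} f"
      by (rule Cinf_on_imp_smooth_on[OF W]) auto
    have "Cinf_on UNIV (\<lambda>w. r *\<^sub>R (((1 + q w) powr (- (1/2))) *\<^sub>R w))"
      using q(3) by (intro Cinf_on_scaleR Cinf_on_powr_compose Cinf_on_add Cinf_on_const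
          q(1) Cinf_on_linear linear_ident) (auto simp: add_pos_nonneg)
    then show "smooth_on L g"
      unfolding g_def by (intro Cinf_on_imp_smooth_on[OF open_UNIV]) auto
  qed (use gf in auto)
  then show ?thesis by (auto simp: diffeomorphic_def)
qed

section \<open>Chart groups\<close>

locale orbi_chart =
  fixes n :: nat and X :: "'x topology" and c :: "('x, 'a::euclidean_space, 'g) orbichart"
  assumes chart: "orbifold_chart n X c"

sublocale orbi_chart \<subseteq> faithful_action "cgroup c" "cdom c" "cact c"
  using chart by (simp add: orbifold_chart_def)

sublocale orbi_chart \<subseteq> G: group "cgroup c"
  using group_hom by (simp add: group_hom_def)

context orbi_chart
begin

lemma model_subspace: "subspace (cmodel c)"
  and model_dim: "dim (cmodel c) = n"
  and dom_open: "openin (top_of_set (cmodel c)) (cdom c)"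
  and zero_dom: "0 \<in> cdom c"
  and dom_diffeo: "diffeomorphic (cdom c) (cmodel c)"
  and finite_group: "finite (carrier (cgroup c))"
  and supp_open: "openin X (csupp c)"
  and proj_quotient: "quotient_map (top_of_set (cdom c)) (subtopology X (csupp c)) (cproj c)"
  and act_smooth: "g \<in> carrier (cgroup c) \<Longrightarrow> smooth_on (cdom c) (cact c g)"
  and act_zero: "g \<in> carrier (cgroup c) \<Longrightarrow> cact c g 0 = 0"
  using chart by (auto simp: orbifold_chart_def)

lemma dom_subset: "cdom c \<subseteq> cmodel c"
  using dom_open openin_imp_subset by blast

lemma act_closed: "g \<in> carrier (cgroup c) \<Longrightarrow> y \<in> cdom c \<Longrightarrow> cact c g y \<in> cdom c"
  using element_image by blast

lemma act_one: "y \<in> cdom c \<Longrightarrow> cact c \<one>\<^bsub>cgroup c\<^esub> y = y"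
  using id_eq_one by (metis restrict_apply')

lemmas act_mult = composition_rule

lemma act_inv:
  assumes "g \<in> carrier (cgroup c)" "y \<in> cdom c"
  shows "cact c (inv\<^bsub>cgroup c\<^esub> g) (cact c g y) = y" "cact c g (cact c (inv\<^bsub>cgroup c\<^esub> g) y) = y"
  using assms by (simp_all flip: act_mult add: act_one)

lemma proj_eq_iff:
  assumes "y \<in> cdom c" "z \<in> cdom c"
  shows "cproj c y = cproj c z \<longleftrightarrow> (\<exists>g\<in>carrier (cgroup c). z = cact c g y)"
  using chart assms by (auto simp: orbifold_chart_def orbit_def)

lemma proj_act: "g \<in> carrier (cgroup c) \<Longrightarrow> y \<in> cdom c \<Longrightarrow> cproj c (cact c g y) = cproj c y"
  using proj_eq_iff[of y "cact c g y"] act_closed by metis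

text \<open>Every group element fixes 0, so the orbit over the centre is a single point.\<close>

lemma proj_eq_centre_iff: "y \<in> cdom c \<Longrightarrow> cproj c y = ccentre c \<longleftrightarrow> y = 0"
  using proj_eq_iff[of 0 y] zero_dom act_zero unfolding ccentre_def by (metis G.one_closed)

lemma supp_subset: "csupp c \<subseteq> topspace X"
  using supp_open by (rule openin_subset)

lemma centre_supp: "ccentre c \<in> csupp c"
  using zero_dom by (auto simp: ccentre_def csupp_def)

lemma proj_continuous: "continuous_map (top_of_set (cdom c)) X (cproj c)"
  using quotient_imp_continuous_map[OF proj_quotient] by (simp add: continuous_map_in_subtopology)

lemma act_continuous: "g \<in> carrier (cgroup c) \<Longrightarrow> continuous_on (cdom c) (cact c g)"
  using act_smooth by (rule smooth_on_imp_continuous_on)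

lemma act_open:
  assumes g: "g \<in> carrier (cgroup c)" and W: "openin (top_of_set (cdom c)) W"
  shows "openin (top_of_set (cdom c)) (cact c g ` W)"
proof -
  have "cact c g ` W = cdom c \<inter> cact c (inv\<^bsub>cgroup c\<^esub> g) -` W" (is "?L = ?R")
  proof
    show "?L \<subseteq> ?R"
      using openin_imp_subset[OF W] g act_closed act_inv by auto
    show "?R \<subseteq> ?L"
      using g act_inv(2) by (metis IntE image_eqI subsetI vimageD)
  qed
  then show ?thesis
    using continuous_openin_preimage[OF act_continuous _ W, of "inv\<^bsub>cgroup c\<^esub> g"] g
    by (simp add: act_closed)
qed

text \<open>The saturation of \<open>W\<close> is the union of its translates, hence open, and
  \<open>cproj c\<close> is a quotient map.\<close>

lemma proj_open:
  assumes W: "openin (top_of_set (cdom c)) W"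
  shows "openin X (cproj c ` W)"
proof -
  have sub: "W \<subseteq> cdom c" using openin_imp_subset[OF W] .
  let ?S = "{y \<in> topspace (top_of_set (cdom c)). cproj c y \<in> cproj c ` W}"
  have "?S = (\<Union>g\<in>carrier (cgroup c). cact c g ` W)"
    using sub proj_eq_iff act_closed by (auto simp: subset_iff image_iff) metis+
  then have "openin (top_of_set (cdom c)) ?S"
    using act_open[OF _ W] by auto
  moreover have "cproj c ` W \<subseteq> topspace (subtopology X (csupp c))"
    using sub supp_subset by (auto simp: csupp_def)
  ultimately have "openin (subtopology X (csupp c)) (cproj c ` W)"
    using proj_quotient unfolding quotient_map_def by blast
  then show ?thesis
    using openin_trans_full supp_open by blast
qed

lemma dom_connected: "connected (cdom c)"
proof -
  have "cdom c homeomorphic cmodel c"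
    using dom_diffeo diffeomorphism_imp_homeomorphic by (auto simp: diffeomorphic_def)
  moreover have "connected (cmodel c)"
    using model_subspace by (simp add: convex_connected subspace_imp_convex)
  ultimately show ?thesis
    using homeomorphic_connectedness by blast
qed

text \<open>The average \<open>\<phi>\<close> of the powers of \<open>g\<close> satisfies \<open>\<phi> \<circ> g = \<phi>\<close>. If \<open>g\<close> is the identity on a set
  with \<open>q\<close> in its closure, then \<open>\<phi>\<close> has derivative the identity at \<open>q\<close>, hence is injective
  near \<open>q\<close>, and so \<open>g\<close> is the identity near \<open>q\<close>.\<close>

lemma act_eq_id_near_closure:
  assumes g: "g \<in> carrier (cgroup c)" and Z: "openin (top_of_set (cdom c)) Z"
    and fix_Z: "\<And>y. y \<in> Z \<Longrightarrow> cact c g y = y" and q: "q \<in> cdom c" "q \<in> closure Z"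
  shows "\<exists>W. openin (top_of_set (cdom c)) W \<and> q \<in> W \<and> (\<forall>y\<in>W. cact c g y = y)"
proof -
  obtain P where P: "linear P" "\<And>x. P x \<in> cmodel c" "\<And>x. x \<in> cmodel c \<Longrightarrow> P x = x"
    using subspace_projection[OF model_subspace] by metis
  have sub: "Z \<subseteq> cdom c" using openin_imp_subset[OF Z] .
  have oD: "open (P -` cdom c)" and oZ: "open (P -` Z)"
    using open_vimage_projection[OF _ P(1,2)] dom_open openin_trans[OF Z dom_open] by blast+
  define N where "N = order (cgroup c)"
  have N: "N > 0" using G.order_gt_0_iff_finite finite_group by (simp add: N_def)
  define a where "a k y = cact c (g [^]\<^bsub>cgroup c\<^esub> k) y" for k :: nat and y
  define \<phi> where "\<phi> y = (1 / real N) *\<^sub>R (\<Sum>k<N. a k y)" for y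
  have a_shift: "a k (cact c g y) = a (Suc k) y" if "y \<in> cdom c" for k y
    using that g by (simp add: a_def act_mult)
  have aN: "a N y = a 0 y" for y
    using g by (simp add: a_def N_def G.pow_order_eq_1)
  \<comment> \<open>Composition with \<open>g\<close> shifts the index by one, and the term for
    \<open>N\<close> equals the term for 0 because \<open>N\<close> is the group order.\<close>
  have \<phi>_inv: "\<phi> (cact c g y) = \<phi> y" if "y \<in> cdom c" for y
    using sum.lessThan_Suc_shift[of "\<lambda>k. a k y" N] aN[of y] a_shift[OF that]
    by (simp add: \<phi>_def)
  have a_fix: "a k y = y" if "y \<in> Z" for k y
    using that sub fix_Z a_shift by (induction k) (auto simp: a_def act_one act_mult g)
  then have \<phi>_fix: "\<phi> y = y" if "y \<in> Z" for y
    using that N by (simp add: \<phi>_def sum_constant_scaleR)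
  \<comment> \<open>The summand \<open>x - P x\<close> supplies the identity in the directions off
    the model, so that the inverse function theorem applies in the ambient space.\<close>
  define f where "f x = \<phi> (P x) + (x - P x)" for x
  have f: "Cinf_on (P -` cdom c) f"
    unfolding f_def \<phi>_def a_def using g
    by (intro Cinf_on_add Cinf_on_diff Cinf_on_scaleR Cinf_on_const Cinf_on_sum oD
        Cinf_on_linear P(1) linear_ident smooth_on_projection[OF dom_open P act_smooth]) auto
  let ?D = "\<lambda>x. frechet_derivative f (at x)"
  have D_Z: "?D x = (\<lambda>v. v)" if "x \<in> P -` Z" for x
  proof -
    have "?D x = frechet_derivative (\<lambda>x. x) (at x)"
      using \<phi>_fix by (intro frechet_derivative_cong_open[OF oZ _ that]) (auto simp: f_def)
    then show ?thesis by (simp add: frechet_derivative_ident)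
  qed
  have qP: "q \<in> P -` cdom c" using q(1) P(3) dom_subset by (auto simp: subset_iff)
  have D_q: "?D q v = v" for v
  proof -
    obtain z where z: "\<And>i. z i \<in> Z" "z \<longlonglongrightarrow> q"
      using q(2) by (auto simp: closure_sequential)
    have zP: "z i \<in> P -` Z" for i using z(1)[of i] P(3) sub dom_subset by (auto simp: subset_iff)
    have "isCont (\<lambda>x. ?D x v) q"
      using Cinf_on_continuous[OF Cinf_on_frechet_derivative[OF f]] qP oD
      by (auto simp: continuous_on_eq_continuous_at)
    then have "(\<lambda>i. ?D (z i) v) \<longlonglongrightarrow> ?D q v"
      using z(2) by (rule isCont_tendsto_compose)
    then show ?thesis
      using D_Z[OF zP] by (simp add: LIMSEQ_const_iff)
  qed
  have "(f has_derivative ?D q) (at q)"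
    by (rule Cinf_on_has_derivative[OF f qP])
  moreover have "inj (?D q)" using D_q by (auto simp: inj_on_def)
  ultimately obtain U V h where U: "open U" "q \<in> U" "U \<subseteq> P -` cdom c" "homeomorphism U V f h"
    using smooth_local_inverse[OF oD qP f] by metis
  have inj: "inj_on f U" using U(4) by (metis homeomorphism_def inj_onI)
  \<comment> \<open>Injectivity of \<open>f\<close> on \<open>U\<close> is applied to
    \<open>y\<close> and its image under \<open>g\<close>, so both must lie in \<open>U\<close>;
    \<open>q\<close> qualifies because \<open>g\<close> fixes it by continuity.\<close>
  define W where "W = cdom c \<inter> U \<inter> (cdom c \<inter> cact c g -` U)"
  have Pid: "P y = y" if "y \<in> cdom c" for y using that P(3) dom_subset by blast
  have "openin (top_of_set (cdom c)) W"
    unfolding W_def using U(1) continuous_openin_preimage_gen[OF act_continuous[OF g]] by blast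
  moreover have "cact c g q = q"
  proof -
    obtain z where z: "\<And>i. z i \<in> Z" "z \<longlonglongrightarrow> q"
      using q(2) by (auto simp: closure_sequential)
    have "(\<lambda>i. cact c g (z i)) \<longlonglongrightarrow> cact c g q"
      using act_continuous[OF g] q(1) z sub unfolding continuous_on_sequentially
      by (auto simp: o_def subset_iff)
    then show ?thesis
      using fix_Z[OF z(1)] z(2) LIMSEQ_unique by auto
  qed
  then have "q \<in> W" using q(1) U(2) by (auto simp: W_def)
  moreover have "cact c g y = y" if "y \<in> W" for y
  proof (rule inj_onD[OF inj])
    show "cact c g y \<in> U" "y \<in> U" using that by (auto simp: W_def)
    have "y \<in> cdom c" using that by (auto simp: W_def)
    then show "f (cact c g y) = f y"
      using Pid act_closed[OF g] \<phi>_inv by (simp add: f_def)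
  qed
  ultimately show ?thesis by blast
qed

text \<open>The largest open set fixed pointwise by \<open>g\<close> is also relatively closed by
  the preceding lemma, and the domain is connected, being diffeomorphic to a linear space.\<close>

lemma act_rigid:
  assumes g: "g \<in> carrier (cgroup c)" and W: "openin (top_of_set (cdom c)) W" "W \<noteq> {}"
    and fix_W: "\<And>y. y \<in> W \<Longrightarrow> cact c g y = y"
  shows "g = \<one>\<^bsub>cgroup c\<^esub>"
proof -
  define Z where "Z = \<Union>{Z. openin (top_of_set (cdom c)) Z \<and> (\<forall>y\<in>Z. cact c g y = y)}"
  have Z: "openin (top_of_set (cdom c)) Z" unfolding Z_def by blast
  have fix_Z: "cact c g y = y" if "y \<in> Z" for y using that by (auto simp: Z_def)
  have "cdom c \<inter> closure Z \<subseteq> Z"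
    using act_eq_id_near_closure[OF g Z fix_Z] by (auto simp: Z_def)
  then have "Z = cdom c \<inter> closure Z"
    using openin_imp_subset[OF Z] closure_subset by blast
  then have "closedin (top_of_set (cdom c)) Z"
    by (metis closed_closure closedin_closed_Int)
  moreover have "Z \<noteq> {}" using W fix_W by (auto simp: Z_def)
  ultimately have "Z = cdom c"
    using dom_connected Z unfolding connected_clopen by blast
  then have "cact c g y = cact c \<one>\<^bsub>cgroup c\<^esub> y" if "y \<in> cdom c" for y
    using fix_Z that act_one by simp
  \<comment> \<open>Action maps are extensional, so agreement on the domain is equality of
    functions, which is what faithfulness speaks about.\<close>
  moreover have "cact c h \<in> extensional (cdom c)" if "h \<in> carrier (cgroup c)" for h
    using bij_prop0[OF that] by (simp add: Bij_def)
  ultimately have "cact c g = cact c \<one>\<^bsub>cgroup c\<^esub>"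
    using g by (intro extensionalityI[of _ "cdom c"]) auto
  then show ?thesis
    using faithful g by (simp add: inj_on_def)
qed

text \<open>By rigidity a nontrivial element moves some point of every nonempty open set, and the
  points it moves form an open set; so \<open>W\<close> can be shrunk for the finitely many elements
  one after another. A point with trivial stabilizer separates all group elements.\<close>

lemma generic_point:
  assumes W: "openin (top_of_set (cdom c)) W" "W \<noteq> {}"
  shows "\<exists>y\<in>W. \<forall>g\<in>carrier (cgroup c). \<forall>h\<in>carrier (cgroup c). cact c g y = cact c h y \<longrightarrow> g = h"
proof -
  have "\<exists>V. openin (top_of_set (cdom c)) V \<and> V \<subseteq> W \<and> V \<noteq> {} \<and> (\<forall>y\<in>V. \<forall>g\<in>T. cact c g y = y \<longrightarrow> g = \<one>\<^bsub>cgroup c\<^esub>)"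
    if "finite T" "T \<subseteq> carrier (cgroup c)" for T
    using that
  proof (induction T)
    case empty
    then show ?case using W by blast
  next
    case (insert g T)
    then obtain V where V: "openin (top_of_set (cdom c)) V" "V \<subseteq> W" "V \<noteq> {}"
      "\<forall>y\<in>V. \<forall>g\<in>T. cact c g y = y \<longrightarrow> g = \<one>\<^bsub>cgroup c\<^esub>" by blast
    have g: "g \<in> carrier (cgroup c)" using insert.prems by blast
    show ?case
    proof (cases "g = \<one>\<^bsub>cgroup c\<^esub>")
      case True
      then show ?thesis using V by blast
    next
      case False
      let ?F = "cdom c \<inter> (\<lambda>y. cact c g y - y) -` (- {0})"
      have "openin (top_of_set (cdom c)) ?F"
        by (intro continuous_openin_preimage_gen continuous_on_diff act_continuous[OF g]
            continuous_on_id) auto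
      then have "openin (top_of_set (cdom c)) (V \<inter> ?F)"
        using V(1) by blast
      moreover have "V \<inter> ?F \<noteq> {}"
      proof -
        obtain y where "y \<in> V" "cact c g y \<noteq> y"
          using act_rigid[OF g V(1,3)] False by blast
        then show ?thesis using openin_imp_subset[OF V(1)] by auto
      qed
      ultimately show ?thesis
        using V(2,4) by (intro exI[of _ "V \<inter> ?F"]) auto
    qed
  qed
  from this[OF finite_group] obtain V where V: "openin (top_of_set (cdom c)) V" "V \<subseteq> W" "V \<noteq> {}"
    "\<forall>y\<in>V. \<forall>g\<in>carrier (cgroup c). cact c g y = y \<longrightarrow> g = \<one>\<^bsub>cgroup c\<^esub>" by blast
  then obtain y where y: "y \<in> V" by blast
  then have yd: "y \<in> cdom c" using openin_imp_subset[OF V(1)] by blast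
  have "g = h" if gh: "g \<in> carrier (cgroup c)" "h \<in> carrier (cgroup c)" "cact c g y = cact c h y" for g h
  proof -
    have "cact c (inv\<^bsub>cgroup c\<^esub> h \<otimes>\<^bsub>cgroup c\<^esub> g) y = y"
      using gh yd act_inv(1) by (simp add: act_mult)
    then have "inv\<^bsub>cgroup c\<^esub> h \<otimes>\<^bsub>cgroup c\<^esub> g = \<one>\<^bsub>cgroup c\<^esub>"
      using V(4) y gh by simp
    then show ?thesis
      using gh by (metis G.inv_closed G.inv_equality G.inv_inv)
  qed
  then show ?thesis using y V(2) by blast
qed

end

section \<open>Embeddings of charts\<close>

lemma smooth_embeddingI:
  assumes "f ` A \<subseteq> B" "\<And>x. x \<in> A \<Longrightarrow> g (f x) = x" "smooth_on A f" "smooth_on (f ` A) g"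
  shows "smooth_embedding A B f"
  using assms diffeomorphismI[OF refl assms(2-4)] by (simp add: smooth_embedding_def)

lemma smooth_embeddingD:
  assumes "smooth_embedding A B f"
  shows "f ` A \<subseteq> B" "inj_on f A" "smooth_on A f" "smooth_on (f ` A) (inv_into A f)"
  using assms by (auto simp: smooth_embedding_def diffeomorphism_def bij_betw_def)

lemma smooth_embedding_compose:
  assumes f: "smooth_embedding A B f" and g: "smooth_embedding B C g"
  shows "smooth_embedding A C (\<lambda>x. g (f x))"
proof (rule smooth_embeddingI[where g="\<lambda>z. inv_into A f (inv_into B g z)"])
  note F = smooth_embeddingD[OF f] and G = smooth_embeddingD[OF g]
  show "(\<lambda>x. g (f x)) ` A \<subseteq> C" using F(1) G(1) by blast
  show "inv_into A f (inv_into B g (g (f x))) = x" if "x \<in> A" for x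
    using that F(1,2) G(2) by (simp add: image_subset_iff)
  show "smooth_on A (\<lambda>x. g (f x))"
    by (rule smooth_on_compose[OF F(3) G(3) F(1)])
  have "smooth_on ((\<lambda>x. g (f x)) ` A) (inv_into B g)"
    by (rule smooth_on_subset[OF G(4)]) (use F(1) in auto)
  then show "smooth_on ((\<lambda>x. g (f x)) ` A) (\<lambda>z. inv_into A f (inv_into B g z))"
    by (rule smooth_on_compose[OF _ F(4)]) (use F(1) G(2) in \<open>auto simp: image_subset_iff\<close>)
qed

lemma chart_embedding_compose:
  assumes "chart_embedding c d \<psi> \<theta>" and "chart_embedding d e \<phi> \<eta>"
  shows "chart_embedding c e (\<lambda>y. \<phi> (\<psi> y)) (\<lambda>g. \<eta> (\<theta> g))"
proof -
  have \<theta>: "\<theta> \<in> hom (cgroup c) (cgroup d)" and \<eta>: "\<eta> \<in> hom (cgroup d) (cgroup e)"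
    using assms by (auto simp: chart_embedding_def)
  have \<psi>: "\<psi> ` cdom c \<subseteq> cdom d"
    using assms(1) smooth_embeddingD(1)[of _ _ \<psi>] by (simp add: chart_embedding_def)
  have "(\<lambda>g. \<eta> (\<theta> g)) \<in> hom (cgroup c) (cgroup e)"
    using hom_compose[OF \<theta> \<eta>] by (simp add: o_def)
  moreover have "inj_on (\<lambda>g. \<eta> (\<theta> g)) (carrier (cgroup c))"
    using assms \<theta> by (auto simp: chart_embedding_def inj_on_def hom_def Pi_iff)
  ultimately show ?thesis
    using assms \<theta> \<psi> smooth_embedding_compose
    by (auto simp: chart_embedding_def hom_def Pi_iff image_subset_iff)
qed

locale orbi_embedding = c: orbi_chart n X c + d: orbi_chart n X d
  for n :: nat and X :: "'x topology" and c d :: "('x, 'a::euclidean_space, 'g) orbichart" +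
  fixes \<psi> :: "'a \<Rightarrow> 'a" and \<theta> :: "'g \<Rightarrow> 'g"
  assumes embedding: "chart_embedding c d \<psi> \<theta>"
begin

lemma map_closed: "y \<in> cdom c \<Longrightarrow> \<psi> y \<in> cdom d"
  and map_inj: "inj_on \<psi> (cdom c)"
  and map_smooth: "smooth_on (cdom c) \<psi>"
  and inv_smooth: "smooth_on (\<psi> ` cdom c) (inv_into (cdom c) \<psi>)"
  using embedding smooth_embeddingD[of "cdom c" "cdom d" \<psi>] by (auto simp: chart_embedding_def)

lemma hom: "\<theta> \<in> hom (cgroup c) (cgroup d)"
  and hom_inj: "inj_on \<theta> (carrier (cgroup c))"
  and equivariant: "g \<in> carrier (cgroup c) \<Longrightarrow> y \<in> cdom c \<Longrightarrow> \<psi> (cact c g y) = cact d (\<theta> g) (\<psi> y)"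
  and proj_map: "y \<in> cdom c \<Longrightarrow> cproj d (\<psi> y) = cproj c y"
  using embedding by (auto simp: chart_embedding_def)

lemma hom_closed: "g \<in> carrier (cgroup c) \<Longrightarrow> \<theta> g \<in> carrier (cgroup d)"
  using hom by (auto simp: hom_def)

text \<open>Both models have dimension \<open>n\<close>, so invariance of domain applies to the
  continuous injection \<open>\<psi>\<close>.\<close>

lemma open_image:
  assumes W: "openin (top_of_set (cdom c)) W"
  shows "openin (top_of_set (cdom d)) (\<psi> ` W)"
proof -
  have sub: "W \<subseteq> cdom c" using openin_imp_subset[OF W] .
  have "openin (top_of_set (cmodel d)) (\<psi> ` W)"
  proof (rule invariance_of_domain_subspaces)
    show "openin (top_of_set (cmodel c)) W" using openin_trans[OF W c.dom_open] .
    show "continuous_on W \<psi>"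
      using continuous_on_subset[OF smooth_on_imp_continuous_on[OF map_smooth] sub] .
    show "inj_on \<psi> W" using inj_on_subset[OF map_inj sub] .
    show "\<psi> \<in> W \<rightarrow> cmodel d" using map_closed sub d.dom_subset by auto
  qed (simp_all add: c.model_subspace d.model_subspace c.model_dim d.model_dim)
  moreover have "\<psi> ` W \<subseteq> cdom d" using map_closed sub by auto
  ultimately show ?thesis
    using openin_subset_trans d.dom_subset by blast
qed

text \<open>At a generic point \<open>y\<close> of the open overlap, \<open>y\<close> and its
  translate by \<open>g\<close> both come from \<open>c\<close> and have the same projection, so an
  element of the group of \<open>c\<close> relates them. Its image under \<open>\<theta>\<close>
  agrees with \<open>g\<close> at \<open>y\<close>, hence is \<open>g\<close>.\<close>

lemma meets_translate_imp_hom_image: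
  assumes g: "g \<in> carrier (cgroup d)" and uv: "u \<in> cdom c" "v \<in> cdom c" "cact d g (\<psi> u) = \<psi> v"
  shows "g \<in> \<theta> ` carrier (cgroup c)"
proof -
  let ?I = "\<psi> ` cdom c"
  have I: "openin (top_of_set (cdom d)) ?I" by (rule open_image) simp
  have "openin (top_of_set (cdom d)) (cdom d \<inter> cact d g -` ?I)"
    by (rule continuous_openin_preimage[OF d.act_continuous[OF g] _ I]) (use d.act_closed g in auto)
  then have "openin (top_of_set (cdom d)) (?I \<inter> (cdom d \<inter> cact d g -` ?I))"
    using I by blast
  moreover have "\<psi> u \<in> ?I \<inter> (cdom d \<inter> cact d g -` ?I)"
    using uv map_closed by auto
  ultimately obtain y where y: "y \<in> ?I" "cact d g y \<in> ?I"
    "\<forall>g\<in>carrier (cgroup d). \<forall>h\<in>carrier (cgroup d). cact d g y = cact d h y \<longrightarrow> g = h"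
    using d.generic_point by blast
  then obtain u' v' where u': "u' \<in> cdom c" "y = \<psi> u'" and v': "v' \<in> cdom c" "cact d g y = \<psi> v'"
    by blast
  have "cproj c u' = cproj c v'"
    using u' v' proj_map d.proj_act[OF g] map_closed by metis
  then obtain h where h: "h \<in> carrier (cgroup c)" "v' = cact c h u'"
    using c.proj_eq_iff u' v' by blast
  then have "cact d g y = cact d (\<theta> h) y"
    using equivariant u' v' by simp
  then have "g = \<theta> h" using y(3) g hom_closed h(1) by blast
  then show ?thesis using h(1) by blast
qed

text \<open>Here \<open>\<psi>\<close> fixes 0, so every element of the group of \<open>d\<close>
  maps a point of the image into the image and therefore lies in the range of
  \<open>\<theta>\<close>. This makes isotropy groups independent of the chart.\<close>

lemma iso_of_same_centre:
  assumes "ccentre c = ccentre d"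
  shows "\<theta> \<in> iso (cgroup c) (cgroup d)"
proof -
  have "\<psi> 0 = 0"
    using d.proj_eq_centre_iff[OF map_closed[OF c.zero_dom]] proj_map[OF c.zero_dom] assms
    by (simp add: ccentre_def)
  then have "g \<in> \<theta> ` carrier (cgroup c)" if "g \<in> carrier (cgroup d)" for g
    using meets_translate_imp_hom_image[OF that c.zero_dom c.zero_dom] d.act_zero that by simp
  then have "\<theta> ` carrier (cgroup c) = carrier (cgroup d)"
    using hom_closed by blast
  then show ?thesis
    using hom hom_inj by (simp add: iso_def bij_betw_def)
qed

end

text \<open>Translates of the image of \<open>c\<^sub>2\<close> are open and either equal or disjoint, so the connected image
  of \<open>c\<^sub>1\<close> lies in one of them.\<close>

lemma chart_embedding_factor:
  fixes c1 c2 d :: "('x, 'a::euclidean_space, 'g) orbichart"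
  assumes "orbifold_chart n X c1" "orbifold_chart n X c2" "orbifold_chart n X d"
    and e1: "chart_embedding c1 d \<psi>1 \<theta>1" and e2: "chart_embedding c2 d \<psi>2 \<theta>2"
    and supp: "csupp c1 \<subseteq> csupp c2"
  shows "\<exists>\<psi> \<theta>. chart_embedding c1 c2 \<psi> \<theta>"
proof -
  interpret A: orbi_embedding n X c1 d \<psi>1 \<theta>1
    using assms by unfold_locales
  interpret B: orbi_embedding n X c2 d \<psi>2 \<theta>2
    using assms by unfold_locales
  let ?G = "cgroup d"
  define T where "T g = cact d g ` (\<psi>2 ` cdom c2)" for g
  have T_open: "openin (top_of_set (cdom d)) (T g)" if "g \<in> carrier ?G" for g
    unfolding T_def by (rule A.d.act_open[OF that B.open_image]) simp
  have cover: "\<exists>g\<in>carrier ?G. \<psi>1 u \<in> T g" if u: "u \<in> cdom c1" for u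
  proof -
    obtain v where v: "v \<in> cdom c2" "cproj c2 v = cproj c1 u"
      using u supp by (force simp: csupp_def)
    then have "cproj d (\<psi>2 v) = cproj d (\<psi>1 u)"
      using u A.proj_map B.proj_map by simp
    then obtain g where "g \<in> carrier ?G" "\<psi>1 u = cact d g (\<psi>2 v)"
      using A.d.proj_eq_iff A.map_closed[OF u] B.map_closed[OF v(1)] by blast
    then show ?thesis using v(1) by (auto simp: T_def)
  qed
  \<comment> \<open>A common point shows that \<open>?k\<close> comes from the group of
    \<open>c2\<close>, and such elements preserve the image of \<open>c2\<close> by
    equivariance.\<close>
  have T_sub: "T g \<subseteq> T h" if gh: "g \<in> carrier ?G" "h \<in> carrier ?G" and meet: "T g \<inter> T h \<noteq> {}" for g h
  proof
    fix y assume "y \<in> T g"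
    then obtain w where w: "w \<in> cdom c2" "y = cact d g (\<psi>2 w)" by (auto simp: T_def)
    obtain u v where uv: "u \<in> cdom c2" "v \<in> cdom c2" "cact d g (\<psi>2 u) = cact d h (\<psi>2 v)"
      using meet by (fastforce simp: T_def)
    let ?k = "inv\<^bsub>?G\<^esub> h \<otimes>\<^bsub>?G\<^esub> g"
    have k: "?k \<in> carrier ?G" using gh by simp
    have "cact d ?k (\<psi>2 u) = \<psi>2 v"
      using uv gh B.map_closed by (simp add: A.d.act_mult A.d.act_inv(1))
    then obtain l where l: "l \<in> carrier (cgroup c2)" "?k = \<theta>2 l"
      using B.meets_translate_imp_hom_image[OF k uv(1,2)] by blast
    have "h \<otimes>\<^bsub>?G\<^esub> ?k = g"
      using gh by (simp add: A.d.G.m_assoc[symmetric])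
    then have "y = cact d h (cact d (\<theta>2 l) (\<psi>2 w))"
      using w gh l B.map_closed B.hom_closed by (metis A.d.act_mult k)
    also have "\<dots> = cact d h (\<psi>2 (cact c2 l w))"
      using B.equivariant l w by simp
    finally show "y \<in> T h"
      using B.c.act_closed l(1) w(1) by (auto simp: T_def)
  qed
  obtain g where g: "g \<in> carrier ?G" "\<psi>1 0 \<in> T g"
    using cover[OF A.c.zero_dom] by blast
  have image_T: "\<psi>1 ` cdom c1 \<subseteq> T g"
  proof (rule ccontr)
    assume not: "\<not> \<psi>1 ` cdom c1 \<subseteq> T g"
    let ?I = "\<psi>1 ` cdom c1"
    \<comment> \<open>\<open>T g\<close> and \<open>R\<close> are disjoint open sets that together
      contain the image of \<open>c1\<close>, which is connected and meets
      \<open>T g\<close>.\<close>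
    define R where "R = (\<Union>h\<in>{h\<in>carrier ?G. T g \<inter> T h = {}}. T h)"
    have "connected ?I"
      by (rule connected_continuous_image[OF smooth_on_imp_continuous_on[OF A.map_smooth] A.c.dom_connected])
    moreover have Isub: "?I \<subseteq> cdom d" using A.map_closed by auto
    have openI: "openin (top_of_set ?I) (?I \<inter> U)" if "openin (top_of_set (cdom d)) U" for U
    proof -
      have "cdom d \<inter> U = U" using openin_imp_subset[OF that] by blast
      then show ?thesis
        using openin_subtopology_Int_subset[OF _ Isub, of U] that by simp
    qed
    have "openin (top_of_set (cdom d)) R"
      unfolding R_def using T_open by blast
    then have "openin (top_of_set ?I) (?I \<inter> T g)" "openin (top_of_set ?I) (?I \<inter> R)"
      using openI T_open[OF g(1)] by blast+
    moreover have "?I \<subseteq> (?I \<inter> T g) \<union> (?I \<inter> R)"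
    proof
      fix y assume y: "y \<in> ?I"
      then obtain h where h: "h \<in> carrier ?G" "y \<in> T h" using cover by blast
      then show "y \<in> (?I \<inter> T g) \<union> (?I \<inter> R)"
        using T_sub[OF h(1) g(1)] y by (cases "T g \<inter> T h = {}") (auto simp: R_def)
    qed
    moreover have "(?I \<inter> T g) \<inter> (?I \<inter> R) = {}" by (auto simp: R_def)
    moreover have "?I \<inter> T g \<noteq> {}" using g(2) A.c.zero_dom by blast
    ultimately have "?I \<inter> R = {}"
      unfolding connected_openin by blast
    then show False
      using not \<open>?I \<subseteq> (?I \<inter> T g) \<union> (?I \<inter> R)\<close> by blast
  qed
  let ?i = "inv\<^bsub>?G\<^esub> g"
  have i: "?i \<in> carrier ?G" using g by simp
  have into: "cact d ?i (\<psi>1 u) \<in> \<psi>2 ` cdom c2" if "u \<in> cdom c1" for u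
    using image_T that g B.map_closed by (fastforce simp: T_def A.d.act_inv(1))
  \<comment> \<open>The translation by the inverse of \<open>g\<close> brings \<open>T g\<close>
    back to the image of \<open>c2\<close>, where \<open>\<psi>2\<close> can be inverted.\<close>
  define \<psi> where "\<psi> u = inv_into (cdom c2) \<psi>2 (cact d ?i (\<psi>1 u))" for u
  have \<psi>: "\<psi> u \<in> cdom c2" "\<psi>2 (\<psi> u) = cact d ?i (\<psi>1 u)" if "u \<in> cdom c1" for u
    using into[OF that] by (simp_all add: \<psi>_def inv_into_into f_inv_into_f)
  have \<psi>1: "\<psi>1 u = cact d g (\<psi>2 (\<psi> u))" if "u \<in> cdom c1" for u
    using \<psi>[OF that] g A.map_closed[OF that] by (simp add: A.d.act_inv)
  \<comment> \<open>Conjugation by \<open>g\<close> compensates for that translation. Since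
    \<open>K h\<close> moves a point of the image of \<open>c2\<close> into this image, it lies in
    the range of \<open>\<theta>2\<close>.\<close>
  define K where "K h = ?i \<otimes>\<^bsub>?G\<^esub> \<theta>1 h \<otimes>\<^bsub>?G\<^esub> g" for h
  have K_closed: "K h \<in> carrier ?G" if "h \<in> carrier (cgroup c1)" for h
    using that g A.hom_closed by (simp add: K_def)
  have K_act: "cact d (K h) (\<psi>2 (\<psi> u)) = \<psi>2 (\<psi> (cact c1 h u))"
    if "h \<in> carrier (cgroup c1)" "u \<in> cdom c1" for h u
  proof -
    have "\<psi>2 (\<psi> u) \<in> cdom d" using B.map_closed \<psi>(1) that(2) by blast
    then have "cact d (K h) (\<psi>2 (\<psi> u)) = cact d ?i (cact d (\<theta>1 h) (cact d g (\<psi>2 (\<psi> u))))"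
      using A.hom_closed[OF that(1)] g(1) i unfolding K_def
      by (simp only: A.d.act_mult A.d.act_closed A.d.G.m_closed)
    also have "\<dots> = cact d ?i (\<psi>1 (cact c1 h u))"
      using \<psi>1[OF that(2)] A.equivariant[OF that] by simp
    also have "\<dots> = \<psi>2 (\<psi> (cact c1 h u))"
      using \<psi>(2)[OF A.c.act_closed[OF that]] by simp
    finally show ?thesis .
  qed
  define \<theta> where "\<theta> h = inv_into (carrier (cgroup c2)) \<theta>2 (K h)" for h
  have "K h \<in> \<theta>2 ` carrier (cgroup c2)" if "h \<in> carrier (cgroup c1)" for h
    using B.meets_translate_imp_hom_image[OF K_closed[OF that] _ _ K_act[OF that A.c.zero_dom]]
      \<psi>(1) A.c.act_closed that A.c.zero_dom by blast
  then have \<theta>: "\<theta> h \<in> carrier (cgroup c2)" "\<theta>2 (\<theta> h) = K h" if "h \<in> carrier (cgroup c1)" for h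
    using that by (simp_all add: \<theta>_def inv_into_into f_inv_into_f)
  have "chart_embedding c1 c2 \<psi> \<theta>"
    unfolding chart_embedding_def
  proof (intro conjI ballI)
    show "smooth_embedding (cdom c1) (cdom c2) \<psi>"
    proof (rule smooth_embeddingI[where g="\<lambda>w. inv_into (cdom c1) \<psi>1 (cact d g (\<psi>2 w))"])
      show "\<psi> ` cdom c1 \<subseteq> cdom c2" using \<psi>(1) by auto
      show "inv_into (cdom c1) \<psi>1 (cact d g (\<psi>2 (\<psi> u))) = u" if "u \<in> cdom c1" for u
        using \<psi>1[OF that] that A.map_inj by (metis inv_into_f_f)
      have "smooth_on (cdom c1) (\<lambda>u. cact d ?i (\<psi>1 u))"
        by (rule smooth_on_compose[OF A.map_smooth A.d.act_smooth[OF i]]) (use A.map_closed in auto)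
      then show "smooth_on (cdom c1) \<psi>"
        unfolding \<psi>_def by (rule smooth_on_compose[OF _ B.inv_smooth]) (use into in auto)
      have "smooth_on (\<psi> ` cdom c1) \<psi>2"
        by (rule smooth_on_subset[OF B.map_smooth]) (use \<psi>(1) in auto)
      then have "smooth_on (\<psi> ` cdom c1) (\<lambda>w. cact d g (\<psi>2 w))"
        by (rule smooth_on_compose[OF _ A.d.act_smooth[OF g(1)]]) (use \<psi>(1) B.map_closed in auto)
      then show "smooth_on (\<psi> ` cdom c1) (\<lambda>w. inv_into (cdom c1) \<psi>1 (cact d g (\<psi>2 w)))"
        by (rule smooth_on_compose[OF _ A.inv_smooth]) (use \<psi>1 in auto)
    qed
    show "\<theta> \<in> hom (cgroup c1) (cgroup c2)"
    proof (rule homI)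
      fix h k assume hk: "h \<in> carrier (cgroup c1)" "k \<in> carrier (cgroup c1)"
      have "K (h \<otimes>\<^bsub>cgroup c1\<^esub> k) = K h \<otimes>\<^bsub>?G\<^esub> K k"
      proof -
        have cancel: "g \<otimes>\<^bsub>?G\<^esub> (?i \<otimes>\<^bsub>?G\<^esub> x) = x" if "x \<in> carrier ?G" for x
          using that g i by (simp add: A.d.G.m_assoc[symmetric])
        show ?thesis
          using hk g i A.hom_closed hom_mult[OF A.hom]
          by (simp add: K_def A.d.G.m_assoc cancel)
      qed
      then have "\<theta>2 (\<theta> (h \<otimes>\<^bsub>cgroup c1\<^esub> k)) = \<theta>2 (\<theta> h \<otimes>\<^bsub>cgroup c2\<^esub> \<theta> k)"
        using hk \<theta> hom_mult[OF B.hom] by simp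
      then show "\<theta> (h \<otimes>\<^bsub>cgroup c1\<^esub> k) = \<theta> h \<otimes>\<^bsub>cgroup c2\<^esub> \<theta> k"
        using inj_onD[OF B.hom_inj] hk \<theta>(1) by simp
    qed (use \<theta>(1) in auto)
    show "inj_on \<theta> (carrier (cgroup c1))"
    proof (rule inj_onI)
      fix h k assume hk: "h \<in> carrier (cgroup c1)" "k \<in> carrier (cgroup c1)" "\<theta> h = \<theta> k"
      then have "K h = K k" using \<theta>(2) by metis
      then have "\<theta>1 h = \<theta>1 k"
        using hk(1,2) g i A.hom_closed by (simp add: K_def)
      then show "h = k" using A.hom_inj hk by (simp add: inj_on_def)
    qed
    show "\<psi> (cact c1 h u) = cact c2 (\<theta> h) (\<psi> u)" if "h \<in> carrier (cgroup c1)" "u \<in> cdom c1" for h u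
    proof (rule inj_onD[OF B.map_inj])
      show "\<psi>2 (\<psi> (cact c1 h u)) = \<psi>2 (cact c2 (\<theta> h) (\<psi> u))"
        using K_act[OF that] B.equivariant \<theta>[OF that(1)] \<psi>(1)[OF that(2)] by simp
      show "\<psi> (cact c1 h u) \<in> cdom c2" "cact c2 (\<theta> h) (\<psi> u) \<in> cdom c2"
        using that \<psi>(1) A.c.act_closed B.c.act_closed \<theta>(1) by auto
    qed
    show "cproj c2 (\<psi> u) = cproj c1 u" if u: "u \<in> cdom c1" for u
      using u \<psi> A.map_closed A.proj_map B.proj_map A.d.proj_act[OF i] by metis
  qed
  then show ?thesis by blast
qed

section \<open>Linearization\<close>

text \<open>Actions are homomorphisms into \<open>BijGroup E\<close>, whose elements are extensional
  bijections. Bijectivity comes from the inverse element, and injectivity of \<open>\<phi>\<close>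
  from its trivial kernel.\<close>

lemma faithful_actionI:
  assumes G: "group G"
    and closed: "\<And>g y. g \<in> carrier G \<Longrightarrow> y \<in> E \<Longrightarrow> \<phi> g y \<in> E"
    and ext: "\<And>g. g \<in> carrier G \<Longrightarrow> \<phi> g \<in> extensional E"
    and one: "\<And>y. y \<in> E \<Longrightarrow> \<phi> \<one>\<^bsub>G\<^esub> y = y"
    and mult: "\<And>g h y. g \<in> carrier G \<Longrightarrow> h \<in> carrier G \<Longrightarrow> y \<in> E \<Longrightarrow> \<phi> (g \<otimes>\<^bsub>G\<^esub> h) y = \<phi> g (\<phi> h y)"
    and faithful: "\<And>g. g \<in> carrier G \<Longrightarrow> (\<And>y. y \<in> E \<Longrightarrow> \<phi> g y = y) \<Longrightarrow> g = \<one>\<^bsub>G\<^esub>"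
  shows "faithful_action G E \<phi>"
proof -
  interpret group G by (rule G)
  have bij: "\<phi> g \<in> Bij E" if g: "g \<in> carrier G" for g
  proof -
    have "bij_betw (\<phi> g) E E"
      by (rule bij_betw_byWitness[where f'="\<phi> (inv\<^bsub>G\<^esub> g)"])
        (use g closed in \<open>auto simp: one simp flip: mult\<close>)
    then show ?thesis using ext[OF g] by (simp add: Bij_def)
  qed
  have hom: "group_hom G (BijGroup E) \<phi>"
  proof (rule group_hom.intro[OF G group_BijGroup], rule group_hom_axioms.intro, rule homI)
    show "\<phi> g \<in> carrier (BijGroup E)" if "g \<in> carrier G" for g
      using bij[OF that] by (simp add: BijGroup_def)
    show "\<phi> (g \<otimes>\<^bsub>G\<^esub> h) = \<phi> g \<otimes>\<^bsub>BijGroup E\<^esub> \<phi> h" if "g \<in> carrier G" "h \<in> carrier G" for g h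
      using that bij mult ext
      by (intro extensionalityI[of _ E]) (auto simp: BijGroup_def compose_def)
  qed
  have "inj_on \<phi> (carrier G)"
  proof (rule inj_onI)
    fix g h assume gh: "g \<in> carrier G" "h \<in> carrier G" "\<phi> g = \<phi> h"
    have "\<phi> (inv\<^bsub>G\<^esub> h \<otimes>\<^bsub>G\<^esub> g) y = y" if "y \<in> E" for y
    proof -
      have "\<phi> (inv\<^bsub>G\<^esub> h \<otimes>\<^bsub>G\<^esub> g) y = \<phi> (inv\<^bsub>G\<^esub> h \<otimes>\<^bsub>G\<^esub> h) y"
        using gh that by (simp only: mult inv_closed)
      then show ?thesis using gh(2) that one by simp
    qed
    then have "inv\<^bsub>G\<^esub> h \<otimes>\<^bsub>G\<^esub> g = \<one>\<^bsub>G\<^esub>"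
      using faithful[of "inv\<^bsub>G\<^esub> h \<otimes>\<^bsub>G\<^esub> g"] gh by simp
    then show "g = h"
      using gh by (metis inv_closed inv_equality inv_inv)
  qed
  then show ?thesis
    using hom by (simp add: faithful_action_def group_action_def faithful_action_axioms_def)
qed

text \<open>A continuous open surjection is a quotient map, and images of open sets are easier to
  control than saturated sets.\<close>

lemma orbifold_chartI:
  assumes "subspace (cmodel c)" "dim (cmodel c) = n" "openin (top_of_set (cmodel c)) (cdom c)"
    "0 \<in> cdom c" "diffeomorphic (cdom c) (cmodel c)" "finite (carrier (cgroup c))"
    "faithful_action (cgroup c) (cdom c) (cact c)"
    "\<And>g. g \<in> carrier (cgroup c) \<Longrightarrow> smooth_on (cdom c) (cact c g)"
    "\<And>g. g \<in> carrier (cgroup c) \<Longrightarrow> cact c g 0 = 0"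
    and cont: "continuous_map (top_of_set (cdom c)) X (cproj c)"
    and opn: "\<And>W. openin (top_of_set (cdom c)) W \<Longrightarrow> openin X (cproj c ` W)"
    and fibres: "\<And>y z. y \<in> cdom c \<Longrightarrow> z \<in> cdom c \<Longrightarrow>
      cproj c y = cproj c z \<longleftrightarrow> (\<exists>g\<in>carrier (cgroup c). z = cact c g y)"
  shows "orbifold_chart n X c"
proof -
  have supp: "openin X (csupp c)"
    unfolding csupp_def by (rule opn) simp
  have "quotient_map (top_of_set (cdom c)) (subtopology X (csupp c)) (cproj c)"
  proof (rule continuous_open_imp_quotient_map)
    show "continuous_map (top_of_set (cdom c)) (subtopology X (csupp c)) (cproj c)"
      using cont by (auto simp: continuous_map_in_subtopology csupp_def)
    show "open_map (top_of_set (cdom c)) (subtopology X (csupp c)) (cproj c)"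
      unfolding open_map_def
    proof (intro allI impI)
      fix W assume W: "openin (top_of_set (cdom c)) W"
      then have "cproj c ` W \<subseteq> csupp c"
        using openin_imp_subset[OF W] by (auto simp: csupp_def)
      then show "openin (subtopology X (csupp c)) (cproj c ` W)"
        using opn[OF W] supp by (simp add: openin_open_subtopology)
    qed
    show "cproj c ` topspace (top_of_set (cdom c)) = topspace (subtopology X (csupp c))"
      using openin_subset[OF supp] by (auto simp: csupp_def)
  qed
  then show ?thesis
    using assms(1-9) supp fibres by (auto simp: orbifold_chart_def orbit_def)
qed

section \<open>Differentials at the centre, and averaging\<close>

context orbi_chart
begin

lemma has_differential:
  assumes "smooth_on (cdom c) f"
  shows "(f has_derivative differential c f) (at 0 within cdom c)"
proof -
  obtain W g where W: "open W" "0 \<in> W" "Cinf_on W g" "\<forall>y\<in>cdom c \<inter> W. f y = g y"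
    using assms zero_dom unfolding smooth_on_alt by blast
  have g: "(g has_derivative frechet_derivative g (at 0)) (at 0 within cdom c)"
    using Cinf_on_has_derivative[OF W(3,2)] has_derivative_at_withinI by blast
  obtain e where e: "e > 0" "ball 0 e \<subseteq> W"
    using W(1,2) open_contains_ball by blast
  have "(f has_derivative frechet_derivative g (at 0)) (at 0 within cdom c)"
    by (rule has_derivative_transform_within[OF g e(1) zero_dom])
      (use W(4) \<open>ball 0 e \<subseteq> W\<close> in \<open>auto simp: dist_commute subset_iff\<close>)
  then show ?thesis
    unfolding differential_def by (metis differentiableI frechet_derivative_works)
qed

lemma linear_differential: "smooth_on (cdom c) f \<Longrightarrow> linear (differential c f)"
  using has_derivative_linear[OF has_differential] .

lemma differential_eqI:
  assumes f: "smooth_on (cdom c) f" and eq: "\<And>y. y \<in> cdom c \<Longrightarrow> f y = g y"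
    and g: "(g has_derivative D) (at 0 within cdom c)" and v: "v \<in> cmodel c"
  shows "differential c f v = D v"
proof (rule differential_unique[OF chart _ v])
  show "(f has_derivative D) (at 0 within cdom c)"
    by (rule has_derivative_transform[OF zero_dom _ g]) (use eq in auto)
qed

lemma has_derivative_compose_differential:
  assumes f: "smooth_on (cdom c) f" "f ` cdom c \<subseteq> A" "f 0 = a"
    and h: "(h has_derivative D) (at a within A)"
  shows "((\<lambda>y. h (f y)) has_derivative (\<lambda>v. D (differential c f v))) (at 0 within cdom c)"
  by (rule has_derivative_in_compose[OF has_differential[OF f(1)]])
    (use f(3) has_derivative_subset[OF h f(2)] in simp)

text \<open>\<open>f\<close> is unchanged by a projection onto \<open>E\<close>, and its
  differential is unique on the model.\<close>

lemma differential_closed: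
  assumes f: "smooth_on (cdom c) f" "f ` cdom c \<subseteq> E" and E: "subspace E" and v: "v \<in> cmodel c"
  shows "differential c f v \<in> E"
proof -
  obtain P where P: "linear P" "\<And>x. P x \<in> E" "\<And>x. x \<in> E \<Longrightarrow> P x = x"
    using subspace_projection[OF E] by metis
  have "((\<lambda>y. P (f y)) has_derivative (\<lambda>v. P (differential c f v))) (at 0 within cdom c)"
    by (rule has_derivative_compose_differential[OF f(1) _ refl linear_imp_has_derivative[OF P(1)]]) auto
  then have "differential c f v = P (differential c f v)"
    by (rule differential_eqI[OF f(1) _ _ v, rotated]) (use f(2) P(3) in auto)
  then show ?thesis using P(2) by metis
qed

abbreviation dact :: "'g \<Rightarrow> 'a \<Rightarrow> 'a" where
  "dact g \<equiv> differential c (cact c g)"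

lemma linear_dact: "g \<in> carrier (cgroup c) \<Longrightarrow> linear (dact g)"
  by (rule linear_differential[OF act_smooth])

lemma dact_closed: "g \<in> carrier (cgroup c) \<Longrightarrow> v \<in> cmodel c \<Longrightarrow> dact g v \<in> cmodel c"
  by (rule differential_closed[OF act_smooth _ model_subspace])
    (use act_closed dom_subset in auto)

lemma dact_mult:
  assumes "g \<in> carrier (cgroup c)" "h \<in> carrier (cgroup c)" "v \<in> cmodel c"
  shows "dact (g \<otimes>\<^bsub>cgroup c\<^esub> h) v = dact g (dact h v)"
proof (rule differential_eqI[OF act_smooth _ _ assms(3)])
  show "((\<lambda>y. cact c g (cact c h y)) has_derivative (\<lambda>v. dact g (dact h v))) (at 0 within cdom c)"
    by (rule has_derivative_compose_differential[OF act_smooth _ act_zero has_differential[OF act_smooth]])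
      (use assms act_closed in auto)
qed (use assms act_mult in auto)

lemma dact_one: "v \<in> cmodel c \<Longrightarrow> dact \<one>\<^bsub>cgroup c\<^esub> v = v"
  by (rule differential_eqI[OF act_smooth _ has_derivative_ident]) (auto simp: act_one)

lemma dact_inv:
  assumes "g \<in> carrier (cgroup c)" "v \<in> cmodel c"
  shows "dact (inv\<^bsub>cgroup c\<^esub> g) (dact g v) = v" "dact g (dact (inv\<^bsub>cgroup c\<^esub> g) v) = v"
  using assms by (simp_all flip: dact_mult add: dact_one)

text \<open>The index group \<open>K\<close> is kept apart from the chart group because the source
  group also averages in the target chart, acting there through \<open>\<Theta>\<close>. The outer
  factor is the linear action and the inner one the given action, so the average intertwines the
  two.\<close>

definition average :: "('k, 'z) monoid_scheme \<Rightarrow> ('k \<Rightarrow> 'g) \<Rightarrow> ('a \<Rightarrow> 'a) \<Rightarrow> 'a \<Rightarrow> 'a" where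
  "average K \<Theta> f y =
     (1 / real (card (carrier K))) *\<^sub>R (\<Sum>g\<in>carrier K. dact (\<Theta> (inv\<^bsub>K\<^esub> g)) (f (cact c (\<Theta> g) y)))"

text \<open>At 0 each summand has the differential of \<open>\<Theta> g\<close> followed by that of
  its inverse, because \<open>f\<close> contributes the identity; so the average also has the
  identity as differential on the model.\<close>

lemma average_local_inverse:
  assumes K: "group K" "finite (carrier K)" and \<Theta>: "\<Theta> \<in> hom K (cgroup c)"
    and f: "smooth_on (cdom c) f" "f ` cdom c \<subseteq> cmodel c"
    and df: "\<And>v. v \<in> cmodel c \<Longrightarrow> differential c f v = v"
  obtains U V h where "openin (top_of_set (cmodel c)) U" "0 \<in> U" "U \<subseteq> cdom c"
    "openin (top_of_set (cmodel c)) V" "homeomorphism U V (average K \<Theta> f) h"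
    "smooth_on V h" "smooth_on U (average K \<Theta> f)"
proof -
  interpret K: group K by (rule K)
  obtain P where P: "linear P" "\<And>x. P x \<in> cmodel c" "\<And>x. x \<in> cmodel c \<Longrightarrow> P x = x"
    using subspace_projection[OF model_subspace] by metis
  let ?\<Phi> = "average K \<Theta> f"
  have \<Theta>_closed: "\<Theta> g \<in> carrier (cgroup c)" if "g \<in> carrier K" for g
    using \<Theta> that by (auto simp: hom_def)
  have \<Theta>_inv: "\<Theta> (inv\<^bsub>K\<^esub> g) = inv\<^bsub>cgroup c\<^esub> (\<Theta> g)" if "g \<in> carrier K" for g
    using group_hom.hom_inv[of K "cgroup c" \<Theta>] K(1) \<Theta> that
    by (simp add: group_hom_def group_hom_axioms_def)
  have oD: "open (P -` cdom c)"
    using open_vimage_projection[OF dom_open P(1,2)] .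
  have fg: "smooth_on (cdom c) (\<lambda>y. f (cact c (\<Theta> g) y))" if "g \<in> carrier K" for g
    by (rule smooth_on_compose[OF act_smooth f(1)]) (use that \<Theta>_closed act_closed in auto)
  have \<Phi>_mem: "?\<Phi> y \<in> cmodel c" if "y \<in> cdom c" for y
  proof -
    have "f (cact c (\<Theta> g) y) \<in> cmodel c" if "g \<in> carrier K" for g
      using f(2) act_closed[OF \<Theta>_closed[OF that] \<open>y \<in> cdom c\<close>] by blast
    then show ?thesis
      unfolding average_def
      by (intro subspace_scale[OF model_subspace] subspace_sum[OF model_subspace] dact_closed \<Theta>_closed) auto
  qed
  \<comment> \<open>The transverse summand makes the derivative at 0 the identity of the whole
    ambient space.\<close>
  define F where "F x = ?\<Phi> (P x) + (x - P x)" for x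
  have F: "Cinf_on (P -` cdom c) F"
    unfolding F_def average_def
    by (intro Cinf_on_add Cinf_on_diff Cinf_on_scaleR Cinf_on_const Cinf_on_sum oD
        Cinf_on_compose_linear[OF oD linear_dact] Cinf_on_linear P(1) linear_ident
        smooth_on_projection[OF dom_open P fg]) (auto simp: \<Theta>_closed)
  have Pid: "P y = y" if "y \<in> cdom c" for y using that P(3) dom_subset by blast
  have F_eq: "F y = ?\<Phi> y" if "y \<in> cmodel c" for y
    using P(3)[OF that] by (simp add: F_def)
  have zP: "0 \<in> P -` cdom c" using zero_dom Pid[OF zero_dom] by simp
  have dF: "(F has_derivative (\<lambda>v. v)) (at 0)"
  proof -
    have "((\<lambda>y. f (cact c (\<Theta> g) y)) has_derivative (\<lambda>v. differential c f (dact (\<Theta> g) v))) (at 0 within cdom c)"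
      if "g \<in> carrier K" for g
      by (rule has_derivative_compose_differential[OF act_smooth _ act_zero has_differential[OF f(1)]])
        (use that \<Theta>_closed act_closed in auto)
    then have "((\<lambda>y. dact (\<Theta> (inv\<^bsub>K\<^esub> g)) (f (cact c (\<Theta> g) y))) has_derivative
        (\<lambda>v. dact (\<Theta> (inv\<^bsub>K\<^esub> g)) (differential c f (dact (\<Theta> g) v)))) (at 0 within cdom c)"
      if "g \<in> carrier K" for g
      using that
      by (intro bounded_linear.has_derivative[OF linear_dact[OF \<Theta>_closed, unfolded linear_conv_bounded_linear]])
        auto
    then have d\<Phi>: "(?\<Phi> has_derivative (\<lambda>v. (1 / real (card (carrier K))) *\<^sub>R
        (\<Sum>g\<in>carrier K. dact (\<Theta> (inv\<^bsub>K\<^esub> g)) (differential c f (dact (\<Theta> g) v))))) (at 0 within cdom c)"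
      (is "(_ has_derivative ?D) _")
      unfolding average_def by (intro has_derivative_scaleR_right has_derivative_sum)
    have "(P has_derivative P) (at 0 within P -` cdom c)"
      by (rule has_derivative_at_withinI[OF linear_imp_has_derivative[OF P(1)]])
    moreover have "(?\<Phi> has_derivative ?D) (at (P 0) within P ` (P -` cdom c))"
      unfolding linear_0[OF P(1)] by (rule has_derivative_subset[OF d\<Phi>]) auto
    ultimately have "((\<lambda>x. ?\<Phi> (P x)) has_derivative (\<lambda>v. ?D (P v))) (at 0 within P -` cdom c)"
      by (rule has_derivative_in_compose)
    moreover have "?D (P v) = P v" for v
    proof -
      have "dact (\<Theta> (inv\<^bsub>K\<^esub> g)) (differential c f (dact (\<Theta> g) (P v))) = P v" if "g \<in> carrier K" for g
        using that \<Theta>_inv \<Theta>_closed df dact_closed P(2) dact_inv(1) by simp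
      moreover have "carrier K \<noteq> {}" using K.one_closed by blast
      ultimately show ?thesis using K(2) by (simp add: sum_constant_scaleR)
    qed
    ultimately have "((\<lambda>x. ?\<Phi> (P x)) has_derivative P) (at 0 within P -` cdom c)"
      by simp
    then have "((\<lambda>x. ?\<Phi> (P x)) has_derivative P) (at 0)"
      unfolding at_within_open[OF zP oD] .
    then have "(F has_derivative (\<lambda>v. P v + (v - P v))) (at 0)"
      unfolding F_def using linear_imp_has_derivative[OF P(1)]
      by (intro has_derivative_add has_derivative_diff has_derivative_ident)
    then show ?thesis by simp
  qed
  have "inj (\<lambda>v::'a. v)" by simp
  then obtain U V h where U: "open U" "0 \<in> U" "U \<subseteq> P -` cdom c" "open V" "homeomorphism U V F h" "Cinf_on V h"
    using smooth_local_inverse[OF oD zP F dF] by metis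
  have UE: "cmodel c \<inter> U \<subseteq> cdom c" using U(3) P(3) by auto
  \<comment> \<open>The inverse of the extended map must not leave the model:
    \<open>h y - P (h y)\<close> equals \<open>y - ?\<Phi> (P (h y))\<close>, a difference of model
    vectors.\<close>
  have hV: "h y \<in> cmodel c \<inter> U" if "y \<in> cmodel c \<inter> V" for y
  proof -
    have hU: "h y \<in> U" "F (h y) = y"
      using U(5) that by (auto simp: homeomorphism_def)
    have "P (h y) \<in> cdom c" using hU(1) U(3) by blast
    have "h y - P (h y) = y - ?\<Phi> (P (h y))"
      using hU(2) unfolding F_def by (simp add: algebra_simps)
    then have "h y - P (h y) \<in> cmodel c"
      using that \<Phi>_mem[OF \<open>P (h y) \<in> cdom c\<close>] subspace_diff[OF model_subspace] by simp
    then have "h y \<in> cmodel c"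
      using subspace_add[OF model_subspace _ P(2)[of "h y"]] by fastforce
    then show ?thesis using hU(1) by blast
  qed
  have FU: "?\<Phi> y \<in> cmodel c \<inter> V" if "y \<in> cmodel c \<inter> U" for y
  proof -
    have "F y \<in> V" using that U(5) by (auto simp: homeomorphism_def)
    then show ?thesis using that UE \<Phi>_mem F_eq by auto
  qed
  have F_smooth: "smooth_on (cmodel c \<inter> U) ?\<Phi>"
    by (rule smooth_on_cong[OF Cinf_on_imp_smooth_on[OF oD F]]) (use U(3) F_eq in auto)
  have h_smooth: "smooth_on (cmodel c \<inter> V) h"
    by (rule Cinf_on_imp_smooth_on[OF U(4,6)]) auto
  have left: "h (?\<Phi> y) = y" if "y \<in> cmodel c \<inter> U" for y
    using that U(5) F_eq by (auto simp: homeomorphism_def)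
  have right: "?\<Phi> (h y) = y" if "y \<in> cmodel c \<inter> V" for y
    using that U(5) F_eq[of "h y"] hV[OF that] by (auto simp: homeomorphism_def)
  have "homeomorphism (cmodel c \<inter> U) (cmodel c \<inter> V) ?\<Phi> h"
  proof (rule homeomorphismI)
    show "continuous_on (cmodel c \<inter> U) ?\<Phi>" "continuous_on (cmodel c \<inter> V) h"
      using F_smooth h_smooth smooth_on_imp_continuous_on by blast+
  qed (use FU hV left right in blast)+
  moreover have "0 \<in> cmodel c \<inter> U" using U(2) subspace_0[OF model_subspace] by blast
  ultimately show thesis
    using that[of "cmodel c \<inter> U" "cmodel c \<inter> V" h] UE U(1,4) F_smooth h_smooth by (simp add: openin_open_Int)
qed

end

section \<open>Slices\<close>

text \<open>The slice is described twice, as a linear piece and as the part lying over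
  \<open>Y\<close>. The first is what a suborbifold chart demands; the second makes its
  compatibility with the group and with embeddings automatic.\<close>

definition slice_chart ::
    "nat \<Rightarrow> 'x topology \<Rightarrow> 'x set \<Rightarrow> nat \<Rightarrow> ('x, 'a::euclidean_space, 'g) orbichart \<Rightarrow> 'a set \<Rightarrow> bool" where
  "slice_chart n X Y k c L \<longleftrightarrow>
     orbifold_chart n X c \<and> subspace L \<and> L \<subseteq> cmodel c \<and> dim L = k \<and>
     cdom c \<inter> L = {y\<in>cdom c. cproj c y \<in> Y} \<and> diffeomorphic (cdom c \<inter> L) L \<and>
     (\<forall>g\<in>carrier (cgroup c). \<exists>A. linear A \<and> (\<forall>y\<in>cdom c. cact c g y = A y))"

locale orbi_submersion = c: orbi_chart n X c + d: orbi_chart m Z d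
  for n :: nat and X :: "'x topology" and c :: "('x, 'a::euclidean_space, 'g) orbichart"
    and m :: nat and Z :: "'y topology" and d :: "('y, 'b::euclidean_space, 'h) orbichart" +
  fixes f :: "'a \<Rightarrow> 'b" and \<Theta> :: "'g \<Rightarrow> 'h"
  assumes f_smooth: "smooth_on (cdom c) f" and f_closed: "y \<in> cdom c \<Longrightarrow> f y \<in> cdom d"
    and f_zero: "f 0 = 0" and hom: "\<Theta> \<in> hom (cgroup c) (cgroup d)"
    and equivariant: "g \<in> carrier (cgroup c) \<Longrightarrow> y \<in> cdom c \<Longrightarrow> f (cact c g y) = cact d (\<Theta> g) (f y)"
    and surj: "differential c f ` cmodel c = cmodel d"
begin

abbreviation "T \<equiv> differential c f"

definition "K = {v \<in> cmodel c. T v = 0}"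

lemma linear_T: "linear T"
  by (rule c.linear_differential[OF f_smooth])

lemma hom_closed: "g \<in> carrier (cgroup c) \<Longrightarrow> \<Theta> g \<in> carrier (cgroup d)"
  using hom by (auto simp: hom_def)

text \<open>The chain rule at 0 for both sides of the equivariance of \<open>f\<close>, using that
  the action and \<open>f\<close> fix 0.\<close>

lemma T_dact:
  assumes g: "g \<in> carrier (cgroup c)" and v: "v \<in> cmodel c"
  shows "T (c.dact g v) = d.dact (\<Theta> g) (T v)"
proof -
  have s: "smooth_on (cdom c) (\<lambda>y. f (cact c g y))"
    by (rule smooth_on_compose[OF c.act_smooth[OF g] f_smooth]) (use c.act_closed g in auto)
  have "((\<lambda>y. f (cact c g y)) has_derivative (\<lambda>v. T (c.dact g v))) (at 0 within cdom c)"
    by (rule c.has_derivative_compose_differential[OF c.act_smooth _ c.act_zero c.has_differential[OF f_smooth]])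
      (use g c.act_closed in auto)
  then have "differential c (\<lambda>y. f (cact c g y)) v = T (c.dact g v)"
    by (rule c.differential_eqI[OF s refl _ v])
  moreover have "((\<lambda>y. cact d (\<Theta> g) (f y)) has_derivative (\<lambda>v. d.dact (\<Theta> g) (T v))) (at 0 within cdom c)"
    by (rule c.has_derivative_compose_differential[OF f_smooth _ f_zero d.has_differential[OF d.act_smooth]])
      (use hom_closed g f_closed in auto)
  then have "differential c (\<lambda>y. f (cact c g y)) v = d.dact (\<Theta> g) (T v)"
    by (rule c.differential_eqI[OF s _ _ v, rotated]) (use equivariant g in auto)
  ultimately show ?thesis by simp
qed

lemma K_subspace: "subspace K"
  unfolding K_def subspace_def
  using c.model_subspace linear_T by (auto simp: subspace_def linear_0 linear_add linear_scale)

lemma right_inverse_T: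
  obtains s where "linear s" "\<And>w. s w \<in> cmodel c" "\<And>w. w \<in> cmodel d \<Longrightarrow> T (s w) = w"
proof -
  have "\<exists>g. g ` UNIV \<subseteq> cmodel c \<and> linear g \<and> (\<forall>v\<in>T ` cmodel c. T (g v) = v)"
    by (rule linear_exists_right_inverse_on[OF linear_T c.model_subspace])
  then show thesis using that surj by (auto simp: image_subset_iff)
qed

text \<open>A linear right inverse \<open>s\<close> of \<open>T\<close> splits the model into
  \<open>K\<close> and the image of \<open>cmodel d\<close> under \<open>s\<close>, which has
  dimension \<open>m\<close>.\<close>

lemma dim_K: "dim K = n - m"
proof -
  obtain s where s: "linear s" "\<And>w. s w \<in> cmodel c" "\<And>w. w \<in> cmodel d \<Longrightarrow> T (s w) = w"
    by (rule right_inverse_T) blast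
  let ?S = "s ` cmodel d"
  have S: "subspace ?S" by (rule linear_subspace_image[OF s(1) d.model_subspace])
  have inj: "inj_on s (cmodel d)" by (metis inj_onI s(3))
  have "dim ?S = m"
    using dim_image_eq[OF s(1)] inj d.model_subspace d.model_dim by (metis span_eq_iff)
  moreover have "K \<inter> ?S = {0}"
    using s linear_0[OF s(1)] subspace_0[OF K_subspace] subspace_0[OF d.model_subspace]
    by (auto simp: K_def image_iff)
  moreover have "{x + y |x y. x \<in> K \<and> y \<in> ?S} = cmodel c"
  proof
    show "{x + y |x y. x \<in> K \<and> y \<in> ?S} \<subseteq> cmodel c"
      using s(2) subspace_add[OF c.model_subspace] by (auto simp: K_def)
    show "cmodel c \<subseteq> {x + y |x y. x \<in> K \<and> y \<in> ?S}"
    proof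
      fix v assume v: "v \<in> cmodel c"
      then have Tv: "T v \<in> cmodel d" using surj by blast
      have "v - s (T v) \<in> K"
        using v s(2) s(3)[OF Tv] subspace_diff[OF c.model_subspace] linear_diff[OF linear_T]
        by (simp add: K_def)
      then show "v \<in> {x + y |x y. x \<in> K \<and> y \<in> ?S}"
        using Tv by (intro CollectI exI[of _ "v - s (T v)"] exI[of _ "s (T v)"]) auto
    qed
  qed
  ultimately show ?thesis
    using dim_sums_Int[OF K_subspace S] c.model_dim by simp
qed


text \<open>The factorization \<open>T \<circ> \<Phi> = \<eta> \<circ> f\<close> holds with \<open>\<eta>\<close> the average of the identity over the action
  on the target.\<close>

lemma exists_slice_straightening:
  obtains \<Phi> U V h N where
    "openin (top_of_set (cmodel c)) U" "0 \<in> U" "U \<subseteq> cdom c" "openin (top_of_set (cmodel c)) V"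
    "homeomorphism U V \<Phi> h" "smooth_on U \<Phi>" "smooth_on V h" "\<Phi> 0 = 0"
    "\<And>g y. g \<in> carrier (cgroup c) \<Longrightarrow> y \<in> cdom c \<Longrightarrow> \<Phi> (cact c g y) = c.dact g (\<Phi> y)"
    "openin (top_of_set (cdom c)) N" "0 \<in> N"
    "\<And>y. y \<in> N \<Longrightarrow> \<Phi> y \<in> K \<longleftrightarrow> f y = 0"
proof -
  let ?G = "cgroup c"
  obtain s where s: "linear s" "\<And>w. s w \<in> cmodel c" "\<And>w. w \<in> cmodel d \<Longrightarrow> T (s w) = w"
    by (rule right_inverse_T) blast
  \<comment> \<open>The component \<open>s (T y)\<close> of \<open>y\<close> is replaced by
    \<open>s (f y)\<close>; hence \<open>T (\<phi> y) = f y\<close>, and to first order at 0 nothing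
    changes.\<close>
  define \<phi> where "\<phi> y = y - s (T y) + s (f y)" for y
  have T_closed: "T v \<in> cmodel d" if "v \<in> cmodel c" for v using surj that by blast
  have \<phi>_smooth: "smooth_on (cdom c) \<phi>"
    unfolding smooth_on_alt
  proof
    fix x assume "x \<in> cdom c"
    then obtain W f' where W: "open W" "x \<in> W" "Cinf_on W f'" "\<forall>y\<in>cdom c \<inter> W. f y = f' y"
      using f_smooth unfolding smooth_on_alt by blast
    have "Cinf_on W (\<lambda>y. y - s (T y) + s (f' y))"
      by (intro Cinf_on_add Cinf_on_diff Cinf_on_compose_linear[OF _ s(1)] Cinf_on_linear linear_ident
          linear_T W)
    then show "\<exists>W g. open W \<and> x \<in> W \<and> Cinf_on W g \<and> (\<forall>y\<in>cdom c \<inter> W. \<phi> y = g y)"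
      using W by (intro exI[of _ W] exI[of _ "\<lambda>y. y - s (T y) + s (f' y)"]) (auto simp: \<phi>_def)
  qed
  have \<phi>_closed: "\<phi> y \<in> cmodel c" if "y \<in> cdom c" for y
    unfolding \<phi>_def using that c.dom_subset s(2)
    by (intro subspace_add[OF c.model_subspace] subspace_diff[OF c.model_subspace]) auto
  have T_\<phi>: "T (\<phi> y) = f y" if "y \<in> cdom c" for y
    using that c.dom_subset T_closed s(3) f_closed d.dom_subset
    by (auto simp: \<phi>_def linear_add[OF linear_T] linear_diff[OF linear_T] subset_iff)
  have d\<phi>: "differential c \<phi> v = v" if "v \<in> cmodel c" for v
  proof -
    have bl: "bounded_linear s" using s(1) by (simp add: linear_conv_bounded_linear)
    have T': "(T has_derivative T) (at 0 within cdom c)"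
      by (rule has_derivative_at_withinI[OF linear_imp_has_derivative[OF linear_T]])
    have "(\<phi> has_derivative (\<lambda>v. v - s (T v) + s (T v))) (at 0 within cdom c)"
      unfolding \<phi>_def
      by (intro has_derivative_add has_derivative_diff has_derivative_ident
          bounded_linear.has_derivative[OF bl T'] bounded_linear.has_derivative[OF bl c.has_differential[OF f_smooth]])
    then show ?thesis
      using c.differential_eqI[OF \<phi>_smooth refl _ that] by simp
  qed
  define \<Phi> where "\<Phi> = c.average ?G (\<lambda>g. g) \<phi>"
  have id_hom: "(\<lambda>g. g) \<in> hom ?G ?G" by (auto simp: hom_def)
  obtain U V h where U: "openin (top_of_set (cmodel c)) U" "0 \<in> U" "U \<subseteq> cdom c"
    "openin (top_of_set (cmodel c)) V" "homeomorphism U V \<Phi> h" "smooth_on V h" "smooth_on U \<Phi>"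
    unfolding \<Phi>_def
    by (rule c.average_local_inverse[OF c.G.group_axioms c.finite_group id_hom \<phi>_smooth _ d\<phi>])
      (use \<phi>_closed in auto)
  define \<eta> where "\<eta> = d.average ?G \<Theta> (\<lambda>z. z)"
  have id_smooth: "smooth_on (cdom d) (\<lambda>z. z)" by (rule smooth_on_linear[OF linear_ident])
  have "differential d (\<lambda>z. z) w = w" if "w \<in> cmodel d" for w
    by (rule d.differential_eqI[OF id_smooth refl has_derivative_ident that])
  then obtain U' V' h' where U': "openin (top_of_set (cmodel d)) U'" "0 \<in> U'" "U' \<subseteq> cdom d"
    "homeomorphism U' V' \<eta> h'"
    unfolding \<eta>_def
    using d.average_local_inverse[OF c.G.group_axioms c.finite_group hom id_smooth] d.dom_subset
    by (metis image_ident)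
  have card: "real (card (carrier ?G)) \<noteq> 0"
    using c.finite_group c.G.one_closed by auto
  have \<eta>_zero: "\<eta> 0 = 0"
    unfolding \<eta>_def d.average_def
    using d.act_zero hom_closed linear_0[OF d.linear_dact] by simp
  have \<Phi>_zero: "\<Phi> 0 = 0"
    unfolding \<Phi>_def c.average_def
    using c.act_zero linear_0[OF c.linear_dact] linear_0[OF linear_T] linear_0[OF s(1)] f_zero
    by (simp add: \<phi>_def)
  \<comment> \<open>Right translation of the summation index by \<open>g\<close> brings
    \<open>g\<close> out in front as a linear map.\<close>
  have equi: "\<Phi> (cact c g y) = c.dact g (\<Phi> y)" if g: "g \<in> carrier ?G" and y: "y \<in> cdom c" for g y
  proof -
    have "(\<Sum>k\<in>carrier ?G. c.dact (inv\<^bsub>?G\<^esub> k) (\<phi> (cact c k (cact c g y)))) =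
        (\<Sum>k\<in>carrier ?G. c.dact g (c.dact (inv\<^bsub>?G\<^esub> k) (\<phi> (cact c k y))))"
    proof (rule sum.reindex_bij_witness[of _ "\<lambda>k. k \<otimes>\<^bsub>?G\<^esub> inv\<^bsub>?G\<^esub> g" "\<lambda>k. k \<otimes>\<^bsub>?G\<^esub> g"])
      fix k assume k: "k \<in> carrier ?G"
      have "c.dact g (c.dact (inv\<^bsub>?G\<^esub> (k \<otimes>\<^bsub>?G\<^esub> g)) (\<phi> (cact c (k \<otimes>\<^bsub>?G\<^esub> g) y))) =
          c.dact (g \<otimes>\<^bsub>?G\<^esub> inv\<^bsub>?G\<^esub> (k \<otimes>\<^bsub>?G\<^esub> g)) (\<phi> (cact c (k \<otimes>\<^bsub>?G\<^esub> g) y))"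
        using g k y \<phi>_closed c.act_closed by (simp add: c.dact_mult)
      also have "g \<otimes>\<^bsub>?G\<^esub> inv\<^bsub>?G\<^esub> (k \<otimes>\<^bsub>?G\<^esub> g) = inv\<^bsub>?G\<^esub> k"
        using g k by (simp add: c.G.inv_mult_group c.G.m_assoc[symmetric])
      finally show "c.dact g (c.dact (inv\<^bsub>?G\<^esub> (k \<otimes>\<^bsub>?G\<^esub> g)) (\<phi> (cact c (k \<otimes>\<^bsub>?G\<^esub> g) y))) =
          c.dact (inv\<^bsub>?G\<^esub> k) (\<phi> (cact c k (cact c g y)))"
        using g k y by (simp add: c.act_mult)
    qed (use g in \<open>auto simp: c.G.m_assoc\<close>)
    then show ?thesis
      unfolding \<Phi>_def c.average_def
      by (simp add: linear_scale[OF c.linear_dact[OF g]] linear_sum[OF c.linear_dact[OF g]])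
  qed
  \<comment> \<open>\<open>T\<close> carries the summands of \<open>\<Phi>\<close> at
    \<open>y\<close> to those of \<open>\<eta>\<close> at \<open>f y\<close>. There the linear
    action of the inverse meets the given action of the element, so they do not cancel to
    \<open>f y\<close>.\<close>
  have T_\<Phi>: "T (\<Phi> y) = \<eta> (f y)" if y: "y \<in> cdom c" for y
  proof -
    have "T (c.dact (inv\<^bsub>?G\<^esub> g) (\<phi> (cact c g y))) = d.dact (\<Theta> (inv\<^bsub>?G\<^esub> g)) (cact d (\<Theta> g) (f y))"
      if g: "g \<in> carrier ?G" for g
      using T_dact[of "inv\<^bsub>?G\<^esub> g" "\<phi> (cact c g y)"] g y \<phi>_closed T_\<phi> c.act_closed equivariant by simp
    then show ?thesis
      unfolding \<Phi>_def \<eta>_def c.average_def d.average_def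
      by (simp add: linear_scale[OF linear_T] linear_sum[OF linear_T])
  qed
  have \<Phi>_closed: "\<Phi> y \<in> cmodel c" if y: "y \<in> cdom c" for y
    unfolding \<Phi>_def c.average_def using y
    by (intro subspace_scale[OF c.model_subspace] subspace_sum[OF c.model_subspace] c.dact_closed \<phi>_closed
        c.act_closed) auto
  \<comment> \<open>Injectivity of \<open>\<eta>\<close> is available on \<open>U'\<close>; for
    these \<open>y\<close>, vanishing of \<open>\<eta> (f y)\<close> forces
    \<open>f y = 0\<close>.\<close>
  define N where "N = cdom c \<inter> f -` U'"
  have "openin (top_of_set (cdom d)) U'"
    using openin_subset_trans[OF U'(1,3) d.dom_subset] .
  then have "openin (top_of_set (cdom c)) N"
    unfolding N_def
    by (intro continuous_openin_preimage[OF smooth_on_imp_continuous_on[OF f_smooth]]) (use f_closed in auto)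
  moreover have "0 \<in> N" using c.zero_dom f_zero U'(2) by (simp add: N_def)
  moreover have "\<Phi> y \<in> K \<longleftrightarrow> f y = 0" if "y \<in> N" for y
  proof -
    have y: "y \<in> cdom c" "f y \<in> U'" using that by (auto simp: N_def)
    have "\<Phi> y \<in> K \<longleftrightarrow> \<eta> (f y) = \<eta> 0"
      using \<Phi>_closed[OF y(1)] T_\<Phi>[OF y(1)] \<eta>_zero by (simp add: K_def)
    also have "\<dots> \<longleftrightarrow> f y = 0"
      using U'(4) U'(2) y(2) unfolding homeomorphism_def by metis
    finally show ?thesis .
  qed
  ultimately show thesis
    using that[OF U(1-5,7,6) \<Phi>_zero equi] by blast
qed

text \<open>The chart \<open>c\<close> is read in the coordinate \<open>\<Phi>\<close>, where the
  action becomes linear. The group stays the same, so the embedding goes with the identity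
  homomorphism; \<open>W\<close> allows arbitrarily small charts.\<close>

lemma exists_linear_slice:
  assumes W: "openin (top_of_set (cdom c)) W" "0 \<in> W"
  obtains c' h where "orbifold_chart n X c'" "chart_embedding c' c h (\<lambda>g. g)"
    "cgroup c' = cgroup c" "cmodel c' = cmodel c" "ccentre c' = ccentre c" "h ` cdom c' \<subseteq> W"
    "cdom c' \<inter> K = {v\<in>cdom c'. f (h v) = 0}" "diffeomorphic (cdom c' \<inter> K) K"
    "\<And>g v. g \<in> carrier (cgroup c) \<Longrightarrow> v \<in> cdom c' \<Longrightarrow> cact c' g v = c.dact g v"
proof -
  let ?G = "cgroup c" and ?E = "cmodel c"
  obtain \<Phi> U V h N where
    U: "openin (top_of_set ?E) U" "0 \<in> U" "U \<subseteq> cdom c" and V: "openin (top_of_set ?E) V"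
    and h: "homeomorphism U V \<Phi> h" "smooth_on U \<Phi>" "smooth_on V h" "\<Phi> 0 = 0"
    and equi: "\<And>g y. g \<in> carrier ?G \<Longrightarrow> y \<in> cdom c \<Longrightarrow> \<Phi> (cact c g y) = c.dact g (\<Phi> y)"
    and N: "openin (top_of_set (cdom c)) N" "0 \<in> N" "\<And>y. y \<in> N \<Longrightarrow> \<Phi> y \<in> K \<longleftrightarrow> f y = 0"
    by (rule exists_slice_straightening) blast
  have hU: "h v \<in> U" "\<Phi> (h v) = v" if "v \<in> V" for v
    using h(1) that by (auto simp: homeomorphism_def)
  have \<Phi>U: "\<Phi> y \<in> V" "h (\<Phi> y) = y" if "y \<in> U" for y
    using h(1) that by (auto simp: homeomorphism_def)
  have h0: "h 0 = 0" "0 \<in> V" using \<Phi>U[OF U(2)] h(4) by auto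
  \<comment> \<open>Besides lying in \<open>W\<close> and \<open>N\<close>, these points have their
    whole orbit in \<open>U\<close>: there \<open>h\<close> undoes \<open>\<Phi>\<close> at every
    translate, which makes \<open>h\<close> equivariant.\<close>
  define U1 where "U1 = W \<inter> N \<inter> (\<Inter>g\<in>carrier ?G. cdom c \<inter> cact c g -` U)"
  have oU: "openin (top_of_set (cdom c)) (cdom c \<inter> cact c g -` U)" if "g \<in> carrier ?G" for g
    by (rule continuous_openin_preimage[OF c.act_continuous[OF that] _ openin_subset_trans[OF U(1,3) c.dom_subset]])
      (use that c.act_closed in auto)
  have "carrier ?G \<noteq> {}" using c.G.one_closed by blast
  then have "openin (top_of_set (cdom c)) U1"
    unfolding U1_def by (rule openin_Int[OF openin_Int[OF W(1) N(1)] openin_INT2[OF c.finite_group _ oU]])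
  moreover have "U1 \<subseteq> U"
  proof
    fix y assume y: "y \<in> U1"
    then have "cact c \<one>\<^bsub>?G\<^esub> y \<in> U" using c.G.one_closed unfolding U1_def by blast
    moreover have "y \<in> cdom c" using y openin_imp_subset[OF W(1)] unfolding U1_def by blast
    ultimately show "y \<in> U" by (simp add: c.act_one)
  qed
  ultimately have U1: "openin (top_of_set U) U1"
    using U(3) openin_subset_trans by blast
  have "0 \<in> U1"
    using W(2) N(2) c.zero_dom c.act_zero U(2) by (auto simp: U1_def)
  have "openin (top_of_set V) (V \<inter> h -` U1)"
    using h(1) U1 by (intro continuous_openin_preimage[of V h U]) (auto simp: homeomorphism_def)
  then have "openin (top_of_set ?E) (V \<inter> h -` U1)"
    using V openin_trans by blast
  moreover have "0 \<in> V \<inter> h -` U1" using h0 \<open>0 \<in> U1\<close> by simp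
  ultimately obtain r where r: "r > 0" "ball 0 r \<inter> ?E \<subseteq> V \<inter> h -` U1"
    by (meson openin_contains_ball)
  \<comment> \<open>Summation over the group makes \<open>q\<close> invariant. On the model the
    summand of the unit is \<open>(norm v)^2\<close>, so the \<open>q\<close>-ball lies inside the
    norm ball of the same radius.\<close>
  define q where "q v = (\<Sum>g\<in>carrier ?G. c.dact g v \<bullet> c.dact g v)" for v
  define B where "B = {v\<in>?E. q v < r\<^sup>2}"
  have q_smooth: "Cinf_on UNIV q"
    unfolding q_def by (intro Cinf_on_sum Cinf_on_inner Cinf_on_linear c.linear_dact) auto
  have q_scale: "q (t *\<^sub>R v) = t\<^sup>2 * q v" for t v
    unfolding q_def by (simp add: linear_scale[OF c.linear_dact] sum_distrib_left power2_eq_square mult.assoc)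
  have q_nonneg: "0 \<le> q v" for v
    unfolding q_def by (intro sum_nonneg) auto
  have q_ge: "(norm v)\<^sup>2 \<le> q v" if "v \<in> ?E" for v
  proof -
    have "(norm v)\<^sup>2 = c.dact \<one>\<^bsub>?G\<^esub> v \<bullet> c.dact \<one>\<^bsub>?G\<^esub> v"
      using c.dact_one[OF that] by (simp add: power2_norm_eq_inner)
    also have "\<dots> \<le> q v"
      unfolding q_def by (rule member_le_sum) (auto simp: c.finite_group)
    finally show ?thesis .
  qed
  have q_dact: "q (c.dact g v) = q v" if "g \<in> carrier ?G" "v \<in> ?E" for g v
    unfolding q_def
    by (rule sum.reindex_bij_witness[of _ "\<lambda>k. k \<otimes>\<^bsub>?G\<^esub> inv\<^bsub>?G\<^esub> g" "\<lambda>k. k \<otimes>\<^bsub>?G\<^esub> g"])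
      (use that in \<open>auto simp: c.G.m_assoc c.dact_mult\<close>)
  have B_V: "v \<in> V" "h v \<in> U1" "h v \<in> cdom c" if "v \<in> B" for v
  proof -
    have "(norm v)\<^sup>2 < r\<^sup>2" using that q_ge by (fastforce simp: B_def)
    then have "norm v < r" using r(1) by (simp add: power_less_imp_less_base)
    then have "v \<in> ball 0 r \<inter> ?E" using that by (simp add: B_def)
    then show "v \<in> V" "h v \<in> U1" using r(2) by auto
    then show "h v \<in> cdom c" using hU U(3) by blast
  qed
  have B_dact: "c.dact g v \<in> B" if "g \<in> carrier ?G" "v \<in> B" for g v
    using that q_dact c.dact_closed by (simp add: B_def)
  have h_equi: "h (c.dact g v) = cact c g (h v)" if "g \<in> carrier ?G" "v \<in> B" for g v
  proof -
    have "cact c g (h v) \<in> U" using B_V(2)[OF that(2)] that(1) unfolding U1_def by blast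
    then show ?thesis
      using \<Phi>U(2) equi[OF that(1) B_V(3)[OF that(2)]] hU(2)[OF B_V(1)[OF that(2)]] by metis
  qed
  have B_open: "openin (top_of_set ?E) B"
  proof -
    have "open {v. q v < r\<^sup>2}"
      using Cinf_on_continuous[OF q_smooth] by (intro open_Collect_less continuous_intros) auto
    moreover have "B = ?E \<inter> {v. q v < r\<^sup>2}" by (auto simp: B_def)
    ultimately show ?thesis by (metis openin_open_Int)
  qed
  have "B \<subseteq> V" using B_V(1) by blast
  have h_open: "openin (top_of_set (cdom c)) (h ` A)" if "openin (top_of_set B) A" for A
  proof -
    have "openin (top_of_set ?E) A" using openin_trans[OF that B_open] .
    then have "openin (top_of_set V) A"
      using openin_imp_subset[OF that] \<open>B \<subseteq> V\<close> openin_imp_subset[OF V] openin_subset_trans by blast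
    then have "openin (top_of_set U) (h ` A)"
      using homeomorphism_imp_open_map[OF homeomorphism_symD[OF h(1)]] by blast
    then show ?thesis
      using openin_trans openin_subset_trans[OF U(1,3) c.dom_subset] by blast
  qed
  have h_cont: "continuous_on B h"
    using continuous_on_subset[OF smooth_on_imp_continuous_on[OF h(3)] \<open>B \<subseteq> V\<close>] .
  have zB: "0 \<in> B"
    using subspace_0[OF c.model_subspace] q_scale[of 0 0] r(1) by (simp add: B_def)
  define c' where "c' = \<lparr>cmodel = ?E, cdom = B, cgroup = ?G, cact = (\<lambda>g. restrict (c.dact g) B),
    cproj = (\<lambda>v. cproj c (h v))\<rparr>"
  note [simp] = c'_def
  have chart': "orbifold_chart n X c'"
  proof (rule orbifold_chartI)
    show "diffeomorphic (cdom c') (cmodel c')"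
      using diffeomorphic_quadratic_ball[OF c.model_subspace q_smooth q_scale q_nonneg r(1)]
      by (simp add: B_def)
    show "faithful_action (cgroup c') (cdom c') (cact c')"
    proof (rule faithful_actionI)
      fix g assume g: "g \<in> carrier (cgroup c')" and fixed: "\<And>y. y \<in> cdom c' \<Longrightarrow> cact c' g y = y"
      \<comment> \<open>Trivial action on the ball means trivial action on its open image in
        \<open>c\<close>, where rigidity applies.\<close>
      have "g = \<one>\<^bsub>?G\<^esub>"
      proof (rule c.act_rigid)
        show "openin (top_of_set (cdom c)) (h ` B)" by (rule h_open) simp
        show "h ` B \<noteq> {}" using zB by blast
        show "cact c g y = y" if "y \<in> h ` B" for y
          using that g fixed h_equi by auto metis
      qed (use g in simp)
      then show "g = \<one>\<^bsub>cgroup c'\<^esub>" by simp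
    next
      fix g k y assume "g \<in> carrier (cgroup c')" "k \<in> carrier (cgroup c')" "y \<in> cdom c'"
      then show "cact c' (g \<otimes>\<^bsub>cgroup c'\<^esub> k) y = cact c' g (cact c' k y)"
        using B_dact by (auto simp: B_def c.dact_mult)
    qed (use B_dact in \<open>auto simp: B_def c.dact_one c.G.group_axioms\<close>)
    show "smooth_on (cdom c') (cact c' g)" if "g \<in> carrier (cgroup c')" for g
      by (rule smooth_on_cong[OF smooth_on_linear[OF c.linear_dact[of g]]]) (use that in auto)
    show "cact c' g 0 = 0" if "g \<in> carrier (cgroup c')" for g
      using that zB linear_0[OF c.linear_dact] by simp
    have "continuous_map (top_of_set B) (top_of_set (cdom c)) h"
      using h_cont B_V(3) by (auto simp: continuous_map_in_subtopology)
    from continuous_map_compose[OF this c.proj_continuous]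
    show "continuous_map (top_of_set (cdom c')) X (cproj c')"
      by (simp add: o_def)
    show "openin X (cproj c' ` A)" if "openin (top_of_set (cdom c')) A" for A
      using c.proj_open[OF h_open[of A]] that by (simp add: image_image)
    show "cproj c' y = cproj c' z \<longleftrightarrow> (\<exists>g\<in>carrier (cgroup c'). z = cact c' g y)"
      if yz: "y \<in> cdom c'" "z \<in> cdom c'" for y z
    proof -
      have yz': "y \<in> B" "z \<in> B" using yz by auto
      have "h z = cact c g (h y) \<longleftrightarrow> z = c.dact g y" if "g \<in> carrier ?G" for g
        using h_equi[OF that yz'(1)] hU(2)[OF B_V(1)] B_dact[OF that yz'(1)] yz' by metis
      then show ?thesis
        using c.proj_eq_iff[OF B_V(3) B_V(3), OF yz'] yz' by auto
    qed
  qed (use c.model_subspace c.model_dim B_open zB c.finite_group in auto)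
  moreover have "chart_embedding c' c h (\<lambda>g. g)"
    unfolding chart_embedding_def
  proof (intro conjI ballI)
    show "smooth_embedding (cdom c') (cdom c) h"
    proof (rule smooth_embeddingI[where g=\<Phi>])
      show "smooth_on (cdom c') h" using smooth_on_subset[OF h(3) \<open>B \<subseteq> V\<close>] by simp
      show "smooth_on (h ` cdom c') \<Phi>" by (rule smooth_on_subset[OF h(2)]) (use B_V(1) hU in auto)
    qed (use B_V hU in auto)
  qed (use h_equi in \<open>auto simp: hom_def\<close>)
  moreover have "ccentre c' = ccentre c" by (simp add: ccentre_def h0)
  moreover have "h ` cdom c' \<subseteq> W" using B_V(2) by (auto simp: U1_def)
  moreover have "cdom c' \<inter> K = {v\<in>cdom c'. f (h v) = 0}"
  proof -
    have "v \<in> K \<longleftrightarrow> f (h v) = 0" if "v \<in> B" for v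
      using N(3)[of "h v"] B_V(2)[OF that] hU(2)[OF B_V(1)[OF that]] by (simp add: U1_def)
    then show ?thesis by auto
  qed
  moreover have "diffeomorphic (cdom c' \<inter> K) K"
  proof -
    have "cdom c' \<inter> K = {v\<in>K. q v < r\<^sup>2}" by (auto simp: B_def K_def)
    then show ?thesis
      using diffeomorphic_quadratic_ball[OF K_subspace q_smooth q_scale q_nonneg r(1)] by metis
  qed
  ultimately show thesis by (intro that[of c' h]) auto
qed

end

section \<open>Induced charts\<close>

text \<open>From \<open>x\<close> one can move a little in every direction of \<open>M\<close>
  without leaving \<open>W\<close>; linear maps that agree at \<open>x\<close> and at
  \<open>x + t *\<^sub>R m\<close> with nonzero \<open>t\<close> agree at \<open>m\<close>.\<close>

lemma linear_eq_on_open: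
  fixes A B :: "'a::euclidean_space \<Rightarrow> 'a"
  assumes "linear A" "linear B" "subspace M" "openin (top_of_set M) W" "x \<in> W"
    and eq: "\<And>y. y \<in> W \<Longrightarrow> A y = B y" and m: "m \<in> M"
  shows "A m = B m"
proof -
  obtain e where e: "e > 0" "ball x e \<inter> M \<subseteq> W"
    using assms(4,5) by (meson openin_contains_ball)
  have x: "x \<in> M" using openin_imp_subset[OF assms(4)] assms(5) by blast
  \<comment> \<open>The summand 1 covers \<open>m = 0\<close> and makes
    \<open>norm (t *\<^sub>R m)\<close> smaller than \<open>e\<close>.\<close>
  define t where "t = e / (2 * (norm m + 1))"
  have t: "t > 0" using e(1) by (simp add: t_def add_nonneg_pos)
  have "norm (t *\<^sub>R m) < e"
  proof -
    have "norm (t *\<^sub>R m) = e * (norm m / (2 * (norm m + 1)))"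
      using e(1) by (simp add: t_def)
    also have "\<dots> < e * 1"
      using e(1) by (intro mult_strict_left_mono) (auto simp: divide_less_eq add_nonneg_pos)
    finally show ?thesis by simp
  qed
  then have "x + t *\<^sub>R m \<in> W"
    using e(2) x m assms(3) by (auto simp: dist_norm subspace_add subspace_scale)
  then have "A (x + t *\<^sub>R m) = B (x + t *\<^sub>R m)" by (rule eq)
  then have "t *\<^sub>R A m = t *\<^sub>R B m"
    using eq[OF assms(5)] assms(1,2) by (simp add: linear_add linear_scale)
  then show ?thesis using t by simp
qed

locale slice = orbi_chart n X c
  for n :: nat and X :: "'x topology" and c :: "('x, 'a::euclidean_space, 'g) orbichart" +
  fixes Y :: "'x set" and k :: nat and L :: "'a set"
  assumes slice: "slice_chart n X Y k c L"
begin

lemma slice_subspace: "subspace L" and slice_subset: "L \<subseteq> cmodel c" and slice_dim: "dim L = k"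
  and slice_preimage: "cdom c \<inter> L = {y\<in>cdom c. cproj c y \<in> Y}"
  and slice_diffeo: "diffeomorphic (cdom c \<inter> L) L"
  and act_linear: "g \<in> carrier (cgroup c) \<Longrightarrow> \<exists>A. linear A \<and> (\<forall>y\<in>cdom c. cact c g y = A y)"
  using slice unfolding slice_chart_def by blast+

lemma slice_iff: "y \<in> cdom c \<Longrightarrow> y \<in> L \<longleftrightarrow> cproj c y \<in> Y"
  using slice_preimage by blast

abbreviation "stab \<equiv> pointwise_stabilizer c (carrier (cgroup c)) (cdom c \<inter> L)"

abbreviation "induced \<equiv> induced_chart c (carrier (cgroup c)) L"

lemma induced_simps [simp]:
  "cmodel induced = L" "cdom induced = cdom c \<inter> L" "cproj induced = cproj c"
  "cgroup induced = cgroup c Mod stab"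
  by (simp_all add: induced_chart_def)

lemma slice_open: "openin (top_of_set L) (cdom c \<inter> L)"
proof -
  have "cmodel c \<inter> cdom c = cdom c" using dom_subset by blast
  then show ?thesis
    using openin_subtopology_Int_subset[OF _ slice_subset, of "cdom c"] dom_open
    by (simp add: Int_commute)
qed

lemma zero_slice: "0 \<in> cdom c \<inter> L"
  using zero_dom subspace_0[OF slice_subspace] by blast

lemma slice_act: "g \<in> carrier (cgroup c) \<Longrightarrow> y \<in> cdom c \<inter> L \<Longrightarrow> cact c g y \<in> cdom c \<inter> L"
  using slice_iff proj_act act_closed by auto

lemma slice_act_image: "g \<in> carrier (cgroup c) \<Longrightarrow> cact c g ` (cdom c \<inter> L) = cdom c \<inter> L"
  using slice_act slice_act[of "inv\<^bsub>cgroup c\<^esub> g"] act_inv(2)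
  by (auto simp: image_iff) (metis G.inv_closed Int_iff)

lemma stab_normal: "stab \<lhd> cgroup c"
  unfolding G.normal_inv_iff
proof (intro conjI ballI)
  show "subgroup stab (cgroup c)"
  proof (rule G.subgroupI)
    show "stab \<noteq> {}" using act_one by (auto simp: pointwise_stabilizer_def)
    show "inv\<^bsub>cgroup c\<^esub> g \<in> stab" if "g \<in> stab" for g
      using that act_inv(1) unfolding pointwise_stabilizer_def
      by (smt (verit) G.inv_closed IntD1 mem_Collect_eq)
    show "g \<otimes>\<^bsub>cgroup c\<^esub> h \<in> stab" if "g \<in> stab" "h \<in> stab" for g h
      using that by (auto simp: pointwise_stabilizer_def act_mult)
  qed (auto simp: pointwise_stabilizer_def)
  fix g h assume gh: "g \<in> carrier (cgroup c)" "h \<in> stab"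
  then have h: "h \<in> carrier (cgroup c)" "\<And>y. y \<in> cdom c \<inter> L \<Longrightarrow> cact c h y = y"
    by (auto simp: pointwise_stabilizer_def)
  have "cact c (g \<otimes>\<^bsub>cgroup c\<^esub> h \<otimes>\<^bsub>cgroup c\<^esub> inv\<^bsub>cgroup c\<^esub> g) y = y" if y: "y \<in> cdom c \<inter> L" for y
    using y gh(1) h slice_act[of "inv\<^bsub>cgroup c\<^esub> g" y] act_inv(2)
    by (simp add: act_mult act_closed)
  then show "g \<otimes>\<^bsub>cgroup c\<^esub> h \<otimes>\<^bsub>cgroup c\<^esub> inv\<^bsub>cgroup c\<^esub> g \<in> stab"
    using gh(1) h(1) by (simp add: pointwise_stabilizer_def)
qed

text \<open>The representative picked by \<open>SOME\<close> is \<open>g\<close> multiplied on the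
  left by an element of \<open>stab\<close>, which acts trivially once \<open>g\<close> has moved
  \<open>y\<close> within the slice.\<close>

lemma induced_act:
  assumes g: "g \<in> carrier (cgroup c)" and y: "y \<in> cdom c \<inter> L"
  shows "cact induced (stab #>\<^bsub>cgroup c\<^esub> g) y = cact c g y"
proof -
  interpret normal stab "cgroup c" by (rule stab_normal)
  let ?g = "SOME h. h \<in> stab #>\<^bsub>cgroup c\<^esub> g"
  have "?g \<in> stab #>\<^bsub>cgroup c\<^esub> g"
    using G.rcos_self[OF g subgroup_axioms] by (rule someI)
  then obtain h where h: "h \<in> stab" "?g = h \<otimes>\<^bsub>cgroup c\<^esub> g"
    by (auto simp: r_coset_def)
  then have "cact c ?g y = cact c g y"
  proof -
    have "h \<in> carrier (cgroup c)" "\<And>z. z \<in> cdom c \<inter> L \<Longrightarrow> cact c h z = z"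
      using h(1) unfolding pointwise_stabilizer_def by blast+
    then show ?thesis
      unfolding h(2) using act_mult[of y h g] slice_act[OF g y] g y by auto
  qed
  then show ?thesis using y by (simp add: induced_chart_def)
qed

lemma induced_orbifold_chart: "orbifold_chart k (subtopology X Y) induced"
proof (rule orbifold_chartI)
  interpret N: normal stab "cgroup c" by (rule stab_normal)
  have carrier: "C \<in> carrier (cgroup induced) \<Longrightarrow> \<exists>g\<in>carrier (cgroup c). C = stab #>\<^bsub>cgroup c\<^esub> g" for C
    by (auto simp: carrier_FactGroup)
  have coset: "g \<in> carrier (cgroup c) \<Longrightarrow> stab #>\<^bsub>cgroup c\<^esub> g \<in> carrier (cgroup induced)" for g
    by (auto simp: carrier_FactGroup)
  show "finite (carrier (cgroup induced))"
    using finite_group by (simp add: carrier_FactGroup)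
  show "faithful_action (cgroup induced) (cdom induced) (cact induced)"
  proof (rule faithful_actionI)
    show "group (cgroup induced)" using N.factorgroup_is_group by simp
    show "cact induced C y \<in> cdom induced" if C: "C \<in> carrier (cgroup induced)" and y: "y \<in> cdom induced" for C y
      using carrier[OF C] y induced_act slice_act by auto
    show "cact induced C \<in> extensional (cdom induced)" for C
      by (simp add: induced_chart_def)
    show "cact induced \<one>\<^bsub>cgroup induced\<^esub> y = y" if "y \<in> cdom induced" for y
    proof -
      have "\<one>\<^bsub>cgroup induced\<^esub> = stab #>\<^bsub>cgroup c\<^esub> \<one>\<^bsub>cgroup c\<^esub>"
        using N.subset by (simp add: G.coset_mult_one)
      then show ?thesis using that induced_act[of "\<one>\<^bsub>cgroup c\<^esub>" y] act_one by auto
    qed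
    show "cact induced (C \<otimes>\<^bsub>cgroup induced\<^esub> D) y = cact induced C (cact induced D y)"
      if CD: "C \<in> carrier (cgroup induced)" "D \<in> carrier (cgroup induced)" and y: "y \<in> cdom induced" for C D y
    proof -
      obtain g h where gh: "g \<in> carrier (cgroup c)" "C = stab #>\<^bsub>cgroup c\<^esub> g"
        "h \<in> carrier (cgroup c)" "D = stab #>\<^bsub>cgroup c\<^esub> h"
        using carrier CD by metis
      have "C \<otimes>\<^bsub>cgroup induced\<^esub> D = stab #>\<^bsub>cgroup c\<^esub> (g \<otimes>\<^bsub>cgroup c\<^esub> h)"
        using gh N.rcos_sum by simp
      then show ?thesis
        using gh y induced_act slice_act act_mult by simp
    qed
    show "C = \<one>\<^bsub>cgroup induced\<^esub>"
      if C: "C \<in> carrier (cgroup induced)" and triv: "\<And>y. y \<in> cdom induced \<Longrightarrow> cact induced C y = y" for C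
    proof -
      obtain g where g: "g \<in> carrier (cgroup c)" "C = stab #>\<^bsub>cgroup c\<^esub> g"
        using carrier C by metis
      have "cact c g y = y" if "y \<in> cdom c \<inter> L" for y
        using triv[of y] induced_act[OF g(1) that] that g(2) by simp
      then have "g \<in> stab"
        unfolding pointwise_stabilizer_def using g(1) by blast
      then show ?thesis
        using g G.coset_join2[OF g(1) N.subgroup_axioms] by simp
    qed
  qed
  show "smooth_on (cdom induced) (cact induced C)" if C: "C \<in> carrier (cgroup induced)" for C
  proof -
    obtain g where g: "g \<in> carrier (cgroup c)" "C = stab #>\<^bsub>cgroup c\<^esub> g"
      using carrier C by metis
    show ?thesis
      unfolding g(2)
      by (rule smooth_on_cong[OF smooth_on_subset[OF act_smooth[OF g(1)]]]) (use induced_act[OF g(1)] in auto)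
  qed
  show "cact induced C 0 = 0" if C: "C \<in> carrier (cgroup induced)" for C
    using carrier[OF C] induced_act zero_slice act_zero by auto
  have "continuous_map (top_of_set (cdom c \<inter> L)) X (cproj c)"
    using continuous_map_from_subtopology[OF proj_continuous, of L] by (simp add: subtopology_subtopology)
  then show "continuous_map (top_of_set (cdom induced)) (subtopology X Y) (cproj induced)"
    using slice_iff by (auto simp: continuous_map_in_subtopology)
  show "openin (subtopology X Y) (cproj induced ` W)" if "openin (top_of_set (cdom induced)) W" for W
  proof -
    obtain V where V: "openin (top_of_set (cdom c)) V" "W = V \<inter> L"
    proof -
      obtain U where "open U" "W = (cdom c \<inter> L) \<inter> U"
        using \<open>openin (top_of_set (cdom induced)) W\<close> unfolding openin_open induced_simps by blast
      then show thesis using that[of "cdom c \<inter> U"] by (auto simp: openin_open)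
    qed
    \<comment> \<open>Points of the chart over \<open>Y\<close> are exactly those in
      \<open>L\<close>, so cutting \<open>V\<close> down to \<open>L\<close> cuts its image down to
      \<open>Y\<close>.\<close>
    have "cproj c ` W = cproj c ` V \<inter> Y"
      using V(2) openin_imp_subset[OF V(1)] slice_iff by blast
    then show ?thesis
      using proj_open[OF V(1)] by (auto simp: openin_subtopology)
  qed
  show "cproj induced y = cproj induced z \<longleftrightarrow> (\<exists>C\<in>carrier (cgroup induced). z = cact induced C y)"
    if "y \<in> cdom induced" "z \<in> cdom induced" for y z
  proof -
    have "(\<exists>C\<in>carrier (cgroup induced). z = cact induced C y) \<longleftrightarrow> (\<exists>g\<in>carrier (cgroup c). z = cact c g y)"
      using carrier coset induced_act that(1) by (metis induced_simps(2))
    then show ?thesis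
      using proj_eq_iff that by auto
  qed
qed (use slice_subspace slice_dim slice_open zero_slice slice_diffeo in simp_all)

lemma induced_supp: "csupp induced = csupp c \<inter> Y"
  using slice_iff by (auto simp: csupp_def)

lemma induced_centre: "ccentre induced = ccentre c"
  by (simp add: ccentre_def)

text \<open>Faithfulness of the induced chart turns agreement on the slice into equality of
  cosets.\<close>

lemma coset_eq_iff:
  assumes gh: "g \<in> carrier (cgroup c)" "h \<in> carrier (cgroup c)"
  shows "stab #>\<^bsub>cgroup c\<^esub> g = stab #>\<^bsub>cgroup c\<^esub> h \<longleftrightarrow> (\<forall>y\<in>cdom c \<inter> L. cact c g y = cact c h y)"
proof
  interpret I: orbi_chart k "subtopology X Y" induced
    by unfold_locales (rule induced_orbifold_chart)
  let ?g = "stab #>\<^bsub>cgroup c\<^esub> g" and ?h = "stab #>\<^bsub>cgroup c\<^esub> h"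
  show "\<forall>y\<in>cdom c \<inter> L. cact c g y = cact c h y" if "?g = ?h"
    using that induced_act gh by metis
  assume eq: "\<forall>y\<in>cdom c \<inter> L. cact c g y = cact c h y"
  have "cact induced ?g = cact induced ?h"
  proof (rule extensionalityI[of _ "cdom c \<inter> L"])
    show "cact induced ?g y = cact induced ?h y" if "y \<in> cdom c \<inter> L" for y
      using eq that induced_act[OF gh(1) that] induced_act[OF gh(2) that] by simp
  qed (simp_all add: induced_chart_def)
  then show "?g = ?h"
    by (rule inj_onD[OF I.faithful]) (use gh in \<open>auto simp: carrier_FactGroup\<close>)
qed

end

text \<open>\<open>\<psi>\<close> respects slices because both lie over \<open>Y\<close>. If two
  elements agree on the slice of \<open>c\<close>, their images under \<open>\<theta>\<close> agree
  on an open piece of \<open>M\<close>, hence on \<open>M\<close> by linearity; so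
  \<open>\<theta>\<close> descends to the quotients. Injectivity of the result comes from that of
  \<open>\<psi>\<close>.\<close>

lemma induced_chart_embedding:
  assumes "slice n X c Y k L" "slice n X d Y k M" and emb: "chart_embedding c d \<psi> \<theta>"
  shows "\<exists>\<psi> \<theta>. chart_embedding (induced_chart c (carrier (cgroup c)) L)
    (induced_chart d (carrier (cgroup d)) M) \<psi> \<theta>"
proof -
  interpret c: slice n X c Y k L by fact
  interpret d: slice n X d Y k M by fact
  interpret E: orbi_embedding n X c d \<psi> \<theta>
    using emb by unfold_locales
  interpret Nc: normal c.stab "cgroup c" by (rule c.stab_normal)
  interpret Nd: normal d.stab "cgroup d" by (rule d.stab_normal)
  have slice_map: "\<psi> y \<in> cdom d \<inter> M" if "y \<in> cdom c \<inter> L" for y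
    using that c.slice_iff d.slice_iff E.map_closed E.proj_map by auto
  \<comment> \<open>This is also the image of the slice of \<open>c\<close>, as both slices are the
    parts over \<open>Y\<close>; in this form it is visibly open in \<open>M\<close>.\<close>
  let ?W = "\<psi> ` cdom c \<inter> M"
  have "openin (top_of_set (cmodel d)) (\<psi> ` cdom c)"
    using openin_trans[OF E.open_image d.dom_open] by simp
  moreover have "cmodel d \<inter> \<psi> ` cdom c = \<psi> ` cdom c"
    using E.map_closed d.dom_subset by auto
  ultimately have W: "openin (top_of_set M) ?W"
    using openin_subtopology_Int_subset[OF _ d.slice_subset, of "\<psi> ` cdom c"] by (simp add: Int_commute)
  have W_slice: "\<exists>y\<in>cdom c \<inter> L. w = \<psi> y" if "w \<in> ?W" for w
    using that c.slice_iff d.slice_iff E.map_closed E.proj_map by auto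
  have \<psi>0: "\<psi> 0 \<in> ?W" using slice_map[OF c.zero_slice] c.zero_dom by blast
  define h where "h g = d.stab #>\<^bsub>cgroup d\<^esub> \<theta> g" for g
  have h_hom: "h \<in> hom (cgroup c) (cgroup d Mod d.stab)"
    using hom_compose[OF E.hom Nd.r_coset_hom_Mod] by (simp add: h_def[abs_def] o_def)
  have "h g = h g'"
    if g: "g \<in> carrier (cgroup c)" "g' \<in> carrier (cgroup c)"
      and eq: "c.stab #>\<^bsub>cgroup c\<^esub> g = c.stab #>\<^bsub>cgroup c\<^esub> g'" for g g'
  proof -
    have act_eq: "cact c g y = cact c g' y" if "y \<in> cdom c \<inter> L" for y
      using that eq c.coset_eq_iff[OF g] by blast
    obtain A where A: "linear A" "\<forall>y\<in>cdom d. cact d (\<theta> g) y = A y"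
      using d.act_linear[OF E.hom_closed[OF g(1)]] by blast
    obtain B where B: "linear B" "\<forall>y\<in>cdom d. cact d (\<theta> g') y = B y"
      using d.act_linear[OF E.hom_closed[OF g(2)]] by blast
    have AB: "A w = B w" if "w \<in> ?W" for w
    proof -
      obtain y where y: "y \<in> cdom c \<inter> L" "w = \<psi> y" using W_slice \<open>w \<in> ?W\<close> by blast
      then show ?thesis
        using act_eq[OF y(1)] E.equivariant[OF g(1)] E.equivariant[OF g(2)] A(2) B(2) E.map_closed
        by (metis IntD1)
    qed
    have "A z = B z" if "z \<in> M" for z
      by (rule linear_eq_on_open[OF A(1) B(1) d.slice_subspace W \<psi>0 AB that])
    then show ?thesis
      unfolding h_def using d.coset_eq_iff[OF E.hom_closed[OF g(1)] E.hom_closed[OF g(2)]] A(2) B(2) by simp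
  qed
  then obtain \<eta> where \<eta>: "\<eta> \<in> hom (cgroup c Mod c.stab) (cgroup d Mod d.stab)"
      "\<And>g. g \<in> carrier (cgroup c) \<Longrightarrow> \<eta> (c.stab #>\<^bsub>cgroup c\<^esub> g) = h g"
    using FactGroup_universal[OF h_hom c.stab_normal] by metis
  have "chart_embedding c.induced d.induced \<psi> \<eta>"
    unfolding chart_embedding_def
  proof (intro conjI ballI)
    show "smooth_embedding (cdom c.induced) (cdom d.induced) \<psi>"
    proof (rule smooth_embeddingI[where g="inv_into (cdom c) \<psi>"])
      show "\<psi> ` cdom c.induced \<subseteq> cdom d.induced" using slice_map by auto
      show "inv_into (cdom c) \<psi> (\<psi> y) = y" if "y \<in> cdom c.induced" for y
        using that E.map_inj by simp
      show "smooth_on (cdom c.induced) \<psi>" by (rule smooth_on_subset[OF E.map_smooth]) simp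
      show "smooth_on (\<psi> ` cdom c.induced) (inv_into (cdom c) \<psi>)"
        by (rule smooth_on_subset[OF E.inv_smooth]) auto
    qed
    show "\<eta> \<in> hom (cgroup c.induced) (cgroup d.induced)" using \<eta>(1) by simp
    show "inj_on \<eta> (carrier (cgroup c.induced))"
    proof (rule inj_onI)
      fix C D assume "C \<in> carrier (cgroup c.induced)" "D \<in> carrier (cgroup c.induced)" and eq: "\<eta> C = \<eta> D"
      then obtain g g' where g: "g \<in> carrier (cgroup c)" "C = c.stab #>\<^bsub>cgroup c\<^esub> g"
        "g' \<in> carrier (cgroup c)" "D = c.stab #>\<^bsub>cgroup c\<^esub> g'"
        by (auto simp: carrier_FactGroup)
      have "h g = h g'" using eq g \<eta>(2) by simp
      then have "cact d (\<theta> g) z = cact d (\<theta> g') z" if "z \<in> cdom d \<inter> M" for z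
        using that d.coset_eq_iff[OF E.hom_closed[OF g(1)] E.hom_closed[OF g(3)]] by (simp add: h_def)
      then have "\<psi> (cact c g y) = \<psi> (cact c g' y)" if "y \<in> cdom c \<inter> L" for y
        using that slice_map[OF that] E.equivariant g(1,3) by simp
      then have "cact c g y = cact c g' y" if "y \<in> cdom c \<inter> L" for y
        using that inj_onD[OF E.map_inj] c.act_closed g(1,3) by blast
      then show "C = D" using c.coset_eq_iff g by simp
    qed
    show "\<psi> (cact c.induced C y) = cact d.induced (\<eta> C) (\<psi> y)"
      if C: "C \<in> carrier (cgroup c.induced)" and y: "y \<in> cdom c.induced" for C y
    proof -
      obtain g where g: "g \<in> carrier (cgroup c)" "C = c.stab #>\<^bsub>cgroup c\<^esub> g"
        using C by (auto simp: carrier_FactGroup)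
      have y': "y \<in> cdom c \<inter> L" using y by simp
      show ?thesis
        using c.induced_act[OF g(1) y'] \<eta>(2)[OF g(1)] d.induced_act[OF E.hom_closed[OF g(1)] slice_map[OF y']]
          E.equivariant[OF g(1)] y' g(2) by (simp add: h_def)
    qed
    show "cproj d.induced (\<psi> y) = cproj c.induced y" if "y \<in> cdom c.induced" for y
      using that E.proj_map by simp
  qed
  then show ?thesis by blast
qed

section \<open>The preimage of a regular value\<close>

lemma chart_embedding_supp_subset:
  assumes "chart_embedding c d \<psi> \<theta>"
  shows "csupp c \<subseteq> csupp d"
proof
  fix x assume "x \<in> csupp c"
  then obtain y where y: "y \<in> cdom c" "x = cproj c y" by (auto simp: csupp_def)
  then have "cproj d (\<psi> y) = x" "\<psi> y \<in> cdom d"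
    using assms smooth_embeddingD(1)[of "cdom c" "cdom d" \<psi>] by (auto simp: chart_embedding_def)
  then show "x \<in> csupp d" by (auto simp: csupp_def)
qed

lemma paracompact_space_refinement:
  assumes "paracompact_space X" "\<forall>U\<in>\<U>. openin X U" "\<Union>\<U> = topspace X"
  obtains \<V> where "\<forall>V\<in>\<V>. openin X V \<and> (\<exists>U\<in>\<U>. V \<subseteq> U)" "\<Union>\<V> = topspace X" "locally_finite_in X \<V>"
proof -
  have "\<exists>\<V>. (\<forall>V\<in>\<V>. openin X V \<and> (\<exists>U\<in>\<U>. V \<subseteq> U)) \<and> \<Union>\<V> = topspace X \<and> locally_finite_in X \<V>"
    using assms(1)[unfolded paracompact_space_def, THEN spec[of _ \<U>]] assms(2,3) by simp
  then show thesis using that by (elim exE conjE)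
qed

text \<open>The complement of \<open>Y\<close> completes a relative cover to an open cover of
  \<open>X\<close>, whose refinement is then restricted to \<open>Y\<close>.\<close>

lemma paracompact_space_closedin_subtopology:
  assumes X: "paracompact_space X" and Y: "closedin X Y"
  shows "paracompact_space (subtopology X Y)"
  unfolding paracompact_space_def
proof (intro allI impI)
  have YX: "Y \<subseteq> topspace X" using closedin_subset[OF Y] .
  fix \<U> assume \<U>: "(\<forall>U\<in>\<U>. openin (subtopology X Y) U) \<and> \<Union>\<U> = topspace (subtopology X Y)"
  then have "\<exists>e. \<forall>U\<in>\<U>. openin X (e U) \<and> U = e U \<inter> Y"
    by (intro bchoice) (auto simp: openin_subtopology)
  then obtain e where e: "\<And>U. U \<in> \<U> \<Longrightarrow> openin X (e U)" "\<And>U. U \<in> \<U> \<Longrightarrow> U = e U \<inter> Y"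
    by metis
  let ?C = "insert (topspace X - Y) (e ` \<U>)"
  have Y_cover: "Y \<subseteq> \<Union>(e ` \<U>)"
    using \<U> e(2) YX by (auto simp: inf_absorb2)
  have op: "\<forall>U\<in>?C. openin X U" using e(1) Y by auto
  have "\<Union>?C = topspace X"
  proof -
    have "\<Union>?C \<subseteq> topspace X"
      using op openin_subset[of X] by (intro Union_least) auto
    moreover have "topspace X \<subseteq> \<Union>?C"
    proof
      fix x assume "x \<in> topspace X"
      then show "x \<in> \<Union>?C"
        using Y_cover by (cases "x \<in> Y") blast+
    qed
    ultimately show "\<Union>?C = topspace X" by (rule subset_antisym)
  qed
  then obtain \<V> where \<V>: "\<forall>V\<in>\<V>. openin X V \<and> (\<exists>U\<in>?C. V \<subseteq> U)" "\<Union>\<V> = topspace X" "locally_finite_in X \<V>"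
    by (rule paracompact_space_refinement[OF X op])
  \<comment> \<open>Members missing \<open>Y\<close> are dropped, so each remaining one comes from a
    set inside some \<open>e U'\<close> and not inside the complement of \<open>Y\<close>.\<close>
  let ?D = "{V \<inter> Y |V. V \<in> \<V> \<and> V \<inter> Y \<noteq> {}}"
  have refines: "openin (subtopology X Y) W \<and> (\<exists>U\<in>\<U>. W \<subseteq> U)" if "W \<in> ?D" for W
  proof -
    obtain V where V: "V \<in> \<V>" "V \<inter> Y \<noteq> {}" "W = V \<inter> Y" using \<open>W \<in> ?D\<close> by blast
    obtain U where "U \<in> ?C" "V \<subseteq> U"
      by (rule bexE[OF conjunct2[OF bspec[OF \<V>(1) V(1)]]]) (rule that)
    then obtain U' where "U' \<in> \<U>" "V \<subseteq> e U'" using V(2) by blast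
    then have "W \<subseteq> U'" using V(3) e(2)[of U'] by blast
    then show ?thesis
      using V \<V>(1) \<open>U' \<in> \<U>\<close> by (auto simp: openin_subtopology)
  qed
  have cover: "\<Union>?D = topspace (subtopology X Y)"
  proof -
    have "\<Union>?D = \<Union>\<V> \<inter> Y" by blast
    then show ?thesis using \<V>(2) by simp
  qed
  have "locally_finite_in (subtopology X Y) ?D"
    unfolding locally_finite_in_def
  proof (intro conjI ballI)
    show "\<Union>?D \<subseteq> topspace (subtopology X Y)" using cover by (rule equalityD1)
    fix x assume x: "x \<in> topspace (subtopology X Y)"
    then obtain N where N: "openin X N" "x \<in> N" "finite {U \<in> \<V>. U \<inter> N \<noteq> {}}"
      using \<V>(3) by (auto simp: locally_finite_in_def)
    have "{W \<in> ?D. W \<inter> (N \<inter> Y) \<noteq> {}} \<subseteq> (\<lambda>V. V \<inter> Y) ` {U \<in> \<V>. U \<inter> N \<noteq> {}}"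
      by auto
    then have fin: "finite {W \<in> ?D. W \<inter> (N \<inter> Y) \<noteq> {}}"
      by (rule finite_surj[OF N(3)])
    have "openin (subtopology X Y) (N \<inter> Y)" "x \<in> N \<inter> Y"
      using N(1,2) x by (auto simp: openin_subtopology)
    with fin show "\<exists>V. openin (subtopology X Y) V \<and> x \<in> V \<and> finite {U \<in> ?D. U \<inter> V \<noteq> {}}"
      by blast
  qed
  with cover show "\<exists>\<V>. (\<forall>V\<in>\<V>. openin (subtopology X Y) V \<and> (\<exists>U\<in>\<U>. V \<subseteq> U)) \<and>
      \<Union>\<V> = topspace (subtopology X Y) \<and> locally_finite_in (subtopology X Y) \<V>"
    by (intro exI[of _ ?D] conjI ballI) (rule conjunct1[OF refines] conjunct2[OF refines], assumption | assumption)+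
qed

section \<open>Slice charts along the preimage and the atlas made from them\<close>

locale regular_preimage =
  fixes Q :: "('x, 'a::euclidean_space, 'g) orbifold"
    and P :: "('y, 'b::euclidean_space, 'h) orbifold"
    and F :: "('x, 'a, 'g, 'y, 'b, 'h) orbimap"
    and p :: 'y
  assumes Q: "smooth_orbifold Q" and P: "smooth_orbifold P"
    and F: "complete_orbifold_map Q P F" and p: "regular_value Q P F p"
begin

abbreviation "X \<equiv> ospace Q"
definition "Y = {x \<in> topspace X. mfun F x = p}"
abbreviation "k \<equiv> odim Q - odim P"
abbreviation "ind c x \<equiv> induced_chart c (carrier (cgroup c)) (lift_kernel F x)"

lemma Y_subset: "Y \<subseteq> topspace X"
  by (auto simp: Y_def)

lemma closedin_Y: "closedin X Y"
proof -
  have "closedin (ospace P) {p}"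
    using P p by (simp add: smooth_orbifold_def regular_value_def closedin_Hausdorff_singleton)
  moreover have "continuous_map X (ospace P) (mfun F)"
    using F by (simp add: complete_orbifold_map_def)
  ultimately have "closedin X {x \<in> topspace X. mfun F x \<in> {p}}"
    using closedin_continuous_map_preimage by blast
  then show ?thesis by (simp add: Y_def)
qed

lemma src_chart:
  assumes "x \<in> Y"
  shows "chart_of Q (msrc F x)" "ccentre (msrc F x) = x" "orbifold_chart (odim Q) X (msrc F x)"
  using assms F by (auto simp: Y_def complete_orbifold_map_def chart_of_def)

lemma atlas_chart: "w \<in> oatlas Q \<Longrightarrow> orbifold_chart (odim Q) X w"
  using Q by (simp add: smooth_orbifold_def)

text \<open>The point to check is that the lift sends 0 to 0: it covers the map between the centres,
  and only 0 lies over a centre.\<close>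

lemma submersion:
  assumes x: "x \<in> Y"
  shows "orbi_submersion (odim Q) X (msrc F x) (odim P) (ospace P) (mtgt F x) (mlift F x) (mhom F x)"
proof -
  have xX: "x \<in> topspace X" and fx: "mfun F x = p" using x by (auto simp: Y_def)
  note M = F[unfolded complete_orbifold_map_def, THEN conjunct2, rule_format, OF xX]
  interpret c: orbi_chart "odim Q" X "msrc F x"
    by unfold_locales (rule src_chart(3)[OF x])
  interpret d: orbi_chart "odim P" "ospace P" "mtgt F x"
    by unfold_locales (use M in \<open>simp add: chart_of_def\<close>)
  have closed: "mlift F x y \<in> cdom (mtgt F x)" if "y \<in> cdom (msrc F x)" for y
    using M that by blast
  have "cproj (mtgt F x) (mlift F x 0) = ccentre (mtgt F x)"
    using M c.zero_dom by (simp add: ccentre_def)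
  then have "mlift F x 0 = 0"
    using d.proj_eq_centre_iff closed c.zero_dom by blast
  then show ?thesis
    using M closed p xX fx by unfold_locales (auto simp: regular_value_def)
qed

text \<open>The embedding into the given chart \<open>msrc F x\<close> makes all such charts at
  \<open>x\<close> comparable. The last clause ties the stabilizer, which is read off in the chart,
  to \<open>kernel_fixer\<close>, which refers only to the given lift.\<close>

definition good :: "'x \<Rightarrow> ('x, 'a, 'g) orbichart \<Rightarrow> bool" where
  "good x c \<longleftrightarrow> slice_chart (odim Q) X Y k c (lift_kernel F x) \<and>
     (\<exists>h. chart_embedding c (msrc F x) h (\<lambda>g. g)) \<and> cgroup c = cgroup (msrc F x) \<and> ccentre c = x \<and>
     pointwise_stabilizer c (carrier (cgroup c)) (cdom c \<inter> lift_kernel F x) = kernel_fixer F x"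

lemma good_slice: "good x c \<Longrightarrow> slice (odim Q) X c Y k (lift_kernel F x)"
  by unfold_locales (auto simp: good_def slice_chart_def)

lemma good_chart: "good x c \<Longrightarrow> orbifold_chart (odim Q) X c"
  by (simp add: good_def slice_chart_def)

lemma good_centre: "good x c \<Longrightarrow> ccentre c = x \<and> x \<in> csupp c"
  using orbi_chart.centre_supp[OF orbi_chart.intro[OF good_chart]] by (auto simp: good_def)

lemma exists_good:
  assumes x: "x \<in> Y" and W: "openin X W" "x \<in> W"
  shows "\<exists>c. good x c \<and> csupp c \<subseteq> W"
proof -
  let ?c = "msrc F x" and ?d = "mtgt F x" and ?f = "mlift F x"
  have xX: "x \<in> topspace X" and fx: "mfun F x = p" using x by (auto simp: Y_def)
  note M = F[unfolded complete_orbifold_map_def, THEN conjunct2, rule_format, OF xX]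
  interpret S: orbi_submersion "odim Q" X ?c "odim P" "ospace P" ?d ?f "mhom F x"
    by (rule submersion[OF x])
  have K: "S.K = lift_kernel F x" by (simp add: S.K_def lift_kernel_def)
  let ?W = "{y \<in> cdom ?c. cproj ?c y \<in> W}"
  have "openin (top_of_set (cdom ?c)) ?W"
    using openin_continuous_map_preimage[OF S.c.proj_continuous W(1)] by simp
  moreover have "0 \<in> ?W"
    using S.c.zero_dom W(2) src_chart(2)[OF x] by (simp add: ccentre_def)
  ultimately obtain c h where c: "orbifold_chart (odim Q) X c" "chart_embedding c ?c h (\<lambda>g. g)"
    "cgroup c = cgroup ?c" "cmodel c = cmodel ?c" "ccentre c = ccentre ?c" "h ` cdom c \<subseteq> ?W"
    "cdom c \<inter> S.K = {v\<in>cdom c. ?f (h v) = 0}" "diffeomorphic (cdom c \<inter> S.K) S.K"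
    "\<And>g v. g \<in> carrier (cgroup ?c) \<Longrightarrow> v \<in> cdom c \<Longrightarrow> cact c g v = S.c.dact g v"
    by (rule S.exists_linear_slice) blast
  interpret E: orbi_embedding "odim Q" X c ?c h "\<lambda>g. g"
    by unfold_locales (use c in auto)
  \<comment> \<open>The target chart is centred at \<open>p\<close>, and only 0 lies over its
    centre.\<close>
  have Y_iff: "cproj c v \<in> Y \<longleftrightarrow> ?f (h v) = 0" if v: "v \<in> cdom c" for v
  proof -
    have hv: "h v \<in> cdom ?c" using E.map_closed v by blast
    have "cproj c v \<in> topspace X"
      using E.c.supp_subset v by (auto simp: csupp_def)
    then have "cproj c v \<in> Y \<longleftrightarrow> mfun F (cproj ?c (h v)) = p"
      using E.proj_map[OF v] by (simp add: Y_def)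
    also have "\<dots> \<longleftrightarrow> cproj ?d (?f (h v)) = ccentre ?d"
      using M hv fx by simp
    also have "\<dots> \<longleftrightarrow> ?f (h v) = 0"
      using S.d.proj_eq_centre_iff[OF S.f_closed[OF hv]] .
    finally show ?thesis .
  qed
  have "slice_chart (odim Q) X Y k c S.K"
    unfolding slice_chart_def
  proof (intro conjI ballI)
    show "S.K \<subseteq> cmodel c" using c(4) by (auto simp: S.K_def)
    show "cdom c \<inter> S.K = {y \<in> cdom c. cproj c y \<in> Y}"
      using c(7) Y_iff by auto
    show "\<exists>A. linear A \<and> (\<forall>y\<in>cdom c. cact c g y = A y)" if "g \<in> carrier (cgroup c)" for g
      using S.c.linear_dact c(3,9) that by auto
  qed (use c S.K_subspace S.dim_K in auto)
  then interpret L: slice "odim Q" X c Y k S.K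
    by unfold_locales
  \<comment> \<open>The slice is a neighbourhood of 0 in the kernel, so a linear map that is the
    identity on the slice is the identity on the whole kernel.\<close>
  have "(\<forall>v\<in>cdom c \<inter> S.K. cact c g v = v) \<longleftrightarrow> (\<forall>v\<in>S.K. S.c.dact g v = v)"
    if g: "g \<in> carrier (cgroup ?c)" for g
  proof
    assume fixed: "\<forall>v\<in>cdom c \<inter> S.K. cact c g v = v"
    show "\<forall>v\<in>S.K. S.c.dact g v = v"
    proof
      fix v assume v: "v \<in> S.K"
      show "S.c.dact g v = v"
        by (rule linear_eq_on_open[OF S.c.linear_dact[OF g] linear_ident S.K_subspace L.slice_open L.zero_slice _ v])
          (use fixed c(9)[OF g] in auto)
    qed
  qed (use c(9)[OF g] in auto)
  then have "L.stab = kernel_fixer F x"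
    using c(3) K by (auto simp: pointwise_stabilizer_def kernel_fixer_def)
  then have "good x c"
    unfolding good_def using \<open>slice_chart _ _ _ _ c S.K\<close> c(2,3,5) K src_chart(2)[OF x] by auto
  moreover have "csupp c \<subseteq> W"
  proof
    fix z assume "z \<in> csupp c"
    then obtain v where v: "v \<in> cdom c" "z = cproj c v" by (auto simp: csupp_def)
    then have "z = cproj ?c (h v)" using E.proj_map by simp
    then show "z \<in> W" using c(6) v(1) by auto
  qed
  ultimately show ?thesis by blast
qed

text \<open>The atlas chart provided by \<open>chart_of\<close> need not be supported in
  \<open>W\<close>; a smaller one with the same centre embeds into it, and embeddings
  compose.\<close>

lemma atlas_embedding_near:
  assumes y: "y \<in> csupp c" and c: "chart_of Q c" and W: "openin X W" "y \<in> W"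
  shows "\<exists>w\<in>oatlas Q. ccentre w = y \<and> csupp w \<subseteq> W \<and> (\<exists>\<psi> \<theta>. chart_embedding w c \<psi> \<theta>)"
proof -
  obtain w1 \<psi>1 \<theta>1 where w1: "w1 \<in> oatlas Q" "ccentre w1 = y" "chart_embedding w1 c \<psi>1 \<theta>1"
    using c y unfolding chart_of_def by blast
  interpret w1: orbi_chart "odim Q" X w1
    by unfold_locales (rule atlas_chart[OF w1(1)])
  have "openin X (W \<inter> csupp w1)" "y \<in> W \<inter> csupp w1"
    using W w1.supp_open w1.centre_supp w1(2) by auto
  then obtain w where w: "w \<in> oatlas Q" "ccentre w = y" "csupp w \<subseteq> W \<inter> csupp w1"
    using Q unfolding smooth_orbifold_def by meson
  then obtain \<psi> \<theta> where "chart_embedding w w1 \<psi> \<theta>"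
    using Q w1(1) unfolding smooth_orbifold_def by (meson le_infE)
  then show ?thesis
    using chart_embedding_compose[OF _ w1(3)] w by blast
qed

text \<open>A small atlas chart \<open>w\<close> at \<open>x\<close> links the two given charts: it
  embeds into \<open>msrc F x\<close> and, through \<open>w1\<close>, into \<open>msrc F z\<close>.
  A good chart at \<open>x\<close> supported inside \<open>w\<close> factors through
  \<open>w\<close>.\<close>

lemma good_embeds_near:
  assumes x: "x \<in> Y" and z: "z \<in> Y" and xz: "x \<in> csupp (msrc F z)"
  shows "\<exists>N. openin X N \<and> x \<in> N \<and>
    (\<forall>c. good x c \<and> csupp c \<subseteq> N \<longrightarrow> (\<exists>\<psi> \<theta>. chart_embedding c (msrc F z) \<psi> \<theta>))"
proof -
  obtain w1 \<psi>1 \<theta>1 where w1: "w1 \<in> oatlas Q" "ccentre w1 = x" "chart_embedding w1 (msrc F z) \<psi>1 \<theta>1"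
    using src_chart(1)[OF z] xz unfolding chart_of_def by blast
  interpret w1: orbi_chart "odim Q" X w1
    by unfold_locales (rule atlas_chart[OF w1(1)])
  interpret cx: orbi_chart "odim Q" X "msrc F x"
    by unfold_locales (rule src_chart(3)[OF x])
  obtain w \<psi>2 \<theta>2 where w: "w \<in> oatlas Q" "ccentre w = x" "csupp w \<subseteq> csupp w1" "chart_embedding w (msrc F x) \<psi>2 \<theta>2"
    using atlas_embedding_near[OF _ src_chart(1)[OF x] w1.supp_open, of x]
      w1.centre_supp w1(2) cx.centre_supp src_chart(2)[OF x] by auto
  obtain \<psi>3 \<theta>3 where e3: "chart_embedding w w1 \<psi>3 \<theta>3"
    using Q w1(1) w(1,3) unfolding smooth_orbifold_def by meson
  interpret w: orbi_chart "odim Q" X w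
    by unfold_locales (rule atlas_chart[OF w(1)])
  have "\<exists>\<psi> \<theta>. chart_embedding c (msrc F z) \<psi> \<theta>" if c: "good x c" "csupp c \<subseteq> csupp w" for c
  proof -
    obtain h where h: "chart_embedding c (msrc F x) h (\<lambda>g. g)" using c(1) by (auto simp: good_def)
    obtain \<psi> \<theta> where "chart_embedding c w \<psi> \<theta>"
      using chart_embedding_factor[OF good_chart[OF c(1)] w.chart cx.chart h w(4) c(2)] by blast
    then show ?thesis
      using chart_embedding_compose chart_embedding_compose[OF e3 w1(3)] by blast
  qed
  then show ?thesis
    using w.supp_open w.centre_supp w(2) by blast
qed

text \<open>The base charts \<open>b z\<close> are indexed by the members of a point-finite cover. A neighbourhood
  \<open>N x\<close> is shrunk with respect to the finitely many members that contain \<open>x\<close>.\<close>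

lemma exists_adapted_neighbourhoods:
  "\<exists>N. \<forall>x\<in>Y. openin X (N x) \<and> x \<in> N x \<and>
     (\<exists>z b. good z b \<and> (\<forall>y\<in>Y \<inter> N x. \<forall>c. good y c \<and> csupp c \<subseteq> N y \<longrightarrow> (\<exists>\<psi> \<theta>. chart_embedding c b \<psi> \<theta>)))"
proof -
  have "\<forall>z\<in>Y. \<exists>b. good z b"
    using exists_good[OF _ openin_topspace] Y_subset by blast
  then obtain b where b: "\<And>z. z \<in> Y \<Longrightarrow> good z (b z)" by metis
  \<comment> \<open>The supports are only known to cover \<open>Y\<close>; the complement is added
    because the refinement is taken in \<open>X\<close>.\<close>
  let ?C = "insert (topspace X - Y) ((\<lambda>z. csupp (b z)) ` Y)"
  have op: "\<forall>U\<in>?C. openin X U"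
    using closedin_Y b good_chart by (auto simp: orbifold_chart_def)
  have "\<Union>?C = topspace X"
  proof
    show "\<Union>?C \<subseteq> topspace X"
      using op openin_subset[of X] by (intro Union_least) auto
    show "topspace X \<subseteq> \<Union>?C"
    proof
      fix x assume "x \<in> topspace X"
      then show "x \<in> \<Union>?C"
        using good_centre[OF b] by (cases "x \<in> Y") auto
    qed
  qed
  moreover have "paracompact_space X" using Q by (simp add: smooth_orbifold_def)
  ultimately obtain \<V> where \<V>: "\<forall>V\<in>\<V>. openin X V \<and> (\<exists>U\<in>?C. V \<subseteq> U)" "\<Union>\<V> = topspace X" "locally_finite_in X \<V>"
    using paracompact_space_refinement[OF _ op] by metis
  have "\<forall>V\<in>{V\<in>\<V>. V \<inter> Y \<noteq> {}}. \<exists>z. z \<in> Y \<and> V \<subseteq> csupp (b z)"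
  proof
    fix V assume "V \<in> {V\<in>\<V>. V \<inter> Y \<noteq> {}}"
    then have V: "V \<in> \<V>" "V \<inter> Y \<noteq> {}" by auto
    obtain U where "U \<in> ?C" "V \<subseteq> U"
      by (rule bexE[OF conjunct2[OF bspec[OF \<V>(1) V(1)]]]) (rule that)
    then show "\<exists>z. z \<in> Y \<and> V \<subseteq> csupp (b z)" using V(2) by blast
  qed
  from bchoice[OF this]
  obtain z where z': "\<forall>V\<in>{V\<in>\<V>. V \<inter> Y \<noteq> {}}. z V \<in> Y \<and> V \<subseteq> csupp (b (z V))" ..
  have z: "z V \<in> Y \<and> V \<subseteq> csupp (b (z V))" if "V \<in> \<V>" "V \<inter> Y \<noteq> {}" for V
    using z' that by blast
  have "\<forall>x\<in>Y. \<exists>V\<in>\<V>. x \<in> V" using \<V>(2) Y_subset by blast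
  then obtain V where V: "\<And>x. x \<in> Y \<Longrightarrow> V x \<in> \<V> \<and> x \<in> V x" by metis
  have "\<exists>M. openin X M \<and> x \<in> M \<and> (\<forall>c. good x c \<and> csupp c \<subseteq> M \<longrightarrow> (\<exists>\<psi> \<theta>. chart_embedding c (b (z U)) \<psi> \<theta>))"
    if x: "x \<in> Y" and U: "U \<in> \<V>" "x \<in> U" for x U
  proof -
    have zU: "z U \<in> Y" "U \<subseteq> csupp (b (z U))" using z[OF U(1)] x U(2) by blast+
    obtain h where h: "chart_embedding (b (z U)) (msrc F (z U)) h (\<lambda>g. g)"
      using b[OF zU(1)] by (auto simp: good_def)
    have "x \<in> csupp (msrc F (z U))"
      using chart_embedding_supp_subset[OF h] zU(2) U(2) by blast
    from good_embeds_near[OF x zU(1) this] obtain M where M: "openin X M" "x \<in> M"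
      "\<forall>c. good x c \<and> csupp c \<subseteq> M \<longrightarrow> (\<exists>\<psi> \<theta>. chart_embedding c (msrc F (z U)) \<psi> \<theta>)" by blast
    \<comment> \<open>Both \<open>c\<close> and the base chart embed into
      \<open>msrc F (z U)\<close>, and the support of \<open>c\<close> is the smaller one, so the
      embedding factors.\<close>
    have "\<exists>\<psi> \<theta>. chart_embedding c (b (z U)) \<psi> \<theta>" if c: "good x c" "csupp c \<subseteq> M \<inter> U" for c
    proof -
      obtain \<psi> \<theta> where "chart_embedding c (msrc F (z U)) \<psi> \<theta>" using M(3) c by blast
      then show ?thesis
        using chart_embedding_factor[OF good_chart[OF c(1)] good_chart[OF b[OF zU(1)]] src_chart(3)[OF zU(1)] _ h]
          c(2) zU(2) by blast
    qed
    then show ?thesis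
      using M(1,2) U \<V>(1) by (intro exI[of _ "M \<inter> U"]) auto
  qed
  then obtain M where M: "\<And>x U. x \<in> Y \<Longrightarrow> U \<in> \<V> \<Longrightarrow> x \<in> U \<Longrightarrow> openin X (M x U) \<and> x \<in> M x U \<and>
      (\<forall>c. good x c \<and> csupp c \<subseteq> M x U \<longrightarrow> (\<exists>\<psi> \<theta>. chart_embedding c (b (z U)) \<psi> \<theta>))"
    by metis
  \<comment> \<open>All members containing \<open>x\<close> count, not only the chosen
    \<open>V x\<close>: if \<open>y\<close> lies in \<open>N x\<close>, then \<open>V x\<close> is
    among the members containing \<open>y\<close>, so \<open>N y\<close> lies in
    \<open>M y (V x)\<close>, and charts small at \<open>y\<close> embed into the base chart chosen
    for \<open>x\<close>. Local finiteness keeps the intersection open.\<close>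
  define N where "N x = V x \<inter> (\<Inter>U\<in>{U\<in>\<V>. x \<in> U}. M x U)" for x
  have "openin X (N x) \<and> x \<in> N x" if x: "x \<in> Y" for x
  proof -
    obtain O' where "x \<in> O'" "finite {U \<in> \<V>. U \<inter> O' \<noteq> {}}"
      using \<V>(3) x Y_subset unfolding locally_finite_in_def by blast
    then have "finite {U\<in>\<V>. x \<in> U}"
      by (elim finite_subset[rotated]) auto
    moreover have "{U\<in>\<V>. x \<in> U} \<noteq> {}" using V[OF x] by blast
    ultimately have "openin X (\<Inter>U\<in>{U\<in>\<V>. x \<in> U}. M x U)"
      using M[OF x] by (intro openin_INT2) auto
    then show ?thesis
      using V[OF x] \<V>(1) M[OF x] by (auto simp: N_def)
  qed
  moreover have "\<exists>\<psi> \<theta>. chart_embedding c (b (z (V x))) \<psi> \<theta>"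
    if x: "x \<in> Y" and y: "y \<in> Y \<inter> N x" and c: "good y c" "csupp c \<subseteq> N y" for x y c
  proof -
    have "V x \<in> \<V>" "y \<in> V x" using V[OF x] y by (auto simp: N_def)
    moreover then have "csupp c \<subseteq> M y (V x)" using c(2) unfolding N_def by blast
    ultimately show ?thesis using M y c(1) by blast
  qed
  moreover have "good (z (V x)) (b (z (V x)))" if "x \<in> Y" for x
    using b z V[OF that] that by blast
  ultimately show ?thesis by (intro exI[of _ N]) blast
qed

definition N :: "'x \<Rightarrow> 'x set" where
  "N = (SOME N. \<forall>x\<in>Y. openin X (N x) \<and> x \<in> N x \<and>
     (\<exists>z b. good z b \<and> (\<forall>y\<in>Y \<inter> N x. \<forall>c. good y c \<and> csupp c \<subseteq> N y \<longrightarrow> (\<exists>\<psi> \<theta>. chart_embedding c b \<psi> \<theta>))))"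

lemma N:
  assumes "x \<in> Y"
  shows "openin X (N x)" "x \<in> N x"
    and "\<exists>z b. good z b \<and> (\<forall>y\<in>Y \<inter> N x. \<forall>c. good y c \<and> csupp c \<subseteq> N y \<longrightarrow> (\<exists>\<psi> \<theta>. chart_embedding c b \<psi> \<theta>))"
  using someI_ex[OF exists_adapted_neighbourhoods] assms unfolding N_def by blast+

definition preimage :: "('x, 'a, 'g set) orbifold" where
  "preimage = \<lparr>ospace = subtopology X Y, odim = k,
     oatlas = {ind c x |x c. x \<in> Y \<and> good x c \<and> csupp c \<subseteq> N x}\<rparr>"

lemma preimage_simps [simp]:
  "ospace preimage = subtopology X Y" "odim preimage = k"
  "oatlas preimage = {ind c x |x c. x \<in> Y \<and> good x c \<and> csupp c \<subseteq> N x}"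
  by (simp_all add: preimage_def)

lemma good_induced:
  assumes "good x c"
  shows "orbifold_chart k (subtopology X Y) (ind c x)" "csupp (ind c x) = csupp c \<inter> Y" "ccentre (ind c x) = x"
  using slice.induced_orbifold_chart[OF good_slice[OF assms]] slice.induced_supp[OF good_slice[OF assms]]
    slice.induced_centre[OF good_slice[OF assms]] good_centre[OF assms] by auto

lemma preimage_smooth_orbifold: "smooth_orbifold preimage"
  unfolding smooth_orbifold_def
proof (intro conjI ballI allI impI)
  show "Hausdorff_space (ospace preimage)"
    using Q by (simp add: smooth_orbifold_def Hausdorff_space_subtopology)
  show "paracompact_space (ospace preimage)"
    using Q closedin_Y by (simp add: smooth_orbifold_def paracompact_space_closedin_subtopology)
  show "orbifold_chart (odim preimage) (ospace preimage) c" if "c \<in> oatlas preimage" for c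
    using that good_induced(1) by auto
  show "\<exists>c\<in>oatlas preimage. ccentre c = x \<and> csupp c \<subseteq> U"
    if xU: "openin (ospace preimage) U \<and> x \<in> U" for x U
  proof -
    obtain W where W: "openin X W" "U = W \<inter> Y" using xU by (auto simp: openin_subtopology)
    have x: "x \<in> Y" using xU W(2) by blast
    have "openin X (W \<inter> N x)" "x \<in> W \<inter> N x" using W N[OF x] xU by auto
    then obtain c where "good x c" "csupp c \<subseteq> W \<inter> N x"
      using exists_good[OF x] by blast
    then show ?thesis
      using x W(2) good_induced(2,3) by (intro bexI[of _ "ind c x"]) auto
  qed
  show "\<exists>\<psi> \<theta>. chart_embedding c d \<psi> \<theta>"
    if cd: "c \<in> oatlas preimage" "d \<in> oatlas preimage" and sub: "csupp c \<subseteq> csupp d" for c d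
  proof -
    obtain y c' where c': "c = ind c' y" "y \<in> Y" "good y c'" "csupp c' \<subseteq> N y" using cd(1) by auto
    obtain x d' where d': "d = ind d' x" "x \<in> Y" "good x d'" "csupp d' \<subseteq> N x" using cd(2) by auto
    obtain z b where b: "good z b"
      "\<And>y c. y \<in> Y \<inter> N x \<Longrightarrow> good y c \<Longrightarrow> csupp c \<subseteq> N y \<Longrightarrow> \<exists>\<psi> \<theta>. chart_embedding c b \<psi> \<theta>"
      using N(3)[OF d'(2)] by blast
    \<comment> \<open>Nested supports put the centre \<open>y\<close> of the smaller chart into
      \<open>N x\<close>, so the base chart \<open>b\<close> belonging to \<open>N x\<close>
      receives both charts, and its induced chart receives both induced ones.\<close>
    have "y \<in> csupp c' \<inter> Y" using good_centre[OF c'(3)] c'(2) by blast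
    then have "y \<in> N x"
      using sub good_induced(2)[OF c'(3)] good_induced(2)[OF d'(3)] d'(4) c'(1) d'(1) by auto
    then obtain \<psi>1 \<theta>1 where "chart_embedding c' b \<psi>1 \<theta>1" using b(2) c' by blast
    then obtain \<psi>1 \<theta>1 where e1: "chart_embedding c (ind b z) \<psi>1 \<theta>1"
      using induced_chart_embedding[OF good_slice[OF c'(3)] good_slice[OF b(1)]] c'(1) by blast
    obtain \<psi>2 \<theta>2 where "chart_embedding d' b \<psi>2 \<theta>2" using b(2) d' N(2) by blast
    then obtain \<psi>2 \<theta>2 where e2: "chart_embedding d (ind b z) \<psi>2 \<theta>2"
      using induced_chart_embedding[OF good_slice[OF d'(3)] good_slice[OF b(1)]] d'(1) by blast
    show ?thesis
      using chart_embedding_factor[OF good_induced(1)[OF c'(3)] good_induced(1)[OF d'(3)]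
          good_induced(1)[OF b(1)]] e1 e2 sub c'(1) d'(1) by blast
  qed
qed

text \<open>A small atlas chart at \<open>y\<close> embeds into \<open>msrc F x\<close>, and so does
  \<open>c\<close>; hence it factors through \<open>c\<close>.\<close>

lemma good_chart_of:
  assumes x: "x \<in> Y" and c: "good x c"
  shows "chart_of Q c"
  unfolding chart_of_def
proof (intro conjI ballI)
  show ch: "orbifold_chart (odim Q) X c" by (rule good_chart[OF c])
  obtain h where h: "chart_embedding c (msrc F x) h (\<lambda>g. g)" using c by (auto simp: good_def)
  fix y assume y: "y \<in> csupp c"
  then have "y \<in> csupp (msrc F x)" using chart_embedding_supp_subset[OF h] by blast
  moreover have "openin X (csupp c)" using ch by (simp add: orbifold_chart_def)
  ultimately obtain w \<psi> \<theta> where w: "w \<in> oatlas Q" "ccentre w = y" "csupp w \<subseteq> csupp c"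
    "chart_embedding w (msrc F x) \<psi> \<theta>"
    using atlas_embedding_near[OF _ src_chart(1)[OF x]] y by blast
  then show "\<exists>w\<in>oatlas Q. ccentre w = y \<and> csupp w \<subseteq> csupp c \<and> (\<exists>\<psi> \<theta>. chart_embedding w c \<psi> \<theta>)"
    using chart_embedding_factor[OF atlas_chart[OF w(1)] ch src_chart(3)[OF x] w(4) h w(3)] by blast
qed

lemma topspace_preimage: "topspace (ospace preimage) = Y"
  using Y_subset by auto

lemma preimage_full: "full_suborbifold Q preimage"
proof -
  have full: "\<exists>c L. ccentre c = x \<and> csupp c \<subseteq> W \<and> suborbifold_chart Q preimage c (carrier (cgroup c)) L"
    if x: "x \<in> Y" and W: "openin X W" "x \<in> W" for x W
  proof -
    have "openin X (W \<inter> N x)" "x \<in> W \<inter> N x" using W N[OF x] by auto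
    then obtain c where c: "good x c" "csupp c \<subseteq> W \<inter> N x"
      using exists_good[OF x] by blast
    interpret L: slice "odim Q" X c Y k "lift_kernel F x" by (rule good_slice[OF c(1)])
    have "ind c x \<in> oatlas preimage" using c x by auto
    then have "chart_of preimage (ind c x)"
      by (rule chart_of_atlas[OF preimage_smooth_orbifold])
    then have "suborbifold_chart Q preimage c (carrier (cgroup c)) (lift_kernel F x)"
      unfolding suborbifold_chart_def topspace_preimage
      using good_chart_of[OF x c(1)] L.G.subgroup_self L.slice_subspace L.slice_subset L.slice_act_image
        good_induced(2)[OF c(1)] by blast
    then show ?thesis using c good_centre by blast
  qed
  then have "suborbifold Q preimage"
    unfolding suborbifold_def topspace_preimage
    using preimage_smooth_orbifold Y_subset by auto blast
  then show ?thesis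
    unfolding full_suborbifold_def topspace_preimage using full by blast
qed

text \<open>Some atlas chart of \<open>preimage\<close> with centre \<open>x\<close> embeds into
  \<open>c\<close>, and an embedding between charts with a common centre is an isomorphism on
  groups.\<close>

lemma preimage_isotropy:
  assumes x: "x \<in> Y"
  shows "kernel_fixer F x \<lhd> cgroup (msrc F x)"
    and "chart_of preimage c \<Longrightarrow> ccentre c = x \<Longrightarrow> cgroup c \<cong> cgroup (msrc F x) Mod kernel_fixer F x"
proof -
  obtain c' where "good x c'"
    using exists_good[OF x openin_topspace] x Y_subset by blast
  then show normal: "kernel_fixer F x \<lhd> cgroup (msrc F x)"
    using slice.stab_normal[OF good_slice] by (metis good_def)
  assume c: "chart_of preimage c" "ccentre c = x"
  then interpret c: orbi_chart k "subtopology X Y" c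
    by unfold_locales (simp add: chart_of_def)
  have "x \<in> csupp c" using c.centre_supp c(2) by simp
  then obtain w \<psi> \<theta> where w: "w \<in> oatlas preimage" "ccentre w = x" "chart_embedding w c \<psi> \<theta>"
    using c(1) unfolding chart_of_def by blast
  \<comment> \<open>The point indexing an atlas chart is recovered as its centre, so
    \<open>w\<close> is induced by a good chart at \<open>x\<close> itself.\<close>
  then obtain d where d: "w = ind d x" "good x d"
    using good_induced(3) by auto
  interpret E: orbi_embedding k "subtopology X Y" w c \<psi> \<theta>
    using good_induced(1)[OF d(2)] d(1) w(3) c.chart by unfold_locales auto
  have "cgroup w \<cong> cgroup c"
    using E.iso_of_same_centre w(2) c(2) by (auto simp: is_iso_def)
  then have "cgroup c \<cong> cgroup w"
    by (rule E.c.G.iso_sym)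
  moreover have "cgroup w = cgroup d Mod kernel_fixer F x"
  proof -
    have "pointwise_stabilizer d (carrier (cgroup d)) (cdom d \<inter> lift_kernel F x) = kernel_fixer F x"
      using d(2) unfolding good_def by blast
    then show ?thesis
      unfolding d(1) slice.induced_simps(4)[OF good_slice[OF d(2)]] by (rule arg_cong)
  qed
  moreover have "cgroup d = cgroup (msrc F x)"
    using d(2) by (simp only: good_def)
  ultimately show "cgroup c \<cong> cgroup (msrc F x) Mod kernel_fixer F x"
    by simp
qed

end

theorem theorem13:
  fixes Q :: "('x, 'a::euclidean_space, 'g) orbifold"
    and P :: "('y, 'b::euclidean_space, 'h) orbifold"
    and F :: "('x, 'a, 'g, 'y, 'b, 'h) orbimap"
    and p :: 'y
  assumes "smooth_orbifold Q" and "smooth_orbifold P"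
    and "odim Q \<ge> odim P"
    and "complete_orbifold_map Q P F"
    and "regular_value Q P F p"
  shows "\<exists>S :: ('x, 'a, 'g set) orbifold.
           topspace (ospace S) = {x \<in> topspace (ospace Q). mfun F x = p} \<and>
           odim S = odim Q - odim P \<and>
           full_suborbifold Q S \<and>
           (\<forall>x\<in>topspace (ospace S).
              kernel_fixer F x \<lhd> cgroup (msrc F x) \<and>
              (\<forall>c. chart_of S c \<and> ccentre c = x \<longrightarrow>
                 cgroup c \<cong> cgroup (msrc F x) Mod kernel_fixer F x))"
proof -
  interpret regular_preimage Q P F p
    using assms by unfold_locales
  show ?thesis
    using topspace_preimage preimage_full preimage_isotropy
    by (intro exI[of _ preimage]) (simp add: Y_def)
qed

end
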